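(* Let $\{T_1,T_2\}$ be a dual pair of contractions in $\mathfrak H=\mathfrak H_1\oplus\mathfrak H_2$, $$T_1=\binom{T_{11}}{VD_{T_{11}}},\qquad T_2=\binom{T_{11}^*}{U^*D_{T_{11}^*}},$$ and let $\varphi_0\in[0,\pi/2)$. Suppose that both $T_1$ and $T_2$ satisfy $2\cot\varphi_0\,|\mathrm{Im}(T_jf,f)|\le\|D_{T_j}f\|^2$ for all $f\in\mathfrak H_1$ (for $\varphi_0=0$: $\mathrm{Im}(T_jf,f)=0$). Then: (i) there exist selfadjoint contractions $C_1,C_2$ in $\mathfrak H_1$, with $\ker C_1\supset\ker D_{T_{11}}$ and $\ker C_2\supset\ker D_{T_{11}^*}$, of the form $$C_1=D_VC'D_V,\qquad C_2=D_{U^*}C''D_{U^*},\qquad -I\le C',C''\le I,$$ such that for any $\varphi\in[\varphi_0,\pi/2)$, $\varphi>0$, $$2(T_{11}^* )_I=\tan\varphi\cdot D_{T_{11}}C_1(\varphi)D_{T_{11}}=\tan\varphi\cdot D_{T_{11}^*}C_2(\varphi)D_{T_{11}^*},$$ where $C_j(\varphi):=C_j\tan\varphi_0/\tan\varphi$, $j\in\{1,2\}$, are selfadjoint contractions; (ii) for any $\varphi\in(\varphi_0,\pi/2)$ the set $\mathrm{Ext}_{\{T_1,T_2\}}(\varphi)$ forms an operator hole: for an extension $T=(T_{ij})$ of $\{T_1,T_2\}$, $$T\in\mathrm{Ext}_{\{T_1,T_2\}}(\varphi)\iff T_{22}\sin\varphi\in L(\varphi):=B(C_+;R_l^+,R_r^+)\cap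 B(C_-;R_l^-,R_r^-),$$ where $$C_\pm:=\mp i\cos\varphi\cdot I-V_\pm(T_{11}^*\sin\varphi\mp i\cos\varphi)U_\pm,\qquad R_l^\pm=D_{V_\pm^*},\qquad R_r^\pm=D_{U_\pm},$$ and $V_\pm,U_\pm$ are contractions of the form $$V_\pm^*:=V_{1\pm}^*(I\pm C_1(\varphi))^{-1/2}V^*,\qquad U_\pm:=U_{1\pm}(I\pm C_2(\varphi))^{-1/2}U,$$ with uniquely determined partial isometries $V_{1\pm},U_{1\pm}$. In particular, $\mathrm{Ext}_{\{T_1,T_2\}}(\varphi)\neq\emptyset$ if and only if $L(\varphi)\neq\emptyset$.
   Context: Hilbert spaces are complex and separable. $[\mathfrak H,\mathfrak K]$ denotes bounded operators from $\mathfrak H$ to $\mathfrak K$, $[\mathfrak H]=[\mathfrak H,\mathfrak H]$. For a contraction $X$, $D_X:=(I-X^*X)^{1/2}$; $X_I:=(2i)^{-1}(X-X^* )$. A dual pair of contractions here is a pair of contractions $T_1,T_2\in[\mathfrak H_1,\mathfrak H]$ with $(T_1f,g)=(f,T_2g)$, $f,g\in\mathfrak H_1$; then $T_1=\binom{T_{11}}{T_{21}}$, $T_2=\binom{T_{11}^*}{T_{12}^*}$ with $T_{21}=VD_{T_{11}}$, $T_{12}=D_{T_{11}^*}U$, where the contractions $V\in[\mathfrak H_1,\mathfrak H_2]$, $U\in[\mathfrak H_2,\mathfrak H_1]$ are uniquely determined by $\ker V\supset\ker D_{T_{11}}$, $\ker U^*\supset\ker D_{T_{11}^*}$. An extension of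 $\{T_1,T_2\}$ is $T=\begin{pmatrix}T_{11}&T_{12}\\ T_{21}&T_{22}\end{pmatrix}\in[\mathfrak H]$ with $T_{22}\in[\mathfrak H_2]$ arbitrary. $\mathrm{Ext}_{\{T_1,T_2\}}(\varphi)$ is the set of extensions $T$ with $\|T\sin\varphi\pm i\cos\varphi\, I\|\le1$ for both signs. The operator ball $B(C;R_l,R_r)$ is the set of all $C+R_lKR_r$ with $\|K\|\le1$ (here $C,R_l,R_r\in[\mathfrak H_2]$, $R_l,R_r\ge0$). With $B_{11}^\pm:=T_{11}\sin\varphi\pm i\cos\varphi\, I$, the partial isometries are those determined by the polar-type decompositions $D_{B_{11}^\pm}=\sin\varphi\cdot V_{1\pm}^*(I\pm C_1(\varphi))^{1/2}D_{T_{11}}$ (with $V_{1\pm}^*$ having initial space $\overline{\mathrm{ran}}\,D_{T_{11}}$) and $D_{(B_{11}^{\pm})^*}=\sin\varphi\cdot U_{1\pm}(I\pm C_2(\varphi))^{1/2}D_{T_{11}^*}$ (with $U_{1\pm}$ having initial space $\overline{\mathrm{ran}}\,D_{T_{11}^*}$). *)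

theory Defs
  imports "HOL-Analysis.Analysis"
begin

class scaleC =
  fixes scaleC :: "complex \<Rightarrow> 'a \<Rightarrow> 'a"  (infixr "*\<^sub>C" 75)

text \<open>The inner product \<open>cinner\<close> is linear in its first argument. The real inner product of
  \<^class>\<open>real_inner\<close>, which determines the norm, is its real part. For metric spaces second
  countability is the same as separability.\<close>

class chilbert_space = real_inner + complete_space + second_countable_topology + scaleC +
  fixes cinner :: "'a \<Rightarrow> 'a \<Rightarrow> complex"
  assumes scaleC_add_right: "a *\<^sub>C (x + y) = a *\<^sub>C x + a *\<^sub>C y"
    and scaleC_add_left: "(a + b) *\<^sub>C x = a *\<^sub>C x + b *\<^sub>C x"
    and scaleC_scaleC: "a *\<^sub>C b *\<^sub>C x = (a * b) *\<^sub>C x"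
    and scaleR_scaleC: "r *\<^sub>R x = complex_of_real r *\<^sub>C x"
    and cinner_commute: "cinner x y = cnj (cinner y x)"
    and cinner_add_left: "cinner (x + y) z = cinner x z + cinner y z"
    and cinner_scaleC_left: "cinner (a *\<^sub>C x) y = a * cinner x y"
    and Re_cinner: "Re (cinner x y) = inner x y"
begin

subclass banach ..

end

text \<open>The orthogonal sum \<open>\<HH>\<^sub>1 \<oplus> \<HH>\<^sub>2\<close> is the product type; its norm, completeness and separability
  come from the library.\<close>

instantiation prod :: (chilbert_space, chilbert_space) chilbert_space
begin

definition scaleC_prod :: "complex \<Rightarrow> 'a \<times> 'b \<Rightarrow> 'a \<times> 'b"
  where "a *\<^sub>C x = (a *\<^sub>C fst x, a *\<^sub>C snd x)"

definition cinner_prod :: "'a \<times> 'b \<Rightarrow> 'a \<times> 'b \<Rightarrow> complex"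
  where "cinner x y = cinner (fst x) (fst y) + cinner (snd x) (snd y)"

instance
proof
  fix a b :: complex and r :: real and x y z :: "'a \<times> 'b"
  show "a *\<^sub>C (x + y) = a *\<^sub>C x + a *\<^sub>C y"
    by (simp add: scaleC_prod_def scaleC_add_right)
  show "(a + b) *\<^sub>C x = a *\<^sub>C x + b *\<^sub>C x"
    by (simp add: scaleC_prod_def scaleC_add_left)
  show "a *\<^sub>C b *\<^sub>C x = (a * b) *\<^sub>C x"
    by (simp add: scaleC_prod_def scaleC_scaleC)
  show "r *\<^sub>R x = complex_of_real r *\<^sub>C x"
    by (simp add: scaleC_prod_def scaleR_prod_def scaleR_scaleC)
  show "cinner x y = cnj (cinner y x)"
    by (simp add: cinner_prod_def cinner_commute[symmetric])
  show "cinner (x + y) z = cinner x z + cinner y z"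
    by (simp add: cinner_prod_def cinner_add_left)
  show "cinner (a *\<^sub>C x) y = a * cinner x y"
    by (simp add: cinner_prod_def scaleC_prod_def cinner_scaleC_left distrib_left)
  show "Re (cinner x y) = inner x y"
    by (simp add: cinner_prod_def inner_prod_def Re_cinner)
qed

end

lemma chilbert_scaleC_zero_right [simp]: "a *\<^sub>C (0::'a::chilbert_space) = 0"
  using scaleC_add_right[of a "0::'a" 0] by simp

lemma chilbert_scaleC_minus_right: "a *\<^sub>C (- x) = - (a *\<^sub>C (x::'a::chilbert_space))"
  using scaleC_add_right[of a x "- x"] by (simp add: eq_neg_iff_add_eq_0 add.commute)

lemma chilbert_norm_scaleC: "norm (a *\<^sub>C (x::'a::chilbert_space)) = cmod a * norm x"
proof -
  have "cinner (a *\<^sub>C x) (a *\<^sub>C x) = (a * cnj a) * cinner x x"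
    by (metis (no_types, lifting) cinner_commute cinner_scaleC_left complex_cnj_mult mult.assoc mult.commute)
  then have "inner (a *\<^sub>C x) (a *\<^sub>C x) = (cmod a)\<^sup>2 * inner x x"
    by (simp add: Re_cinner[symmetric] complex_norm_square[symmetric])
  then show ?thesis
    by (simp add: norm_eq_sqrt_inner real_sqrt_mult)
qed

lemma chilbert_bounded_linear_scaleC: "bounded_linear (\<lambda>x::'a::chilbert_space. a *\<^sub>C x)"
  by (rule bounded_linear_intro[of _ "cmod a"])
    (simp_all add: scaleC_add_right scaleR_scaleC scaleC_scaleC chilbert_norm_scaleC mult.commute)

typedef (overloaded) ('a, 'b) cblinfun ("(_ \<Rightarrow>\<^sub>C\<^sub>L /_)" [22, 21] 21) =
  "{f :: 'a::chilbert_space \<Rightarrow> 'b::chilbert_space.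
      bounded_linear f \<and> (\<forall>c x. f (c *\<^sub>C x) = c *\<^sub>C f x)}"
  morphisms cblinfun_apply CBlinfun
  by (rule exI[of _ "\<lambda>_. 0"]) simp

setup_lifting type_definition_cblinfun

declare [[coercion cblinfun_apply]]

instantiation cblinfun :: (chilbert_space, chilbert_space) real_normed_vector
begin

lift_definition zero_cblinfun :: "'a \<Rightarrow>\<^sub>C\<^sub>L 'b" is "\<lambda>_. 0"
  by simp

lift_definition plus_cblinfun :: "'a \<Rightarrow>\<^sub>C\<^sub>L 'b \<Rightarrow> 'a \<Rightarrow>\<^sub>C\<^sub>L 'b \<Rightarrow> 'a \<Rightarrow>\<^sub>C\<^sub>L 'b" is "\<lambda>f g x. f x + g x"
  by (auto intro: bounded_linear_add simp: scaleC_add_right)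

lift_definition uminus_cblinfun :: "'a \<Rightarrow>\<^sub>C\<^sub>L 'b \<Rightarrow> 'a \<Rightarrow>\<^sub>C\<^sub>L 'b" is "\<lambda>f x. - f x"
  by (auto intro: bounded_linear_minus simp: chilbert_scaleC_minus_right)

definition minus_cblinfun :: "'a \<Rightarrow>\<^sub>C\<^sub>L 'b \<Rightarrow> 'a \<Rightarrow>\<^sub>C\<^sub>L 'b \<Rightarrow> 'a \<Rightarrow>\<^sub>C\<^sub>L 'b"
  where "minus_cblinfun A B = A + - B"

lift_definition scaleR_cblinfun :: "real \<Rightarrow> 'a \<Rightarrow>\<^sub>C\<^sub>L 'b \<Rightarrow> 'a \<Rightarrow>\<^sub>C\<^sub>L 'b" is "\<lambda>r f x. r *\<^sub>R f x"
  by (simp add: bounded_linear_const_scaleR) (simp add: scaleR_scaleC scaleC_scaleC mult.commute)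

lift_definition norm_cblinfun :: "'a \<Rightarrow>\<^sub>C\<^sub>L 'b \<Rightarrow> real" is onorm .

definition sgn_cblinfun :: "'a \<Rightarrow>\<^sub>C\<^sub>L 'b \<Rightarrow> 'a \<Rightarrow>\<^sub>C\<^sub>L 'b"
  where "sgn_cblinfun A = inverse (norm A) *\<^sub>R A"

definition dist_cblinfun :: "'a \<Rightarrow>\<^sub>C\<^sub>L 'b \<Rightarrow> 'a \<Rightarrow>\<^sub>C\<^sub>L 'b \<Rightarrow> real"
  where "dist_cblinfun A B = norm (A - B)"

definition uniformity_cblinfun :: "(('a \<Rightarrow>\<^sub>C\<^sub>L 'b) \<times> ('a \<Rightarrow>\<^sub>C\<^sub>L 'b)) filter"
  where "uniformity_cblinfun = (INF e\<in>{0<..}. principal {(x, y). dist x y < e})"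

definition open_cblinfun :: "('a \<Rightarrow>\<^sub>C\<^sub>L 'b) set \<Rightarrow> bool"
  where "open_cblinfun S = (\<forall>x\<in>S. \<forall>\<^sub>F (x', y) in uniformity. x' = x \<longrightarrow> y \<in> S)"

instance
proof
  fix a b :: real and A B C :: "'a \<Rightarrow>\<^sub>C\<^sub>L 'b"
  show "A + B + C = A + (B + C)" "A + B = B + A" "0 + A = A" "- A + A = 0"
    by (transfer; force simp: ac_simps)+
  show "a *\<^sub>R (A + B) = a *\<^sub>R A + a *\<^sub>R B" "(a + b) *\<^sub>R A = a *\<^sub>R A + b *\<^sub>R A"
    "a *\<^sub>R b *\<^sub>R A = (a * b) *\<^sub>R A" "1 *\<^sub>R A = A"
    by (transfer; force simp: algebra_simps)+
  show "norm A = 0 \<longleftrightarrow> A = 0"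
    by transfer (auto simp: onorm_eq_0)
  show "norm (A + B) \<le> norm A + norm B"
    by transfer (auto intro: onorm_triangle)
  show "norm (a *\<^sub>R A) = \<bar>a\<bar> * norm A"
    by transfer (auto intro: onorm_scaleR)
qed (rule minus_cblinfun_def sgn_cblinfun_def dist_cblinfun_def uniformity_cblinfun_def
      open_cblinfun_def)+

end

instantiation cblinfun :: (chilbert_space, chilbert_space) scaleC
begin

lift_definition scaleC_cblinfun :: "complex \<Rightarrow> 'a \<Rightarrow>\<^sub>C\<^sub>L 'b \<Rightarrow> 'a \<Rightarrow>\<^sub>C\<^sub>L 'b" is "\<lambda>c f x. c *\<^sub>C f x"
  by (auto intro: bounded_linear_compose[OF chilbert_bounded_linear_scaleC]
      simp: scaleC_scaleC mult.commute)

instance ..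

end

lift_definition id_cblinfun :: "'a::chilbert_space \<Rightarrow>\<^sub>C\<^sub>L 'a" is "\<lambda>x. x"
  by simp

lift_definition cblinfun_compose ::
  "'b::chilbert_space \<Rightarrow>\<^sub>C\<^sub>L 'c::chilbert_space \<Rightarrow> 'a::chilbert_space \<Rightarrow>\<^sub>C\<^sub>L 'b \<Rightarrow> 'a \<Rightarrow>\<^sub>C\<^sub>L 'c"
    (infixl "o\<^sub>C\<^sub>L" 67) is "\<lambda>f g x. f (g x)"
  by (auto intro: bounded_linear_compose)

text \<open>The definite descriptions below are meaningful when the object exists and is unique: \<open>adj\<close>
  always, \<open>op_sqrt\<close> for \<open>A \<ge> 0\<close>, \<open>op_inverse\<close> for boundedly invertible \<open>A\<close>.\<close>

definition adj :: "'a::chilbert_space \<Rightarrow>\<^sub>C\<^sub>L 'b::chilbert_space \<Rightarrow> 'b \<Rightarrow>\<^sub>C\<^sub>L 'a"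
  where "adj A = (THE B :: 'b \<Rightarrow>\<^sub>C\<^sub>L 'a. \<forall>x y. cinner (A x) y = cinner x (B y))"

definition selfadjoint :: "'a::chilbert_space \<Rightarrow>\<^sub>C\<^sub>L 'a \<Rightarrow> bool"
  where "selfadjoint A \<longleftrightarrow> adj A = A"

definition positive_op :: "'a::chilbert_space \<Rightarrow>\<^sub>C\<^sub>L 'a \<Rightarrow> bool"
  where "positive_op A \<longleftrightarrow> (\<forall>x. Im (cinner (A x) x) = 0 \<and> 0 \<le> Re (cinner (A x) x))"

definition op_le :: "'a::chilbert_space \<Rightarrow>\<^sub>C\<^sub>L 'a \<Rightarrow> 'a \<Rightarrow>\<^sub>C\<^sub>L 'a \<Rightarrow> bool"  (infix "\<preceq>" 50)
  where "A \<preceq> B \<longleftrightarrow> positive_op (B - A)"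

definition op_sqrt :: "'a::chilbert_space \<Rightarrow>\<^sub>C\<^sub>L 'a \<Rightarrow> 'a \<Rightarrow>\<^sub>C\<^sub>L 'a"
  where "op_sqrt A = (THE B. positive_op B \<and> B o\<^sub>C\<^sub>L B = A)"

definition op_inverse :: "'a::chilbert_space \<Rightarrow>\<^sub>C\<^sub>L 'a \<Rightarrow> 'a \<Rightarrow>\<^sub>C\<^sub>L 'a"
  where "op_inverse A = (THE B. A o\<^sub>C\<^sub>L B = id_cblinfun \<and> B o\<^sub>C\<^sub>L A = id_cblinfun)"

definition im_part :: "'a::chilbert_space \<Rightarrow>\<^sub>C\<^sub>L 'a \<Rightarrow> 'a \<Rightarrow>\<^sub>C\<^sub>L 'a"
  where "im_part X = (1 / (2 * \<i>)) *\<^sub>C (X - adj X)"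

definition kernel :: "'a::chilbert_space \<Rightarrow>\<^sub>C\<^sub>L 'b::chilbert_space \<Rightarrow> 'a set"
  where "kernel A = {x. A x = 0}"

definition contraction :: "'a::chilbert_space \<Rightarrow>\<^sub>C\<^sub>L 'b::chilbert_space \<Rightarrow> bool"
  where "contraction X \<longleftrightarrow> norm X \<le> 1"

definition defect :: "'a::chilbert_space \<Rightarrow>\<^sub>C\<^sub>L 'b::chilbert_space \<Rightarrow> 'a \<Rightarrow>\<^sub>C\<^sub>L 'a"
  where "defect X = op_sqrt (id_cblinfun - adj X o\<^sub>C\<^sub>L X)"

definition orthogonal_complement :: "'a::chilbert_space set \<Rightarrow> 'a set"
  where "orthogonal_complement M = {x. \<forall>y\<in>M. cinner x y = 0}"

definition initial_space :: "'a::chilbert_space \<Rightarrow>\<^sub>C\<^sub>L 'b::chilbert_space \<Rightarrow> 'a set"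
  where "initial_space W = orthogonal_complement (kernel W)"

definition partial_isometry :: "'a::chilbert_space \<Rightarrow>\<^sub>C\<^sub>L 'b::chilbert_space \<Rightarrow> bool"
  where "partial_isometry W \<longleftrightarrow> (\<forall>x\<in>initial_space W. norm (W x) = norm x)"

lift_definition op_column ::
  "'a::chilbert_space \<Rightarrow>\<^sub>C\<^sub>L 'b::chilbert_space \<Rightarrow> 'a \<Rightarrow>\<^sub>C\<^sub>L 'c::chilbert_space \<Rightarrow> 'a \<Rightarrow>\<^sub>C\<^sub>L ('b \<times> 'c)"
  is "\<lambda>f g x. (f x, g x)"
  by (auto intro: bounded_linear_Pair simp: scaleC_prod_def)

lift_definition op_block ::
  "'a::chilbert_space \<Rightarrow>\<^sub>C\<^sub>L 'a \<Rightarrow> 'b::chilbert_space \<Rightarrow>\<^sub>C\<^sub>L 'a \<Rightarrow> 'a \<Rightarrow>\<^sub>C\<^sub>L 'b \<Rightarrow> 'b \<Rightarrow>\<^sub>C\<^sub>L 'b \<Rightarrow> ('a \<times> 'b) \<Rightarrow>\<^sub>C\<^sub>L ('a \<times> 'b)"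
  is "\<lambda>t11 t12 t21 t22 x. (t11 (fst x) + t12 (snd x), t21 (fst x) + t22 (snd x))"
  by (auto intro!: bounded_linear_Pair bounded_linear_add
      intro: bounded_linear_compose[OF _ bounded_linear_fst]
        bounded_linear_compose[OF _ bounded_linear_snd]
      simp: scaleC_prod_def scaleC_add_right)

definition dual_pair :: "'a::chilbert_space \<Rightarrow>\<^sub>C\<^sub>L ('a \<times> 'b::chilbert_space) \<Rightarrow> 'a \<Rightarrow>\<^sub>C\<^sub>L ('a \<times> 'b) \<Rightarrow> bool"
  where "dual_pair T1 T2 \<longleftrightarrow> contraction T1 \<and> contraction T2 \<and>
    (\<forall>f g. cinner (T1 f) (g, 0) = cinner (f, 0) (T2 g))"

definition dual_pair_extension ::
  "'a::chilbert_space \<Rightarrow>\<^sub>C\<^sub>L ('a \<times> 'b::chilbert_space) \<Rightarrow> 'a \<Rightarrow>\<^sub>C\<^sub>L ('a \<times> 'b) \<Rightarrow> ('a \<times> 'b) \<Rightarrow>\<^sub>C\<^sub>L ('a \<times> 'b) \<Rightarrow> bool"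
  where "dual_pair_extension T1 T2 T \<longleftrightarrow>
    (\<exists>T11 T12 T21 T22. T1 = op_column T11 T21 \<and> T2 = op_column (adj T11) (adj T12) \<and>
       T = op_block T11 T12 T21 T22)"

definition Ext ::
  "'a::chilbert_space \<Rightarrow>\<^sub>C\<^sub>L ('a \<times> 'b::chilbert_space) \<Rightarrow> 'a \<Rightarrow>\<^sub>C\<^sub>L ('a \<times> 'b) \<Rightarrow> real \<Rightarrow>
    (('a \<times> 'b) \<Rightarrow>\<^sub>C\<^sub>L ('a \<times> 'b)) set"
  where "Ext T1 T2 \<phi> = {T. dual_pair_extension T1 T2 T \<and>
    norm (sin \<phi> *\<^sub>R T + (\<i> * cos \<phi>) *\<^sub>C id_cblinfun) \<le> 1 \<and>
    norm (sin \<phi> *\<^sub>R T - (\<i> * cos \<phi>) *\<^sub>C id_cblinfun) \<le> 1}"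

text \<open>The library sets \<open>cot 0 = 0\<close>; hence the separate case, the limit of the condition
  as \<open>\<phi>\<close> tends to zero.\<close>

definition sector_condition :: "real \<Rightarrow> 'a::chilbert_space \<Rightarrow>\<^sub>C\<^sub>L ('a \<times> 'b::chilbert_space) \<Rightarrow> bool"
  where "sector_condition \<phi> T \<longleftrightarrow> (\<forall>f.
    if \<phi> = 0 then Im (cinner (T f) (f, 0)) = 0
    else 2 * cot \<phi> * \<bar>Im (cinner (T f) (f, 0))\<bar> \<le> (norm (defect T f))\<^sup>2)"

definition operator_ball ::
  "'a::chilbert_space \<Rightarrow>\<^sub>C\<^sub>L 'a \<Rightarrow> 'a \<Rightarrow>\<^sub>C\<^sub>L 'a \<Rightarrow> 'a \<Rightarrow>\<^sub>C\<^sub>L 'a \<Rightarrow> ('a \<Rightarrow>\<^sub>C\<^sub>L 'a) set"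
  where "operator_ball C Rl Rr = {C + Rl o\<^sub>C\<^sub>L K o\<^sub>C\<^sub>L Rr | K. norm K \<le> 1}"

text \<open>In the following definitions the real number \<open>s\<close>, which is \<open>1\<close> or \<open>-1\<close>, is the upper or
  lower sign in \<open>\<plusminus>\<close>, and \<open>C\<close>, \<open>C1\<close>, \<open>C2\<close> stand for \<open>C\<^sub>j(\<phi>)\<close>. The decompositions come from
  \<open>I - B\<^sup>*B = sin\<^sup>2\<phi> D(I \<plusminus> C\<^sub>1(\<phi>))D\<close> with \<open>B = B11 s \<phi> T11\<close>, \<open>D = defect T11\<close>, and its analogue for the
  adjoints.\<close>

definition B11 :: "real \<Rightarrow> real \<Rightarrow> 'a::chilbert_space \<Rightarrow>\<^sub>C\<^sub>L 'a \<Rightarrow> 'a \<Rightarrow>\<^sub>C\<^sub>L 'a"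
  where "B11 s \<phi> T11 = sin \<phi> *\<^sub>R T11 + (s * \<i> * cos \<phi>) *\<^sub>C id_cblinfun"

definition op_root :: "real \<Rightarrow> 'a::chilbert_space \<Rightarrow>\<^sub>C\<^sub>L 'a \<Rightarrow> 'a \<Rightarrow>\<^sub>C\<^sub>L 'a"
  where "op_root s C = op_sqrt (id_cblinfun + s *\<^sub>R C)"

definition V1_decomposition ::
  "real \<Rightarrow> real \<Rightarrow> 'a::chilbert_space \<Rightarrow>\<^sub>C\<^sub>L 'a \<Rightarrow> 'a \<Rightarrow>\<^sub>C\<^sub>L 'a \<Rightarrow> 'a \<Rightarrow>\<^sub>C\<^sub>L 'a \<Rightarrow> bool"
  where "V1_decomposition s \<phi> T11 C1 V1 \<longleftrightarrow>
    partial_isometry (adj V1) \<and> initial_space (adj V1) = closure (range (defect T11)) \<and>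
    defect (B11 s \<phi> T11) = sin \<phi> *\<^sub>R (adj V1 o\<^sub>C\<^sub>L op_root s C1 o\<^sub>C\<^sub>L defect T11)"

definition U1_decomposition ::
  "real \<Rightarrow> real \<Rightarrow> 'a::chilbert_space \<Rightarrow>\<^sub>C\<^sub>L 'a \<Rightarrow> 'a \<Rightarrow>\<^sub>C\<^sub>L 'a \<Rightarrow> 'a \<Rightarrow>\<^sub>C\<^sub>L 'a \<Rightarrow> bool"
  where "U1_decomposition s \<phi> T11 C2 U1 \<longleftrightarrow>
    partial_isometry U1 \<and> initial_space U1 = closure (range (defect (adj T11))) \<and>
    defect (adj (B11 s \<phi> T11)) = sin \<phi> *\<^sub>R (U1 o\<^sub>C\<^sub>L op_root s C2 o\<^sub>C\<^sub>L defect (adj T11))"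

definition V_sgn ::
  "real \<Rightarrow> 'a::chilbert_space \<Rightarrow>\<^sub>C\<^sub>L 'a \<Rightarrow> 'a \<Rightarrow>\<^sub>C\<^sub>L 'a \<Rightarrow> 'a \<Rightarrow>\<^sub>C\<^sub>L 'b::chilbert_space \<Rightarrow> 'a \<Rightarrow>\<^sub>C\<^sub>L 'b"
  where "V_sgn s C1 V1 V = adj (adj V1 o\<^sub>C\<^sub>L op_inverse (op_root s C1) o\<^sub>C\<^sub>L adj V)"

definition U_sgn ::
  "real \<Rightarrow> 'a::chilbert_space \<Rightarrow>\<^sub>C\<^sub>L 'a \<Rightarrow> 'a \<Rightarrow>\<^sub>C\<^sub>L 'a \<Rightarrow> 'b::chilbert_space \<Rightarrow>\<^sub>C\<^sub>L 'a \<Rightarrow> 'b \<Rightarrow>\<^sub>C\<^sub>L 'a"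
  where "U_sgn s C2 U1 U = U1 o\<^sub>C\<^sub>L op_inverse (op_root s C2) o\<^sub>C\<^sub>L U"

definition ball_center ::
  "real \<Rightarrow> real \<Rightarrow> 'a::chilbert_space \<Rightarrow>\<^sub>C\<^sub>L 'a \<Rightarrow> 'a \<Rightarrow>\<^sub>C\<^sub>L 'b::chilbert_space \<Rightarrow> 'b \<Rightarrow>\<^sub>C\<^sub>L 'a \<Rightarrow> 'b \<Rightarrow>\<^sub>C\<^sub>L 'b"
  where "ball_center s \<phi> T11 Vs Us =
    (- s * \<i> * cos \<phi>) *\<^sub>C id_cblinfun
    - Vs o\<^sub>C\<^sub>L (sin \<phi> *\<^sub>R adj T11 - (s * \<i> * cos \<phi>) *\<^sub>C id_cblinfun) o\<^sub>C\<^sub>L Us"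

definition sgn_ball ::
  "real \<Rightarrow> real \<Rightarrow> 'a::chilbert_space \<Rightarrow>\<^sub>C\<^sub>L 'a \<Rightarrow> 'a \<Rightarrow>\<^sub>C\<^sub>L 'b::chilbert_space \<Rightarrow> 'b \<Rightarrow>\<^sub>C\<^sub>L 'a \<Rightarrow> ('b \<Rightarrow>\<^sub>C\<^sub>L 'b) set"
  where "sgn_ball s \<phi> T11 Vs Us =
    operator_ball (ball_center s \<phi> T11 Vs Us) (defect (adj Vs)) (defect Us)"

end

theory Submission
  imports Defs
begin

text \<open>For a dual pair the defect of \<open>T\<^sub>1\<close> is \<open>\<parallel>D\<^bsub>V\<^esub> D f\<parallel>\<close> with \<open>D\<close> the defect operator of \<open>T\<^sub>1\<^sub>1\<close>, so the
  sector condition bounds the quadratic form of \<open>2(T\<^sub>1\<^sub>1\<^sup>*)\<^sub>I\<close> by \<open>tan \<phi>\<^sub>0 \<parallel>D\<^bsub>V\<^esub> D f\<parallel>\<^sup>2\<close>. A Douglas type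
  factorization of this form gives the contraction \<open>C'\<close>. Then \<open>I - B\<^sup>*B = sin\<^sup>2\<phi> D(I \<plusminus> C\<^sub>1(\<phi>))D\<close> for
  \<open>B = T\<^sub>1\<^sub>1 sin \<phi> \<plusminus> i cos \<phi>\<close>, with an invertible middle factor when \<open>\<phi> > \<phi>\<^sub>0\<close>, so the off-diagonal
  blocks of \<open>T sin \<phi> \<plusminus> i cos \<phi>\<close> are \<open>V\<^sub>\<plusminus> D\<^bsub>B\<^esub>\<close> and \<open>D\<^bsub>B*\<^esub> U\<^sub>\<plusminus>\<close>. A block operator of
  this shape is a contraction exactly when its last entry lies in the ball with center \<open>-V\<^sub>\<plusminus> B\<^sup>* U\<^sub>\<plusminus>\<close>
  and radii \<open>D\<^bsub>V*\<^esub>\<close> and \<open>D\<^bsub>U\<^esub>\<close>.\<close>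

section \<open>Riesz representation and adjoints\<close>

text \<open>Estimates run over the real inner product: \<open>cinner\<close> is recovered from
  \<open>inner\<close> by inserting the imaginary unit. Vectors are split along closures of ranges
  one at a time, and kernel inclusions govern the orthogonal parts. The sandwiched form
  \<open>D_V C' D_V\<close> matters twice. With \<open>k = tan \<phi>0 / tan \<phi>\<close> and
  \<open>C = D_V C' D_V\<close>, the difference of the forms of \<open>I \<plusminus> k C\<close>
  and \<open>V\<^sup>* V\<close> equals the form of \<open>I \<plusminus> k C'\<close> at
  \<open>D_V g\<close>, which is nonnegative; hence dividing \<open>V\<^sup>*\<close> by the root of
  \<open>I \<plusminus> k C\<close> still leaves a contraction. Also \<open>C\<close> has norm at
  most one, so for \<open>k < 1\<close> that root is boundedly invertible. At
  \<open>\<phi> = \<phi>0\<close> the ratio is no longer guaranteed to be below one, which separates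
  the range of angles in (i) from that in (ii).\<close>

lemma quadratic_nonneg_discriminant:
  fixes a b c :: real
  assumes "\<And>t. 0 \<le> a * t\<^sup>2 + 2 * b * t + c"
  shows "b\<^sup>2 \<le> a * c"
proof (cases "a = 0")
  case True
  have "b = 0"
  proof (rule ccontr)
    assume "b \<noteq> 0"
    \<comment> \<open>For \<open>a = 0\<close> this argument gives the value
      \<open>-1\<close>.\<close>
    with assms[of "- (c + 1) / (2 * b)"] True show False by simp
  qed
  with True show ?thesis by simp
next
  case False
  have "0 \<le> a"
  proof (rule ccontr)
    assume "\<not> 0 \<le> a"
    \<comment> \<open>Large enough for the quadratic term to beat the other two; the final
      \<open>+ 1\<close> gives \<open>t \<ge> 1\<close>, so that the constant is bounded by
      \<open>\<bar>c\<bar> * t\<close>.\<close>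
    define t where "t = (\<bar>b\<bar> + \<bar>c\<bar> + 1) * 2 / (- a) + 1"
    have t: "t \<ge> 1" and at: "- a * t \<ge> 2 * (\<bar>b\<bar> + \<bar>c\<bar> + 1)"
    proof -
      show "t \<ge> 1"
        using \<open>\<not> 0 \<le> a\<close> unfolding t_def by (simp add: divide_nonneg_neg divide_le_0_iff)
      have "- a * t = 2 * (\<bar>b\<bar> + \<bar>c\<bar> + 1) - a"
        using False by (simp add: t_def field_simps)
      then show "- a * t \<ge> 2 * (\<bar>b\<bar> + \<bar>c\<bar> + 1)"
        using \<open>\<not> 0 \<le> a\<close> by linarith
    qed
    have "- a * t * t \<ge> 2 * (\<bar>b\<bar> + \<bar>c\<bar> + 1) * t"
      using at t by (intro mult_right_mono) auto
    moreover have "2 * (\<bar>b\<bar> + \<bar>c\<bar> + 1) * t = 2 * (\<bar>b\<bar> * t) + 2 * (\<bar>c\<bar> * t) + 2 * t"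
      by (simp add: algebra_simps)
    moreover have "\<bar>c\<bar> \<le> \<bar>c\<bar> * t" "b * t \<le> \<bar>b\<bar> * t"
      using t mult_left_mono[of 1 t "\<bar>c\<bar>"] by (auto intro: mult_right_mono)
    moreover have "0 \<le> a * t * t + 2 * (b * t) + c"
      using assms[of t] by (simp add: power2_eq_square mult.assoc)
    ultimately show False
      using t by linarith
  qed
  with False have "a > 0" by simp
  have "0 \<le> a * (a * (- b / a)\<^sup>2 + 2 * b * (- b / a) + c)"
    using assms[of "- b / a"] \<open>a > 0\<close> by (intro mult_nonneg_nonneg) auto
  also have "\<dots> = a * c - b\<^sup>2"
    using \<open>a > 0\<close> by (simp add: field_simps power2_eq_square)
  finally show ?thesis by simp
qed

text \<open>The representing vector is the limit of \<open>L x\<^sub>n\<close> along a minimizing sequence of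
  \<open>\<parallel>L x\<parallel>\<^sup>2 - 2 G x\<close>. Allowing \<open>L\<close> other than the identity gives orthogonal projections and
  factorizations of operators by the same argument.\<close>

lemma riesz_range:
  fixes L :: "'a::real_vector \<Rightarrow> 'b::{real_inner,complete_space}" and G :: "'a \<Rightarrow> real"
  assumes L: "linear L" and G: "linear G" and bound: "\<And>x. \<bar>G x\<bar> \<le> M * norm (L x)"
  shows "\<exists>z \<in> closure (range L). \<forall>x. inner (L x) z = G x"
proof -
  define q where "q x = (norm (L x))\<^sup>2 - 2 * G x" for x
  have lower: "- (M\<^sup>2) \<le> q x" for x
  proof -
    have "0 \<le> (norm (L x) - M)\<^sup>2" by simp
    then show ?thesis
      using bound[of x] by (simp add: q_def power2_eq_square algebra_simps)
  qed
  define m where "m = Inf (range q)"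
  have m_le: "m \<le> q x" for x
    unfolding m_def by (rule cInf_lower) (auto intro!: bdd_belowI[of _ "- (M\<^sup>2)"] lower)
  have "\<exists>x. q x < m + 1 / real (Suc n)" for n
  proof -
    have "m < m + 1 / real (Suc n)" by simp
    then obtain y where "y \<in> range q" "y < m + 1 / real (Suc n)"
      unfolding m_def using cInf_lessD[of "range q"] by blast
    then show ?thesis by blast
  qed
  then obtain x where x: "\<And>n. q (x n) < m + 1 / real (Suc n)" by metis
  \<comment> \<open>Parallelogram law; the linear part of \<open>q\<close> cancels. Since the
    midpoint has value at least \<open>m\<close>, two near-minimizers have close images.\<close>
  have par: "(norm (L u - L v))\<^sup>2 = 2 * q u + 2 * q v - 4 * q ((1/2) *\<^sub>R (u + v))" for u v
    by (simp add: q_def linear_scale[OF L] linear_add[OF L] linear_scale[OF G] linear_add[OF G]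
        power2_norm_eq_inner inner_simps inner_commute algebra_simps)
  have "Cauchy (\<lambda>n. L (x n))"
  proof (rule metric_CauchyI)
    fix e :: real assume "0 < e"
    \<comment> \<open>Both values are below \<open>m + 1 / Suc k\<close>, so \<open>par\<close>
      bounds the squared distance by \<open>4 / Suc k\<close>.\<close>
    obtain k where k: "1 / real (Suc k) < e\<^sup>2 / 4"
      using \<open>0 < e\<close> nat_approx_posE[of "e\<^sup>2 / 4"] by auto
    show "\<exists>k. \<forall>m\<ge>k. \<forall>n\<ge>k. dist (L (x m)) (L (x n)) < e"
    proof (intro exI[of _ k] allI impI)
      fix i j assume ij: "i \<ge> k" "j \<ge> k"
      have le: "1 / real (Suc i) \<le> 1 / real (Suc k)" "1 / real (Suc j) \<le> 1 / real (Suc k)"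
        using ij by (simp_all add: frac_le)
      have "(norm (L (x i) - L (x j)))\<^sup>2 < e\<^sup>2"
        unfolding par using x[of i] x[of j] m_le[of "(1/2) *\<^sub>R (x i + x j)"] le k by linarith
      then show "dist (L (x i)) (L (x j)) < e"
        using \<open>0 < e\<close> by (simp add: dist_norm power_less_imp_less_base)
    qed
  qed
  then have "convergent (\<lambda>n. L (x n))"
    by (rule Cauchy_convergent)
  then obtain z where z: "(\<lambda>n. L (x n)) \<longlonglongrightarrow> z"
    unfolding convergent_def ..
  show ?thesis
  proof (intro bexI[of _ z] allI)
    show "z \<in> closure (range L)"
      unfolding closure_sequential using z by (intro exI[of _ "\<lambda>n. L (x n)"]) auto
    fix y
    \<comment> \<open>Variation of the minimizing sequence in the direction \<open>y\<close>, passed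
      to the limit. As the constant term is \<open>0\<close>, the discriminant bound forces the
      linear coefficient to vanish.\<close>
    have "0 \<le> (norm (L y))\<^sup>2 * t\<^sup>2 + 2 * (inner z (L y) - G y) * t + 0" for t
    proof -
      have "- (1 / real (Suc n)) \<le>
          (norm (L y))\<^sup>2 * t\<^sup>2 + 2 * (inner (L (x n)) (L y) - G y) * t" for n
      proof -
        have "q (x n + t *\<^sub>R y) = q (x n) +
            ((norm (L y))\<^sup>2 * t\<^sup>2 + 2 * (inner (L (x n)) (L y) - G y) * t)"
          by (simp add: q_def linear_scale[OF L] linear_add[OF L] linear_scale[OF G]
              linear_add[OF G] power2_norm_eq_inner inner_simps inner_commute algebra_simps)
              (simp add: power2_eq_square algebra_simps)
        then show ?thesis
          using x[of n] m_le[of "x n + t *\<^sub>R y"] by linarith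
      qed
      moreover have "(\<lambda>n. (norm (L y))\<^sup>2 * t\<^sup>2 + 2 * (inner (L (x n)) (L y) - G y) * t)
          \<longlonglongrightarrow> (norm (L y))\<^sup>2 * t\<^sup>2 + 2 * (inner z (L y) - G y) * t"
        by (intro tendsto_intros z)
      moreover have "(\<lambda>n. - (1 / real (Suc n))) \<longlonglongrightarrow> - 0"
        by (intro tendsto_intros LIMSEQ_Suc[OF lim_1_over_n])
      ultimately have "- 0 \<le> (norm (L y))\<^sup>2 * t\<^sup>2 + 2 * (inner z (L y) - G y) * t"
        by (intro LIMSEQ_le[of "\<lambda>n. - (1 / real (Suc n))"]) auto
      then show ?thesis by simp
    qed
    from quadratic_nonneg_discriminant[OF this] show "inner (L y) z = G y"
      by (simp add: inner_commute)
  qed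
qed

lemma inner_closure_range_bound:
  fixes L :: "'a \<Rightarrow> 'b::real_inner"
  assumes "\<And>x. inner (L x) z \<le> M * norm (L x)" and "w \<in> closure (range L)"
  shows "inner w z \<le> M * norm w"
proof -
  have "closed {w. inner w z \<le> M * norm w}"
    by (intro closed_Collect_le continuous_intros)
  then show ?thesis
    using closure_minimal[of "range L" "{w. inner w z \<le> M * norm w}"] assms by auto
qed

text \<open>Lying in the closure, \<open>z\<close> can be tested against itself. The alternative
  \<open>z = 0\<close> covers negative \<open>M\<close>.\<close>

lemma closure_range_norm_bound:
  fixes L :: "'a \<Rightarrow> 'b::real_inner"
  assumes "\<And>x. inner (L x) z \<le> M * norm (L x)" and "z \<in> closure (range L)"
  shows "norm z \<le> M \<or> z = 0"
  using inner_closure_range_bound[OF assms]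
  by (cases "z = 0") (simp_all add: dot_square_norm power2_eq_square)

lemma orthogonal_closure_range:
  fixes L :: "'a \<Rightarrow> 'b::real_inner"
  assumes "\<And>x. inner (L x) z = 0" and "w \<in> closure (range L)"
  shows "inner w z = 0"
  using inner_closure_range_bound[of L z 0 w] inner_closure_range_bound[of L "- z" 0 w] assms
  by simp

text \<open>The vector that represents \<open>y \<mapsto> inner (L y) x\<close> by
  \<open>riesz_range\<close> is the orthogonal projection of \<open>x\<close>.\<close>

lemma closure_range_decompose:
  fixes L :: "'a::real_vector \<Rightarrow> 'b::{real_inner,complete_space}"
  assumes "linear L"
  shows "\<exists>p q. x = p + q \<and> p \<in> closure (range L) \<and> (\<forall>y. inner (L y) q = 0)"
proof -
  have "linear (\<lambda>y. inner (L y) x)"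
    using assms by (auto intro!: linearI simp: linear_add linear_scale inner_simps)
  moreover have "\<bar>inner (L y) x\<bar> \<le> norm x * norm (L y)" for y
    using Cauchy_Schwarz_ineq2[of "L y" x] by (simp add: mult.commute)
  ultimately obtain z where
    "z \<in> closure (range L)" "\<forall>y. inner (L y) z = inner (L y) x"
    using riesz_range[OF assms, of "\<lambda>y. inner (L y) x" "norm x"] by blast
  then show ?thesis
    by (intro exI[of _ z] exI[of _ "x - z"]) (simp add: inner_simps)
qed

text \<open>The difference is orthogonal to the closure that contains both vectors. This uniqueness
  makes the choice of representing vectors linear.\<close>

lemma closure_range_eqI:
  fixes L :: "'a::real_vector \<Rightarrow> 'b::real_inner"
  assumes "linear L" and "z \<in> closure (range L)" "z' \<in> closure (range L)"
    and "\<And>x. inner (L x) z = inner (L x) z'"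
  shows "z = z'"
proof -
  have "inner (L x) (z - z') = 0" for x
    using assms(4) by (simp add: inner_simps)
  then have "inner w (z - z') = 0" if "w \<in> closure (range L)" for w
    using that by (rule orthogonal_closure_range[of L])
  then have "inner z (z - z') = 0" "inner z' (z - z') = 0"
    using assms by blast+
  then have "inner (z - z') (z - z') = 0"
    by (simp add: inner_simps)
  then show ?thesis by simp
qed

section \<open>Complex scalars in terms of the real inner product\<close>

lemma inner_scaleC:
  fixes x y :: "'a::chilbert_space"
  shows "inner (c *\<^sub>C x) y = inner x (cnj c *\<^sub>C y)"
proof -
  have "cinner (c *\<^sub>C x) y = cinner x (cnj c *\<^sub>C y)"
    by (subst (2) cinner_commute) (simp add: cinner_scaleC_left cinner_commute[of x y])
  then show ?thesis
    by (simp add: Re_cinner[symmetric])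
qed

lemma scaleC_minus_left: "(- c) *\<^sub>C x = - (c *\<^sub>C (x::'a::chilbert_space))"
  using scaleR_scaleC[of "- 1" "c *\<^sub>C x"] by (simp add: scaleC_scaleC)

text \<open>This is what permits checking adjoint relations for \<open>inner\<close> alone.\<close>

lemma cinner_eq_inner:
  fixes x y :: "'a::chilbert_space"
  shows "cinner x y = Complex (inner x y) (inner x (\<i> *\<^sub>C y))"
proof -
  have "Im (cinner x y) = - Re (cinner (\<i> *\<^sub>C x) y)"
    by (simp add: cinner_scaleC_left)
  also have "\<dots> = inner x (\<i> *\<^sub>C y)"
    by (simp add: Re_cinner inner_scaleC scaleC_minus_left)
  finally show ?thesis
    by (simp add: complex_eq_iff Re_cinner)
qed

section \<open>Pointwise calculus of bounded complex linear operators\<close>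

lemma bounded_linear_cblinfun_apply [simp]: "bounded_linear (cblinfun_apply A)"
  by transfer simp

lemma linear_cblinfun_apply [simp]: "linear (cblinfun_apply A)"
  by (simp add: bounded_linear.linear)

lemmas cblinfun_linear_simps [simp] =
  linear_add[OF linear_cblinfun_apply] linear_diff[OF linear_cblinfun_apply]
  linear_neg[OF linear_cblinfun_apply] linear_scale[OF linear_cblinfun_apply]
  linear_0[OF linear_cblinfun_apply]

lemma cblinfun_apply_scaleC [simp]: "cblinfun_apply A (c *\<^sub>C x) = c *\<^sub>C cblinfun_apply A x"
  by transfer simp

lemma cblinfun_apply_plus [simp]: "cblinfun_apply (A + B) x = A x + B x"
  by transfer simp

lemma cblinfun_apply_uminus [simp]: "cblinfun_apply (- A) x = - A x"
  by transfer simp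

lemma cblinfun_apply_minus [simp]: "cblinfun_apply (A - B) x = A x - B x"
  unfolding minus_cblinfun_def cblinfun_apply_plus cblinfun_apply_uminus by simp

lemma cblinfun_apply_scaleR [simp]: "cblinfun_apply (r *\<^sub>R A) x = r *\<^sub>R A x"
  by transfer simp

lemma cblinfun_apply_scaleC_op [simp]: "cblinfun_apply (c *\<^sub>C A) x = c *\<^sub>C A x"
  by transfer simp

lemma cblinfun_apply_compose [simp]: "cblinfun_apply (A o\<^sub>C\<^sub>L B) x = A (B x)"
  by transfer simp

lemma cblinfun_apply_id [simp]: "cblinfun_apply id_cblinfun x = x"
  by transfer simp

lemma cblinfun_apply_zero [simp]: "cblinfun_apply 0 x = 0"
  by transfer simp

lemma cblinfun_eqI: "(\<And>x. A x = B x) \<Longrightarrow> A = B"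
  for A B :: "'a::chilbert_space \<Rightarrow>\<^sub>C\<^sub>L 'b::chilbert_space"
  by transfer auto

lemma cblinfun_inner_eqI:
  fixes A B :: "'a::chilbert_space \<Rightarrow>\<^sub>C\<^sub>L 'b::chilbert_space"
  assumes "\<And>x y. inner (A x) y = inner (B x) y"
  shows "A = B"
proof (rule cblinfun_eqI)
  fix x
  have "inner (A x - B x) (A x - B x) = 0"
    using assms[of x "A x - B x"] by (simp add: inner_diff_left)
  then show "A x = B x" by simp
qed

lemma norm_cblinfun: "norm (A x) \<le> norm A * norm x"
  for A :: "'a::chilbert_space \<Rightarrow>\<^sub>C\<^sub>L 'b::chilbert_space"
  by transfer (auto intro: onorm)

lemma norm_cblinfun_bound: "(\<And>x. norm (A x) \<le> k * norm x) \<Longrightarrow> 0 \<le> k \<Longrightarrow> norm A \<le> k"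
  for A :: "'a::chilbert_space \<Rightarrow>\<^sub>C\<^sub>L 'b::chilbert_space"
  by transfer (auto intro: onorm_bound)

lemma contraction_iff: "contraction A \<longleftrightarrow> (\<forall>x. norm (A x) \<le> norm x)"
proof
  assume "contraction A"
  then show "\<forall>x. norm (A x) \<le> norm x"
    unfolding contraction_def
    by (meson mult_left_le_one_le norm_cblinfun norm_ge_zero order_trans)
next
  assume "\<forall>x. norm (A x) \<le> norm x"
  then show "contraction A"
    unfolding contraction_def by (intro norm_cblinfun_bound) auto
qed

lemma cblinfun_exists:
  fixes F :: "'a::chilbert_space \<Rightarrow> 'b::chilbert_space"
  assumes "\<And>x y. F (x + y) = F x + F y" and "\<And>c x. F (c *\<^sub>C x) = c *\<^sub>C F x"
    and "\<And>x. norm (F x) \<le> k * norm x"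
  shows "\<exists>A :: 'a \<Rightarrow>\<^sub>C\<^sub>L 'b. \<forall>x. A x = F x"
proof -
  have "bounded_linear F"
    using assms by (intro bounded_linear_intro[of F k]) (auto simp: scaleR_scaleC mult.commute)
  then show ?thesis
    using assms(2) by (intro exI[of _ "CBlinfun F"]) (simp add: CBlinfun_inverse)
qed

text \<open>Representing vectors in the closure of the range of \<open>N\<close> are unique, so they
  inherit additivity and homogeneity in \<open>f\<close> from \<open>q\<close>. The assumption
  \<open>q_scaleC\<close> is sesquilinearity as seen by the real part. Adjoints, Douglas factors and
  form factors all arise as instances.\<close>

lemma riesz_operator:
  fixes q :: "'a::chilbert_space \<Rightarrow> 'c::chilbert_space \<Rightarrow> real"
    and N :: "'c \<Rightarrow>\<^sub>C\<^sub>L 'd::chilbert_space" and M :: "'a \<Rightarrow>\<^sub>C\<^sub>L 'b::chilbert_space"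
  assumes q_linear: "\<And>f. linear (q f)" and q_add: "\<And>f f' g. q (f + f') g = q f g + q f' g"
    and q_scaleC: "\<And>c f g. q (c *\<^sub>C f) g = q f (cnj c *\<^sub>C g)"
    and bound: "\<And>f g. \<bar>q f g\<bar> \<le> norm (M f) * norm (N g)"
  shows "\<exists>W :: 'a \<Rightarrow>\<^sub>C\<^sub>L 'd. (\<forall>f g. inner (W f) (N g) = q f g) \<and>
    (\<forall>f. W f \<in> closure (range N)) \<and> (\<forall>f. norm (W f) \<le> norm (M f))"
proof -
  have "\<exists>z \<in> closure (range N). \<forall>g. inner (N g) z = q f g" for f
    using bound q_linear by (intro riesz_range[of _ _ "norm (M f)"]) auto
  then obtain F where F: "\<And>f. F f \<in> closure (range N)" "\<And>f g. inner (N g) (F f) = q f g"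
    by metis
  \<comment> \<open>Uniqueness can be applied to \<open>F x + F y\<close> and
    \<open>c *\<^sub>C F x\<close> only once these are known to lie in the closure.\<close>
  have sub: "x + y \<in> closure (range N)" if "x \<in> closure (range N)" "y \<in> closure (range N)" for x y
  proof -
    from that obtain a b where a: "\<forall>n::nat. a n \<in> range N" "a \<longlonglongrightarrow> x"
      and b: "\<forall>n::nat. b n \<in> range N" "b \<longlonglongrightarrow> y"
      unfolding closure_sequential by auto
    have "a n + b n \<in> range N" for n
    proof -
      from a b obtain u v where "a n = N u" "b n = N v" by blast
      then have "a n + b n = N (u + v)" by simp
      then show ?thesis by blast
    qed
    with tendsto_add[OF a(2) b(2)] show ?thesis
      unfolding closure_sequential by (intro exI[of _ "\<lambda>n. a n + b n"]) auto
  qed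
  have scale: "c *\<^sub>C x \<in> closure (range N)" if "x \<in> closure (range N)" for x c
  proof -
    have "(*\<^sub>C) c ` closure (range N) \<subseteq> closure ((*\<^sub>C) c ` range N)"
      using chilbert_bounded_linear_scaleC[of c]
      by (intro continuous_image_closure_subset[of UNIV] linear_continuous_on) auto
    also have "\<dots> \<subseteq> closure (range N)"
      by (intro closure_mono) (auto simp: image_iff cblinfun_apply_scaleC[symmetric]
          simp del: cblinfun_apply_scaleC)
    finally show ?thesis using that by blast
  qed
  have norm_F: "norm (F f) \<le> norm (M f)" for f
    using closure_range_norm_bound[of N "F f" "norm (M f)"] F bound[of f]
    by (force simp: abs_le_iff)
  have "\<exists>W :: 'a \<Rightarrow>\<^sub>C\<^sub>L 'd. \<forall>x. W x = F x"
  proof (rule cblinfun_exists)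
    show "F (x + y) = F x + F y" for x y
      by (rule closure_range_eqI[of N]) (auto simp: F sub inner_simps q_add)
    show "F (c *\<^sub>C x) = c *\<^sub>C F x" for c x
    proof (rule closure_range_eqI[of N])
      fix g
      have "inner (N g) (c *\<^sub>C F x) = inner (N (cnj c *\<^sub>C g)) (F x)"
        by (simp add: inner_scaleC)
      then show "inner (N g) (F (c *\<^sub>C x)) = inner (N g) (c *\<^sub>C F x)"
        by (simp only: F q_scaleC)
    qed (auto simp: F scale)
    show "norm (F x) \<le> norm M * norm x" for x
      using norm_F[of x] norm_cblinfun[of M x] by linarith
  qed
  then show ?thesis
    using F norm_F by (metis inner_commute)
qed

section \<open>Adjoints\<close>

lemma cinner_adjointI:
  fixes A :: "'a::chilbert_space \<Rightarrow>\<^sub>C\<^sub>L 'b::chilbert_space" and B :: "'b \<Rightarrow>\<^sub>C\<^sub>L 'a"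
  assumes "\<And>x y. inner (A x) y = inner x (B y)"
  shows "cinner (A x) y = cinner x (B y)"
  by (simp add: cinner_eq_inner assms)

lemma adj_eqI:
  fixes A :: "'a::chilbert_space \<Rightarrow>\<^sub>C\<^sub>L 'b::chilbert_space" and B :: "'b \<Rightarrow>\<^sub>C\<^sub>L 'a"
  assumes "\<And>x y. inner (A x) y = inner x (B y)"
  shows "adj A = B"
  unfolding adj_def
proof (rule the_equality)
  show "\<forall>x y. cinner (A x) y = cinner x (B y)"
    using cinner_adjointI[OF assms] by blast
  fix B' :: "'b \<Rightarrow>\<^sub>C\<^sub>L 'a"
  assume B': "\<forall>x y. cinner (A x) y = cinner x (B' y)"
  have "inner x (B' y) = inner x (B y)" for x y
    using B' assms[of x y] by (simp flip: Re_cinner)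
  then have "B' y = B y" for y
    by (metis inner_commute vector_eq_rdot)
  then show "B' = B"
    by (rule cblinfun_eqI)
qed

text \<open>Existence of the adjoint: \<open>riesz_operator\<close> with \<open>N\<close> the
  identity and \<open>M\<close> a multiple of it, after which \<open>adj_eqI\<close> identifies the
  operator found with \<open>adj A\<close>.\<close>

lemma inner_adj: "inner (A x) y = inner x (adj A y)"
  for A :: "'a::chilbert_space \<Rightarrow>\<^sub>C\<^sub>L 'b::chilbert_space"
proof -
  have "\<bar>inner y (A x)\<bar> \<le> norm ((norm A *\<^sub>R id_cblinfun) y) * norm (id_cblinfun x)" for x y
    using Cauchy_Schwarz_ineq2[of y "A x"] mult_left_mono[OF norm_cblinfun[of A x], of "norm y"]
    by (simp add: mult_ac)
  moreover have "linear (\<lambda>x. inner y (A x))" for y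
    by (auto intro!: linearI simp: inner_simps)
  ultimately have "\<exists>B :: 'b \<Rightarrow>\<^sub>C\<^sub>L 'a. (\<forall>y x. inner (B y) (id_cblinfun x) = inner y (A x)) \<and>
      (\<forall>y. B y \<in> closure (range (id_cblinfun :: 'a \<Rightarrow>\<^sub>C\<^sub>L 'a))) \<and>
      (\<forall>y. norm (B y) \<le> norm ((norm A *\<^sub>R id_cblinfun) y))"
    by (intro riesz_operator) (simp_all add: inner_add_left inner_scaleC)
  then obtain B :: "'b \<Rightarrow>\<^sub>C\<^sub>L 'a" where "\<And>x y. inner (B y) x = inner y (A x)"
    by auto
  then have "inner (A x) y = inner x (B y)" for x y
    by (metis inner_commute)
  then show ?thesis
    using adj_eqI[of A B] by simp
qed

lemma inner_adj': "inner (adj A x) y = inner x (A y)"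
  for A :: "'a::chilbert_space \<Rightarrow>\<^sub>C\<^sub>L 'b::chilbert_space"
  by (metis inner_adj inner_commute)

lemma adj_adj [simp]: "adj (adj A) = A"
  for A :: "'a::chilbert_space \<Rightarrow>\<^sub>C\<^sub>L 'b::chilbert_space"
  by (rule adj_eqI) (simp add: inner_adj')

lemma adj_compose [simp]: "adj (A o\<^sub>C\<^sub>L B) = adj B o\<^sub>C\<^sub>L adj A"
  for A :: "'b::chilbert_space \<Rightarrow>\<^sub>C\<^sub>L 'c::chilbert_space" and B :: "'a::chilbert_space \<Rightarrow>\<^sub>C\<^sub>L 'b"
  by (rule adj_eqI) (simp add: inner_adj)

lemma adj_plus [simp]: "adj (A + B) = adj A + adj B"
  for A B :: "'a::chilbert_space \<Rightarrow>\<^sub>C\<^sub>L 'b::chilbert_space"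
  by (rule adj_eqI) (simp add: inner_adj inner_simps)

lemma adj_scaleR [simp]: "adj (r *\<^sub>R A) = r *\<^sub>R adj A"
  for A :: "'a::chilbert_space \<Rightarrow>\<^sub>C\<^sub>L 'b::chilbert_space"
  by (rule adj_eqI) (simp add: inner_adj)

lemma adj_scaleC [simp]: "adj (c *\<^sub>C A) = cnj c *\<^sub>C adj A"
  for A :: "'a::chilbert_space \<Rightarrow>\<^sub>C\<^sub>L 'b::chilbert_space"
  by (rule adj_eqI) (simp add: inner_scaleC inner_adj)

lemma adj_id [simp]: "adj id_cblinfun = id_cblinfun"
  by (rule adj_eqI) simp

lemma selfadjoint_iff: "selfadjoint A \<longleftrightarrow> (\<forall>x y. inner (A x) y = inner x (A y))"
  unfolding selfadjoint_def by (metis adj_eqI inner_adj)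

lemma contraction_adj: "contraction A \<Longrightarrow> contraction (adj A)"
  for A :: "'a::chilbert_space \<Rightarrow>\<^sub>C\<^sub>L 'b::chilbert_space"
  unfolding contraction_iff
proof
  fix y assume A: "\<forall>x. norm (A x) \<le> norm x"
  have "(norm (adj A y))\<^sup>2 = inner (A (adj A y)) y"
    by (simp add: power2_norm_eq_inner inner_adj)
  also have "\<dots> \<le> norm (adj A y) * norm y"
    using Cauchy_Schwarz_ineq2[of "A (adj A y)" y] A mult_right_mono[OF A[rule_format], of "norm y"]
    by (smt (verit) norm_ge_zero)
  finally show "norm (adj A y) \<le> norm y"
    by (cases "adj A y = 0") (simp_all add: power2_eq_square)
qed

text \<open>Douglas' factorization: the adjoint of \<open>K\<close> represents \<open>B x \<mapsto> (A x, y)\<close>.\<close>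

lemma douglas_factorization:
  fixes A :: "'a::chilbert_space \<Rightarrow>\<^sub>C\<^sub>L 'c::chilbert_space" and B :: "'a \<Rightarrow>\<^sub>C\<^sub>L 'b::chilbert_space"
  assumes le: "\<And>x. norm (A x) \<le> norm (B x)"
  shows "\<exists>K. contraction K \<and> A = K o\<^sub>C\<^sub>L B \<and> (\<forall>x. (\<forall>y. inner (B y) x = 0) \<longrightarrow> K x = 0)"
proof -
  have "\<bar>inner (A x) y\<bar> \<le> norm (id_cblinfun y) * norm (B x)" for x y
    using Cauchy_Schwarz_ineq2[of "A x" y] mult_right_mono[OF le[of x], of "norm y"]
    by (simp add: mult.commute)
  moreover have "linear (\<lambda>x. inner (A x) y)" for y
    by (auto intro!: linearI simp: inner_simps)
  ultimately have "\<exists>Z :: 'c \<Rightarrow>\<^sub>C\<^sub>L 'b. (\<forall>y x. inner (Z y) (B x) = inner (A x) y) \<and>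
      (\<forall>y. Z y \<in> closure (range B)) \<and>
      (\<forall>y. norm (Z y) \<le> norm ((id_cblinfun :: 'c \<Rightarrow>\<^sub>C\<^sub>L 'c) y))"
    by (intro riesz_operator)
      (simp_all add: inner_add_right inner_scaleC)
  then obtain Z :: "'c \<Rightarrow>\<^sub>C\<^sub>L 'b" where Z: "\<And>y x. inner (Z y) (B x) = inner (A x) y"
    "\<And>y. Z y \<in> closure (range B)" "\<And>y. norm (Z y) \<le> norm y"
    by auto
  show ?thesis
  proof (intro exI[of _ "adj Z"] conjI allI impI)
    show "contraction (adj Z)"
      using Z(3) by (intro contraction_adj) (simp add: contraction_iff)
    have "inner (A x) y = inner (adj Z (B x)) y" for x y
      using Z(1)[of y x] by (metis inner_adj' inner_commute)
    then show "A = adj Z o\<^sub>C\<^sub>L B"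
      by (intro cblinfun_inner_eqI) simp
    fix x assume "\<forall>y. inner (B y) x = 0"
    then have "inner (Z y) x = 0" for y
      using Z(2) orthogonal_closure_range[of B x] by blast
    then have "inner (adj Z x) (adj Z x) = 0"
      by (metis inner_adj' inner_commute)
    then show "adj Z x = 0" by simp
  qed
qed

text \<open>Representing the form in its second argument through \<open>N\<close> gives
  \<open>Q = adj N o\<^sub>C\<^sub>L W\<close>, and Douglas' factorization then splits
  \<open>W\<close> as \<open>K o\<^sub>C\<^sub>L M\<close>. The two vanishing clauses fix
  \<open>K\<close> off the ranges; kernel inclusions are later read off from them.\<close>

lemma form_factorization:
  fixes Q :: "'a::chilbert_space \<Rightarrow>\<^sub>C\<^sub>L 'c::chilbert_space"
    and M :: "'a \<Rightarrow>\<^sub>C\<^sub>L 'b::chilbert_space" and N :: "'c \<Rightarrow>\<^sub>C\<^sub>L 'd::chilbert_space"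
  assumes bound: "\<And>f g. \<bar>inner (Q f) g\<bar> \<le> norm (M f) * norm (N g)"
  shows "\<exists>K. contraction K \<and> Q = adj N o\<^sub>C\<^sub>L K o\<^sub>C\<^sub>L M \<and>
    (\<forall>x. (\<forall>y. inner (M y) x = 0) \<longrightarrow> K x = 0) \<and>
    (\<forall>x. (\<forall>y. inner (N y) x = 0) \<longrightarrow> adj K x = 0)"
proof -
  have "linear (\<lambda>g. inner (Q f) g)" for f
    by (auto intro!: linearI simp: inner_simps)
  then have "\<exists>W :: 'a \<Rightarrow>\<^sub>C\<^sub>L 'd. (\<forall>f g. inner (W f) (N g) = inner (Q f) g) \<and>
      (\<forall>f. W f \<in> closure (range N)) \<and> (\<forall>f. norm (W f) \<le> norm (M f))"
    using bound by (intro riesz_operator) (simp_all add: inner_add_left inner_scaleC)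
  then obtain W :: "'a \<Rightarrow>\<^sub>C\<^sub>L 'd" where W: "\<And>f g. inner (W f) (N g) = inner (Q f) g"
    "\<And>f. W f \<in> closure (range N)" "\<And>f. norm (W f) \<le> norm (M f)"
    by auto
  from douglas_factorization[OF W(3)] obtain K where K: "contraction K" "W = K o\<^sub>C\<^sub>L M"
    "\<And>x. \<forall>y. inner (M y) x = 0 \<Longrightarrow> K x = 0" by blast
  show ?thesis
  proof (intro exI[of _ K] conjI allI impI)
    have "inner (Q f) g = inner (adj N (K (M f))) g" for f g
      using W(1)[of f g] K(2) by (simp add: inner_adj')
    then show "Q = adj N o\<^sub>C\<^sub>L K o\<^sub>C\<^sub>L M"
      by (intro cblinfun_inner_eqI) simp
    fix x assume x: "\<forall>y. inner (N y) x = 0"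
    \<comment> \<open>So \<open>adj K x\<close> is orthogonal to the range of \<open>M\<close> and
      is killed by \<open>K\<close>; pairing \<open>K (adj K x)\<close> with \<open>x\<close> gives
      the squared norm of \<open>adj K x\<close>.\<close>
    have "inner (M f) (adj K x) = 0" for f
    proof -
      have "inner (M f) (adj K x) = inner (W f) x"
        using K(2) by (simp add: inner_adj)
      also have "\<dots> = 0"
        using W(2) x orthogonal_closure_range[of N x] by blast
      finally show ?thesis .
    qed
    with K(3) have "K (adj K x) = 0" by blast
    then have "inner (adj K x) (adj K x) = 0"
      by (metis inner_adj inner_zero_left inner_commute)
    then show "adj K x = 0" by simp
  qed (use K in auto)
qed

section \<open>Positive operators and square roots\<close>

lemma scaleC_one [simp]: "1 *\<^sub>C x = (x::'a::chilbert_space)"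
  using scaleR_scaleC[of 1 x] by simp

text \<open>Polarization over the complex field: a real quadratic form already forces symmetry,
  which is why \<open>positive_op\<close> can be defined by the form alone.\<close>

lemma cinner_self_real_iff:
  fixes A :: "'a::chilbert_space \<Rightarrow>\<^sub>C\<^sub>L 'a"
  shows "(\<forall>x. Im (cinner (A x) x) = 0) \<longleftrightarrow> (\<forall>x y. inner (A x) y = inner x (A y))"
proof
  assume "\<forall>x. Im (cinner (A x) x) = 0"
  then have zero: "inner (A x) (\<i> *\<^sub>C x) = 0" for x
    by (simp add: cinner_eq_inner)
  have polar: "inner (A x) (\<i> *\<^sub>C y) = - inner (A y) (\<i> *\<^sub>C x)" for x y
    using zero[of "x + y"] zero[of x] zero[of y] by (simp add: scaleC_add_right inner_simps)
  have "inner (A x) y = inner x (A y)" for x y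
  proof -
    \<comment> \<open>Inserting \<open>\<i>\<close> times \<open>- \<i>\<close> brings the pair into
      the shape that \<open>polar\<close> handles.\<close>
    have "inner (A x) y = inner (A x) (\<i> *\<^sub>C (- \<i>) *\<^sub>C y)"
      by (simp add: scaleC_scaleC)
    also have "\<dots> = - inner (A ((- \<i>) *\<^sub>C y)) (\<i> *\<^sub>C x)"
      by (rule polar)
    also have "\<dots> = inner (A y) x"
      by (simp add: inner_scaleC scaleC_scaleC scaleC_minus_left)
    finally show ?thesis by (simp add: inner_commute)
  qed
  then show "\<forall>x y. inner (A x) y = inner x (A y)" by blast
next
  assume A: "\<forall>x y. inner (A x) y = inner x (A y)"
  have "inner (A x) (\<i> *\<^sub>C x) = - inner (A x) (\<i> *\<^sub>C x)" for x
  proof -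
    have "inner (A x) (\<i> *\<^sub>C x) = inner x (\<i> *\<^sub>C A x)"
      using A by simp
    also have "\<dots> = inner (\<i> *\<^sub>C A x) x"
      by (rule inner_commute)
    also have "\<dots> = - inner (A x) (\<i> *\<^sub>C x)"
      by (simp add: inner_scaleC scaleC_minus_left)
    finally show ?thesis .
  qed
  then show "\<forall>x. Im (cinner (A x) x) = 0"
    by (simp add: cinner_eq_inner)
qed

lemma positive_op_iff:
  fixes A :: "'a::chilbert_space \<Rightarrow>\<^sub>C\<^sub>L 'a"
  shows "positive_op A \<longleftrightarrow>
    (\<forall>x y. inner (A x) y = inner x (A y)) \<and> (\<forall>x. 0 \<le> inner (A x) x)"
  using cinner_self_real_iff[of A] by (auto simp: positive_op_def Re_cinner)

lemma positive_op_inner: "positive_op A \<Longrightarrow> inner (A x) y = inner x (A y)"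
  unfolding positive_op_iff by blast

lemma positive_op_nonneg: "positive_op A \<Longrightarrow> 0 \<le> inner (A x) x"
  unfolding positive_op_iff by blast

lemma positive_op_adj: "positive_op A \<Longrightarrow> adj A = A"
  by (rule adj_eqI) (rule positive_op_inner)

lemma positive_op_Cauchy_Schwarz:
  fixes A :: "'a::chilbert_space \<Rightarrow>\<^sub>C\<^sub>L 'a"
  assumes "positive_op A"
  shows "(inner (A x) y)\<^sup>2 \<le> inner (A x) x * inner (A y) y"
proof (rule quadratic_nonneg_discriminant)
  fix t :: real
  have "inner (A y) x = inner (A x) y"
    using positive_op_inner[OF assms, of y x] by (simp add: inner_commute)
  then have "inner (A (t *\<^sub>R x + y)) (t *\<^sub>R x + y) =
      inner (A x) x * t\<^sup>2 + 2 * inner (A x) y * t + inner (A y) y"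
    by (simp add: inner_add_left inner_add_right power2_eq_square algebra_simps)
  then show "0 \<le> inner (A x) x * t\<^sup>2 + 2 * inner (A x) y * t + inner (A y) y"
    using positive_op_nonneg[OF assms, of "t *\<^sub>R x + y"] by simp
qed

lemma positive_op_eq_zero:
  fixes A :: "'a::chilbert_space \<Rightarrow>\<^sub>C\<^sub>L 'a"
  assumes "positive_op A" and "inner (A x) x = 0"
  shows "A x = 0"
  using positive_op_Cauchy_Schwarz[OF assms(1), of x "A x"] assms(2) by simp

text \<open>Cauchy-Schwarz for the form of \<open>A\<close>, taken at \<open>x\<close> and
  \<open>A x\<close>, bounds the fourth power of \<open>norm (A x)\<close> by two values of the
  form, and the assumption applies to both.\<close>

lemma positive_op_contraction:
  fixes A :: "'a::chilbert_space \<Rightarrow>\<^sub>C\<^sub>L 'a"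
  assumes "positive_op A" and "\<And>x. inner (A x) x \<le> (norm x)\<^sup>2"
  shows "contraction A"
  unfolding contraction_iff
proof
  fix x
  have "((norm (A x))\<^sup>2)\<^sup>2 \<le> inner (A x) x * inner (A (A x)) (A x)"
    using positive_op_Cauchy_Schwarz[OF assms(1), of x "A x"] by (simp add: power2_norm_eq_inner)
  also have "\<dots> \<le> (norm x)\<^sup>2 * (norm (A x))\<^sup>2"
    using assms positive_op_nonneg[OF assms(1)] by (intro mult_mono) auto
  finally have "(norm (A x))\<^sup>2 * (norm (A x))\<^sup>2 \<le> (norm x)\<^sup>2 * (norm (A x))\<^sup>2"
    by (simp only: power2_eq_square[of "(norm (A x))\<^sup>2"])
  then have "A x = 0 \<or> (norm (A x))\<^sup>2 \<le> (norm x)\<^sup>2"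
    unfolding mult_le_cancel_right by auto
  then show "norm (A x) \<le> norm x"
    by (auto simp: power2_le_iff_abs_le)
qed

text \<open>The fixed point \<open>X = (E + X\<^sup>2) / 2\<close> satisfies \<open>(I - X)\<^sup>2 = I - E\<close>. The increments are
  dominated by those of the scalar iteration with \<open>E = 1\<close>, which increases to \<open>1\<close>.\<close>

primrec sqrt_iter :: "'a::chilbert_space \<Rightarrow>\<^sub>C\<^sub>L 'a \<Rightarrow> nat \<Rightarrow> 'a \<Rightarrow>\<^sub>C\<^sub>L 'a" where
  "sqrt_iter E 0 = 0"
| "sqrt_iter E (Suc n) = (1/2) *\<^sub>R (E + sqrt_iter E n o\<^sub>C\<^sub>L sqrt_iter E n)"

primrec sqrt_majorant :: "nat \<Rightarrow> real" where
  "sqrt_majorant 0 = 0"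
| "sqrt_majorant (Suc n) = (1 + (sqrt_majorant n)\<^sup>2) / 2"

lemma sqrt_majorant_bounds: "0 \<le> sqrt_majorant n" "sqrt_majorant n \<le> 1"
  by (induction n) (auto simp: power_le_one)

lemma sqrt_majorant_Suc: "sqrt_majorant n \<le> sqrt_majorant (Suc n)"
proof -
  have "0 \<le> (sqrt_majorant n - 1)\<^sup>2" by simp
  then show ?thesis by (simp add: power2_eq_square algebra_simps)
qed

text \<open>Iterates are polynomials in \<open>E\<close>, so an intertwining relation passes to them
  and, in the limit, to square roots.\<close>

lemma sqrt_iter_intertwine:
  fixes T :: "'a::chilbert_space \<Rightarrow>\<^sub>C\<^sub>L 'b::chilbert_space" and E1 :: "'a \<Rightarrow>\<^sub>C\<^sub>L 'a" and E2 :: "'b \<Rightarrow>\<^sub>C\<^sub>L 'b"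
  assumes "\<And>x. T (E1 x) = E2 (T x)"
  shows "T (sqrt_iter E1 n x) = sqrt_iter E2 n (T x)"
  by (induction n arbitrary: x) (simp_all add: assms)

lemma sqrt_iter_commute:
  "sqrt_iter E m (sqrt_iter E n x) = sqrt_iter E n (sqrt_iter E m x)"
proof -
  have "E (sqrt_iter E n x) = sqrt_iter E n (E x)" for x
    by (rule sqrt_iter_intertwine) simp
  then show ?thesis
    using sqrt_iter_intertwine[of "sqrt_iter E n" E E m] by simp
qed

lemma sqrt_iter_norm:
  assumes "contraction E"
  shows "norm (sqrt_iter E n x) \<le> sqrt_majorant n * norm x"
proof (induction n arbitrary: x)
  case (Suc n)
  have "norm (E x + sqrt_iter E n (sqrt_iter E n x)) \<le>
      norm x + sqrt_majorant n * (sqrt_majorant n * norm x)"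
    using assms Suc[of "sqrt_iter E n x"] mult_left_mono[OF Suc[of x] sqrt_majorant_bounds(1)[of n]]
    unfolding contraction_iff
    by (smt (verit, best) norm_triangle_ineq)
  moreover have "norm (sqrt_iter E (Suc n) x) = norm (E x + sqrt_iter E n (sqrt_iter E n x)) / 2"
    by simp
  moreover have "sqrt_majorant (Suc n) * norm x =
      (norm x + sqrt_majorant n * (sqrt_majorant n * norm x)) / 2"
    by (simp add: power2_eq_square algebra_simps)
  ultimately show ?case
    by (metis divide_right_mono zero_le_numeral)
qed simp

lemma sqrt_iter_increment:
  assumes "contraction E"
  shows "norm (sqrt_iter E (Suc n) x - sqrt_iter E n x) \<le>
    (sqrt_majorant (Suc n) - sqrt_majorant n) * norm x"
proof (induction n arbitrary: x)
  case 0
  then show ?case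
    using assms by (simp add: contraction_iff)
next
  case (Suc n)
  let ?X = "sqrt_iter E (Suc n)" and ?Y = "sqrt_iter E n"
  let ?r = "sqrt_majorant (Suc n)" and ?s = "sqrt_majorant n"
  have "sqrt_iter E (Suc (Suc n)) x - ?X x = (1/2) *\<^sub>R (?X (?X x) - ?Y (?Y x))"
    by (simp only: sqrt_iter.simps(2)[of E "Suc n"]) (simp add: algebra_simps)
  \<comment> \<open>The iterates commute, so the difference of squares factors as in the scalar
    recursion: the induction hypothesis bounds one factor, \<open>sqrt_iter_norm\<close> the
    other.\<close>
  also have "?X (?X x) - ?Y (?Y x) = ?X (?X x + ?Y x) - ?Y (?X x + ?Y x)"
    by (simp add: sqrt_iter_commute[of E "Suc n" n] del: sqrt_iter.simps)
  finally have "norm (sqrt_iter E (Suc (Suc n)) x - ?X x) =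
      norm (?X (?X x + ?Y x) - ?Y (?X x + ?Y x)) / 2"
    by (simp del: sqrt_iter.simps cblinfun_linear_simps)
  also have "\<dots> \<le> (?r - ?s) * norm (?X x + ?Y x) / 2"
    using Suc[of "?X x + ?Y x"] by simp
  also have "\<dots> \<le> (?r - ?s) * ((?r + ?s) * norm x) / 2"
  proof -
    have "norm (?X x + ?Y x) \<le> (?r + ?s) * norm x"
      using norm_triangle_ineq[of "?X x" "?Y x"] sqrt_iter_norm[OF assms, of "Suc n" x]
        sqrt_iter_norm[OF assms, of n x] by (simp only: distrib_right)
    then show ?thesis
      using sqrt_majorant_Suc[of n] by (intro divide_right_mono mult_left_mono) auto
  qed
  also have "\<dots> = (sqrt_majorant (Suc (Suc n)) - ?r) * norm x"
    by (simp add: power2_eq_square field_simps)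
  finally show ?case .
qed

lemma sqrt_iter_dist:
  assumes "contraction E" and "n \<le> m"
  shows "norm (sqrt_iter E m x - sqrt_iter E n x) \<le> (sqrt_majorant m - sqrt_majorant n) * norm x"
  using assms(2)
proof (induction m rule: dec_induct)
  case (step m)
  have "norm (sqrt_iter E (Suc m) x - sqrt_iter E n x) \<le>
      norm (sqrt_iter E (Suc m) x - sqrt_iter E m x) + norm (sqrt_iter E m x - sqrt_iter E n x)"
    using norm_triangle_ineq[of "sqrt_iter E (Suc m) x - sqrt_iter E m x"
        "sqrt_iter E m x - sqrt_iter E n x"] by (simp del: sqrt_iter.simps)
  then show ?case
    using step.IH sqrt_iter_increment[OF assms(1), of m x]
    by (simp only: left_diff_distrib)
qed simp

lemma sqrt_iter_limit:
  fixes E :: "'a::chilbert_space \<Rightarrow>\<^sub>C\<^sub>L 'a"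
  assumes E: "contraction E"
  shows "\<exists>X. contraction X \<and> (\<forall>x. (\<lambda>n. sqrt_iter E n x) \<longlonglongrightarrow> X x) \<and>
    (\<forall>x. X (X x) = 2 *\<^sub>R X x - E x)"
proof -
  have "incseq sqrt_majorant"
    by (rule incseq_SucI) (rule sqrt_majorant_Suc)
  then have "convergent sqrt_majorant"
    using sqrt_majorant_bounds(2) by (meson incseq_convergent convergent_def)
  then have r: "Cauchy sqrt_majorant"
    by (rule convergent_Cauchy)
  have "Cauchy (\<lambda>n. sqrt_iter E n x)" for x
  proof (rule metric_CauchyI)
    fix e :: real assume "0 < e"
    \<comment> \<open>The \<open>+ 1\<close> keeps the denominator positive at
      \<open>x = 0\<close>.\<close>
    then have "0 < e / (norm x + 1)"
      by (simp add: add_nonneg_pos)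
    with r obtain N where N: "\<And>m n. m \<ge> N \<Longrightarrow> n \<ge> N \<Longrightarrow>
        \<bar>sqrt_majorant m - sqrt_majorant n\<bar> < e / (norm x + 1)"
      unfolding Cauchy_def dist_real_def by meson
    have "norm (sqrt_iter E m x - sqrt_iter E n x) < e" if "n \<ge> N" "n \<le> m" for m n
    proof -
      have "norm (sqrt_iter E m x - sqrt_iter E n x) \<le>
          \<bar>sqrt_majorant m - sqrt_majorant n\<bar> * (norm x + 1)"
        using sqrt_iter_dist[OF E that(2), of x]
        by (smt (verit) mult_mono norm_ge_zero abs_ge_zero)
      also have "\<dots> < e"
        using N[of m n] that by (simp add: pos_less_divide_eq add_nonneg_pos)
      finally show ?thesis .
    qed
    then show "\<exists>N. \<forall>m\<ge>N. \<forall>n\<ge>N. dist (sqrt_iter E m x) (sqrt_iter E n x) < e"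
      unfolding dist_norm by (metis nle_le norm_minus_commute)
  qed
  then have "\<exists>z. (\<lambda>n. sqrt_iter E n x) \<longlonglongrightarrow> z" for x
    using Cauchy_convergent unfolding convergent_def by blast
  then obtain F where F: "\<And>x. (\<lambda>n. sqrt_iter E n x) \<longlonglongrightarrow> F x"
    by metis
  have F_norm: "norm (F x) \<le> 1 * norm x" for x
  proof -
    have "norm (sqrt_iter E n x) \<le> 1 * norm x" for n
      using sqrt_iter_norm[OF E, of n x] mult_right_mono[OF sqrt_majorant_bounds(2)[of n], of "norm x"]
      by simp
    then show ?thesis
      using Lim_bounded[OF tendsto_norm[OF F]] by blast
  qed
  have "\<exists>X :: 'a \<Rightarrow>\<^sub>C\<^sub>L 'a. \<forall>x. X x = F x"
  proof (rule cblinfun_exists)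
    show "F (x + y) = F x + F y" for x y
      using LIMSEQ_unique[OF F[of "x + y"]] tendsto_add[OF F[of x] F[of y]] by simp
    show "F (c *\<^sub>C x) = c *\<^sub>C F x" for c x
      using LIMSEQ_unique[OF F[of "c *\<^sub>C x"]]
        bounded_linear.tendsto[OF chilbert_bounded_linear_scaleC[of c] F[of x]] by simp
  qed (rule F_norm)
  then obtain X :: "'a \<Rightarrow>\<^sub>C\<^sub>L 'a" where X: "\<And>x. X x = F x" by blast
  show ?thesis
  proof (intro exI[of _ X] conjI allI)
    show "contraction X"
      using F_norm by (simp add: contraction_iff X)
    show "(\<lambda>n. sqrt_iter E n x) \<longlonglongrightarrow> X x" for x
      using F by (simp add: X)
    fix x
    \<comment> \<open>For pointwise limits the square needs care: the inner iterate is split into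
      \<open>X x\<close> and an error, and the uniform bound on the outer iterates removes the
      error.\<close>
    have "(\<lambda>n. sqrt_iter E n (sqrt_iter E n x - X x)) \<longlonglongrightarrow> 0"
    proof (rule Lim_null_comparison)
      show "\<forall>\<^sub>F n in sequentially. norm (sqrt_iter E n (sqrt_iter E n x - X x)) \<le>
          norm (sqrt_iter E n x - X x)"
      proof (rule always_eventually, rule allI)
        fix n
        show "norm (sqrt_iter E n (sqrt_iter E n x - X x)) \<le> norm (sqrt_iter E n x - X x)"
          using sqrt_iter_norm[OF E, of n "sqrt_iter E n x - X x"]
            mult_right_mono[OF sqrt_majorant_bounds(2)[of n], of "norm (sqrt_iter E n x - X x)"]
          by (simp del: cblinfun_linear_simps)
      qed
      show "(\<lambda>n. norm (sqrt_iter E n x - X x)) \<longlonglongrightarrow> 0"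
        using F[of x] unfolding X by (intro tendsto_norm_zero) (simp add: LIM_zero)
    qed
    from tendsto_add[OF this F[of "X x"]]
    have sq: "(\<lambda>n. sqrt_iter E n (sqrt_iter E n x)) \<longlonglongrightarrow> X (X x)"
      by (simp add: X)
    have "(\<lambda>n. sqrt_iter E (Suc n) x) \<longlonglongrightarrow> (1/2) *\<^sub>R (E x + X (X x))"
      unfolding sqrt_iter.simps by (simp del: scaleR_right_distrib) (intro tendsto_intros sq)
    moreover have "(\<lambda>n. sqrt_iter E (Suc n) x) \<longlonglongrightarrow> X x"
      using LIMSEQ_Suc[OF F[of x]] by (simp add: X)
    ultimately have "X x = (1/2) *\<^sub>R (E x + X (X x))"
      using LIMSEQ_unique by blast
    then have "2 *\<^sub>R X x = 2 *\<^sub>R ((1/2) *\<^sub>R (E x + X (X x)))"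
      by (rule arg_cong)
    then show "X (X x) = 2 *\<^sub>R X x - E x"
      by (simp add: algebra_simps)
  qed
qed

text \<open>\<open>B + S\<close> kills \<open>y = B x - S x\<close> because the roots commute and
  have equal squares. Both forms are nonnegative, so each vanishes at \<open>y\<close>; then
  \<open>B y = S y = 0\<close>, and symmetry gives \<open>inner y y = 0\<close>.\<close>

lemma commuting_roots_eq:
  fixes S B :: "'a::chilbert_space \<Rightarrow>\<^sub>C\<^sub>L 'a"
  assumes S: "positive_op S" and B: "positive_op B" and sq: "\<And>x. S (S x) = B (B x)"
    and comm: "\<And>x. S (B x) = B (S x)"
  shows "S = B"
proof (rule cblinfun_eqI)
  fix x
  define y where "y = B x - S x"
  have "B y + S y = 0"
    by (simp add: y_def sq comm)
  then have "inner (B y) y + inner (S y) y = 0"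
    by (metis inner_add_left inner_zero_left)
  then have "inner (B y) y = 0" "inner (S y) y = 0"
    using positive_op_nonneg[OF S, of y] positive_op_nonneg[OF B, of y] by linarith+
  then have "B y = 0" "S y = 0"
    using positive_op_eq_zero S B by blast+
  then have "inner (B x - S x) y = 0"
    by (simp add: inner_diff_left positive_op_inner[OF S] positive_op_inner[OF B])
  then show "S x = B x"
    by (simp add: y_def)
qed

lemma sqrt_iter_symmetric:
  fixes E :: "'a::chilbert_space \<Rightarrow>\<^sub>C\<^sub>L 'a"
  assumes "\<And>x y. inner (E x) y = inner x (E y)"
  shows "inner (sqrt_iter E n x) y = inner x (sqrt_iter E n y)"
  by (induction n arbitrary: x y) (simp_all add: inner_add_left inner_add_right assms)

text \<open>The root is \<open>I - X\<close> for the limit \<open>X\<close> of the iteration with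
  \<open>E = I - A\<close>. The convergence is kept in the conclusion because commutation and
  intertwining are transferred through it.\<close>

lemma sqrt_iter_root:
  fixes A :: "'a::chilbert_space \<Rightarrow>\<^sub>C\<^sub>L 'a"
  assumes A: "positive_op A" and le: "\<And>x. inner (A x) x \<le> (norm x)\<^sup>2"
  shows "\<exists>S. positive_op S \<and> S o\<^sub>C\<^sub>L S = A \<and>
    (\<forall>x. (\<lambda>n. sqrt_iter (id_cblinfun - A) n x) \<longlonglongrightarrow> x - S x)"
proof -
  let ?E = "id_cblinfun - A"
  have "positive_op ?E"
    unfolding positive_op_iff using le
    by (simp add: inner_diff_left inner_diff_right positive_op_inner[OF A] power2_norm_eq_inner)
  moreover have "inner (?E x) x \<le> (norm x)\<^sup>2" for x
    using positive_op_nonneg[OF A, of x] by (simp add: inner_diff_left power2_norm_eq_inner)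
  ultimately have "contraction ?E"
    by (rule positive_op_contraction)
  from sqrt_iter_limit[OF this] obtain X where X: "contraction X"
    "\<And>x. (\<lambda>n. sqrt_iter ?E n x) \<longlonglongrightarrow> X x" "\<And>x. X (X x) = 2 *\<^sub>R X x - ?E x" by blast
  have sym: "inner (X x) y = inner x (X y)" for x y
  proof (rule LIMSEQ_unique)
    have "inner (sqrt_iter ?E n x) y = inner x (sqrt_iter ?E n y)" for n
      by (rule sqrt_iter_symmetric)
        (simp add: inner_diff_left inner_diff_right positive_op_inner[OF A])
    then show "(\<lambda>n. inner (sqrt_iter ?E n x) y) \<longlonglongrightarrow> inner x (X y)"
      using tendsto_inner[OF tendsto_const X(2)[of y]] by simp
    show "(\<lambda>n. inner (sqrt_iter ?E n x) y) \<longlonglongrightarrow> inner (X x) y"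
      by (intro tendsto_intros X(2))
  qed
  have "inner (X x) x \<le> inner x x" for x
  proof -
    have "inner (X x) x \<le> norm (X x) * norm x"
      by (rule norm_cauchy_schwarz)
    also have "\<dots> \<le> norm x * norm x"
      using X(1) by (intro mult_right_mono) (auto simp: contraction_iff)
    finally show ?thesis by (simp add: power2_norm_eq_inner[symmetric] power2_eq_square)
  qed
  then have "positive_op (id_cblinfun - X)"
    unfolding positive_op_iff using sym by (simp add: inner_diff_left inner_diff_right)
  moreover have "(id_cblinfun - X) o\<^sub>C\<^sub>L (id_cblinfun - X) = A"
    by (rule cblinfun_eqI) (simp add: X(3) scaleR_2)
  ultimately show ?thesis
    using X(2) by (intro exI[of _ "id_cblinfun - X"]) simp
qed

text \<open>Any positive root \<open>B\<close> commutes with its square \<open>A\<close>, hence with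
  the iterates and with their limit, so \<open>commuting_roots_eq\<close> applies.\<close>

lemma root_unique_unit:
  fixes A :: "'a::chilbert_space \<Rightarrow>\<^sub>C\<^sub>L 'a"
  assumes le: "\<And>x. inner (A x) x \<le> (norm x)\<^sup>2"
    and B: "positive_op B" "B o\<^sub>C\<^sub>L B = A" and S: "positive_op S" "S o\<^sub>C\<^sub>L S = A"
    and lim: "\<And>x. (\<lambda>n. sqrt_iter (id_cblinfun - A) n x) \<longlonglongrightarrow> x - S x"
  shows "S = B"
proof (rule commuting_roots_eq[OF S(1) B(1)])
  fix x
  have BB: "A x = B (B x)" for x
    using B(2) by (metis cblinfun_apply_compose)
  moreover have "A x = S (S x)" for x
    using S(2) by (metis cblinfun_apply_compose)
  ultimately show "S (S x) = B (B x)" by metis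
  have "(\<lambda>n. B (sqrt_iter (id_cblinfun - A) n x)) \<longlonglongrightarrow> B (x - S x)"
    by (intro bounded_linear.tendsto[OF bounded_linear_cblinfun_apply] lim)
  moreover have "B (sqrt_iter (id_cblinfun - A) n x) = sqrt_iter (id_cblinfun - A) n (B x)" for n
    by (rule sqrt_iter_intertwine) (simp add: BB)
  ultimately have "B (x - S x) = B x - S (B x)"
    using LIMSEQ_unique[OF _ lim[of "B x"]] by simp
  then show "S (B x) = B (S x)" by simp
qed

lemma ex1_positive_root:
  fixes A :: "'a::chilbert_space \<Rightarrow>\<^sub>C\<^sub>L 'a"
  assumes A: "positive_op A"
  shows "\<exists>!B. positive_op B \<and> B o\<^sub>C\<^sub>L B = A"
proof -
  \<comment> \<open>Scaling puts \<open>A\<close> between zero and the identity, where the iteration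
    converges; the \<open>+ 1\<close> keeps \<open>c\<close> positive for
    \<open>A = 0\<close>.\<close>
  define c where "c = norm A + 1"
  have c: "c > 0"
    by (simp add: c_def add_nonneg_pos)
  let ?A = "(1 / c) *\<^sub>R A"
  have "positive_op ?A"
    using A c unfolding positive_op_iff by auto
  moreover have le: "inner (?A x) x \<le> (norm x)\<^sup>2" for x
  proof -
    have "inner (A x) x \<le> norm (A x) * norm x"
      by (rule norm_cauchy_schwarz)
    also have "\<dots> \<le> (norm A * norm x) * norm x"
      by (intro mult_right_mono norm_cblinfun) auto
    also have "\<dots> \<le> c * (norm x)\<^sup>2"
      by (simp add: c_def power2_eq_square algebra_simps)
    finally show ?thesis
      using c by (simp add: pos_divide_le_eq mult.commute)
  qed
  ultimately obtain S where S: "positive_op S" "S o\<^sub>C\<^sub>L S = ?A"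
    "\<And>x. (\<lambda>n. sqrt_iter (id_cblinfun - ?A) n x) \<longlonglongrightarrow> x - S x"
    using sqrt_iter_root[of ?A] by blast
  have root: "sqrt c *\<^sub>R (sqrt c *\<^sub>R y) = c *\<^sub>R y" for y :: 'a
    using c by simp
  show ?thesis
  proof (rule ex1I[of _ "sqrt c *\<^sub>R S"], intro conjI)
    show "positive_op (sqrt c *\<^sub>R S)"
      using S(1) c unfolding positive_op_iff by auto
    show "sqrt c *\<^sub>R S o\<^sub>C\<^sub>L sqrt c *\<^sub>R S = A"
    proof (rule cblinfun_eqI)
      fix x
      have "S (S x) = (1 / c) *\<^sub>R A x"
        using S(2) by (metis cblinfun_apply_compose cblinfun_apply_scaleR)
      then show "(sqrt c *\<^sub>R S o\<^sub>C\<^sub>L sqrt c *\<^sub>R S) x = A x"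
        using c by simp
    qed
    fix B assume B: "positive_op B \<and> B o\<^sub>C\<^sub>L B = A"
    have "S = (1 / sqrt c) *\<^sub>R B"
    proof (rule root_unique_unit[of ?A])
      show "positive_op ((1 / sqrt c) *\<^sub>R B)"
        using B c unfolding positive_op_iff by auto
      show "(1 / sqrt c) *\<^sub>R B o\<^sub>C\<^sub>L (1 / sqrt c) *\<^sub>R B = ?A"
      proof (rule cblinfun_eqI)
        fix x
        have "B (B x) = A x"
          using B by (metis cblinfun_apply_compose)
        then show "((1 / sqrt c) *\<^sub>R B o\<^sub>C\<^sub>L (1 / sqrt c) *\<^sub>R B) x = ?A x"
          using c by simp
      qed
    qed (use le S in auto)
    then show "B = sqrt c *\<^sub>R S"
      using c by simp
  qed
qed

lemma op_sqrt:
  assumes "positive_op A"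
  shows "positive_op (op_sqrt A)" "op_sqrt A o\<^sub>C\<^sub>L op_sqrt A = A"
  using theI'[OF ex1_positive_root[OF assms]] unfolding op_sqrt_def by auto

lemma op_sqrt_apply: "positive_op A \<Longrightarrow> op_sqrt A (op_sqrt A x) = A x"
  using op_sqrt(2)[of A] by (metis cblinfun_apply_compose)

text \<open>Two operators on possibly different spaces are allowed, since the case wanted has
  \<open>T = X\<close> between the defects of \<open>X\<close> and of \<open>adj X\<close>.\<close>

lemma op_sqrt_intertwine:
  fixes T :: "'a::chilbert_space \<Rightarrow>\<^sub>C\<^sub>L 'b::chilbert_space"
  assumes A1: "positive_op A1" "\<And>x. inner (A1 x) x \<le> (norm x)\<^sup>2"
    and A2: "positive_op A2" "\<And>x. inner (A2 x) x \<le> (norm x)\<^sup>2"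
    and T: "\<And>x. T (A1 x) = A2 (T x)"
  shows "T (op_sqrt A1 x) = op_sqrt A2 (T x)"
proof -
  have lim1: "(\<lambda>n. sqrt_iter (id_cblinfun - A1) n x) \<longlonglongrightarrow> x - op_sqrt A1 x"
  proof -
    obtain S where S: "positive_op S" "S o\<^sub>C\<^sub>L S = A1"
      "\<And>x. (\<lambda>n. sqrt_iter (id_cblinfun - A1) n x) \<longlonglongrightarrow> x - S x"
      using sqrt_iter_root[OF A1] by blast
    then have "S = op_sqrt A1"
      using op_sqrt[OF A1(1)] ex1_positive_root[OF A1(1)] by blast
    then show ?thesis using S by simp
  qed
  have lim2: "(\<lambda>n. sqrt_iter (id_cblinfun - A2) n y) \<longlonglongrightarrow> y - op_sqrt A2 y" for y
  proof -
    obtain S where S: "positive_op S" "S o\<^sub>C\<^sub>L S = A2"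
      "\<And>x. (\<lambda>n. sqrt_iter (id_cblinfun - A2) n x) \<longlonglongrightarrow> x - S x"
      using sqrt_iter_root[OF A2] by blast
    then have "S = op_sqrt A2"
      using op_sqrt[OF A2(1)] ex1_positive_root[OF A2(1)] by blast
    then show ?thesis using S by simp
  qed
  have "(\<lambda>n. T (sqrt_iter (id_cblinfun - A1) n x)) \<longlonglongrightarrow> T (x - op_sqrt A1 x)"
    by (intro bounded_linear.tendsto[OF bounded_linear_cblinfun_apply] lim1)
  moreover have "T (sqrt_iter (id_cblinfun - A1) n x) = sqrt_iter (id_cblinfun - A2) n (T x)" for n
    by (rule sqrt_iter_intertwine) (simp add: T)
  ultimately have "T (x - op_sqrt A1 x) = T x - op_sqrt A2 (T x)"
    using LIMSEQ_unique[OF _ lim2[of "T x"]] by simp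
  then show ?thesis by simp
qed

text \<open>\<open>y = S x - x\<close> satisfies \<open>S y = - y\<close>, which positivity permits
  only for \<open>y = 0\<close>.\<close>

lemma positive_op_fixed_point:
  fixes S :: "'a::chilbert_space \<Rightarrow>\<^sub>C\<^sub>L 'a"
  assumes "positive_op S" and "S (S x) = x"
  shows "S x = x"
proof -
  define y where "y = S x - x"
  have "S y + y = 0"
    using assms(2) by (simp add: y_def)
  then have "inner (S y) y + inner y y = 0"
    by (metis inner_add_left inner_zero_left)
  then have "inner y y = 0"
    using positive_op_nonneg[OF assms(1), of y] inner_ge_zero[of y] by linarith
  then show ?thesis by (simp add: y_def)
qed

section \<open>Defect operators and the block contraction theorem\<close>

lemma defect_base:
  fixes X :: "'a::chilbert_space \<Rightarrow>\<^sub>C\<^sub>L 'b::chilbert_space"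
  assumes "contraction X"
  shows "positive_op (id_cblinfun - adj X o\<^sub>C\<^sub>L X)"
    and "inner ((id_cblinfun - adj X o\<^sub>C\<^sub>L X) x) x \<le> (norm x)\<^sup>2"
proof -
  have *: "inner ((id_cblinfun - adj X o\<^sub>C\<^sub>L X) x) x = (norm x)\<^sup>2 - (norm (X x))\<^sup>2" for x
    by (simp add: inner_diff_left inner_adj' power2_norm_eq_inner)
  show "inner ((id_cblinfun - adj X o\<^sub>C\<^sub>L X) x) x \<le> (norm x)\<^sup>2"
    unfolding * by simp
  have "0 \<le> inner ((id_cblinfun - adj X o\<^sub>C\<^sub>L X) x) x" for x
    unfolding * using assms by (simp add: contraction_iff power_mono)
  moreover have "inner ((id_cblinfun - adj X o\<^sub>C\<^sub>L X) x) y = inner x ((id_cblinfun - adj X o\<^sub>C\<^sub>L X) y)" for x y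
    by (simp add: inner_diff_left inner_diff_right inner_adj' inner_adj)
  ultimately show "positive_op (id_cblinfun - adj X o\<^sub>C\<^sub>L X)"
    unfolding positive_op_iff by blast
qed

lemma defect_positive: "contraction X \<Longrightarrow> positive_op (defect X)"
  unfolding defect_def by (intro op_sqrt defect_base)

lemma adj_defect: "contraction X \<Longrightarrow> adj (defect X) = defect X"
  by (intro positive_op_adj defect_positive)

lemma inner_defect: "contraction X \<Longrightarrow> inner (defect X x) y = inner x (defect X y)"
  by (intro positive_op_inner defect_positive)

lemma defect_defect: "contraction X \<Longrightarrow> defect X (defect X x) = x - adj X (X x)"
  unfolding defect_def by (subst op_sqrt_apply) (simp_all add: defect_base)

lemma norm_defect: "contraction X \<Longrightarrow> (norm (defect X x))\<^sup>2 = (norm x)\<^sup>2 - (norm (X x))\<^sup>2"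
  by (simp add: power2_norm_eq_inner inner_defect defect_defect inner_diff_right inner_adj[symmetric])

text \<open>\<open>X\<close> intertwines \<open>I - X\<^sup>* X\<close> with
  \<open>I - X X\<^sup>*\<close>, hence also their roots.\<close>

lemma defect_intertwine:
  assumes "contraction X"
  shows "X (defect X x) = defect (adj X) (X x)"
  unfolding defect_def
  using defect_base[OF assms] defect_base[OF contraction_adj[OF assms]]
  by (intro op_sqrt_intertwine) simp_all

lemma defect_fixed_point: "contraction X \<Longrightarrow> X x = 0 \<Longrightarrow> defect X x = x"
  by (rule positive_op_fixed_point) (simp_all add: defect_positive defect_defect)

text \<open>The Julia operator with rows \<open>A, D_{A*}\<close> and \<open>D_A, -A*\<close> is
  isometric: squared terms are the defect norms, and mixed terms cancel by
  \<open>defect_intertwine\<close>.\<close>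

lemma julia_identity:
  assumes A: "contraction A"
  shows "(norm (A f + defect (adj A) g))\<^sup>2 + (norm (defect A f - adj A g))\<^sup>2 =
    (norm f)\<^sup>2 + (norm g)\<^sup>2"
proof -
  have "inner (A f) (defect (adj A) g) = inner (defect A f) (adj A g)"
  proof -
    have "inner (A f) (defect (adj A) g) = inner (A (defect A f)) g"
      using contraction_adj[OF A] by (simp add: defect_intertwine[OF A] inner_defect)
    then show ?thesis by (simp add: inner_adj)
  qed
  then show ?thesis
    using norm_defect[OF A, of f] norm_defect[OF contraction_adj[OF A], of g]
    by (simp add: power2_norm_eq_inner inner_add_left inner_add_right inner_diff_left
        inner_diff_right inner_commute)
qed

section \<open>Contractive rows and two-by-two block operators\<close>

lemma op_block_apply [simp]:
  "op_block A B C D x = (A (fst x) + B (snd x), C (fst x) + D (snd x))"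
  by transfer simp

lemma op_column_apply [simp]: "op_column A B x = (A x, B x)"
  by transfer simp

text \<open>The column of \<open>adj N\<close> and \<open>defect (adj N)\<close> is isometric, so
  the row, its adjoint, is a contraction. The proof expands the squared distance from
  \<open>(z, w)\<close> to that column applied to \<open>u\<close>.\<close>

lemma row_defect_bound:
  fixes N :: "'a::chilbert_space \<Rightarrow>\<^sub>C\<^sub>L 'b::chilbert_space"
  assumes N: "contraction N"
  shows "(norm (N z + defect (adj N) w))\<^sup>2 \<le> (norm z)\<^sup>2 + (norm w)\<^sup>2"
proof -
  define u where "u = N z + defect (adj N) w"
  have "(norm u)\<^sup>2 = inner z (adj N u) + inner w (defect (adj N) u)"
    unfolding u_def by (simp add: power2_norm_eq_inner inner_add_left inner_adj
        adj_defect contraction_adj[OF N])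
  moreover have "(norm (defect (adj N) u))\<^sup>2 = (norm u)\<^sup>2 - (norm (adj N u))\<^sup>2"
    by (intro norm_defect contraction_adj N)
  moreover have "0 \<le> (norm (z - adj N u))\<^sup>2 + (norm (w - defect (adj N) u))\<^sup>2"
    by simp
  ultimately have "(norm u)\<^sup>2 \<le> (norm z)\<^sup>2 + (norm w)\<^sup>2"
    by (simp add: power2_norm_eq_inner inner_diff_left inner_diff_right inner_commute)
  then show ?thesis by (simp add: u_def)
qed

text \<open>Testing the bound against \<open>z = t N\<^sup>* y\<close> gives a quadratic in
  \<open>t\<close>, whose discriminant yields the form bound.\<close>

lemma row_factorization:
  fixes N :: "'a::chilbert_space \<Rightarrow>\<^sub>C\<^sub>L 'b::chilbert_space" and Y :: "'c::chilbert_space \<Rightarrow>\<^sub>C\<^sub>L 'b"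
    and M :: "'c \<Rightarrow>\<^sub>C\<^sub>L 'd::chilbert_space"
  assumes N: "contraction N" and M: "contraction M"
    and bound: "\<And>z h. (norm (N z + Y h))\<^sup>2 \<le> (norm z)\<^sup>2 + (norm (defect M h))\<^sup>2"
  shows "\<exists>K. contraction K \<and> Y = defect (adj N) o\<^sub>C\<^sub>L K o\<^sub>C\<^sub>L defect M"
proof -
  have form: "\<bar>inner (Y h) y\<bar> \<le> norm (defect M h) * norm (defect (adj N) y)" for h y
  proof -
    define a b c n where "a = (norm (adj N y))\<^sup>2" and "b = inner (Y h) y"
      and "c = (norm (defect M h))\<^sup>2" and "n = (norm y)\<^sup>2"
    have n_a: "(norm (defect (adj N) y))\<^sup>2 = n - a"
      unfolding n_def a_def by (intro norm_defect contraction_adj N)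
    have ineq: "(t * a + b)\<^sup>2 \<le> (t\<^sup>2 * a + c) * n" for t
    proof -
      have "inner (N (t *\<^sub>R adj N y) + Y h) y = t * a + b"
        by (simp add: a_def b_def inner_add_left inner_adj power2_norm_eq_inner)
      then have "(t * a + b)\<^sup>2 \<le> (norm (N (t *\<^sub>R adj N y) + Y h))\<^sup>2 * n"
        using Cauchy_Schwarz_ineq[of "N (t *\<^sub>R adj N y) + Y h" y]
        by (simp add: n_def power2_norm_eq_inner)
      also have "\<dots> \<le> (t\<^sup>2 * a + c) * n"
        using bound[of "t *\<^sub>R adj N y" h]
        by (intro mult_right_mono) (simp_all add: a_def c_def n_def power_mult_distrib)
      finally show ?thesis .
    qed
    have "0 \<le> (a * n - a\<^sup>2) * t\<^sup>2 + 2 * (- a * b) * t + (c * n - b\<^sup>2)" for t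
      using ineq[of t] by (simp add: power2_eq_square algebra_simps)
    \<comment> \<open>Expanding, the square of \<open>a * b\<close> cancels and the common factor
      \<open>a * n\<close> leaves the claim. For \<open>a = 0\<close> nothing can be divided, and
      \<open>ineq\<close> at \<open>t = 0\<close> serves instead.\<close>
    then have disc: "(- a * b)\<^sup>2 \<le> (a * n - a\<^sup>2) * (c * n - b\<^sup>2)"
      by (rule quadratic_nonneg_discriminant)
    have "b\<^sup>2 \<le> c * (n - a)"
    proof (cases "a = 0")
      case True
      then show ?thesis using ineq[of 0] by simp
    next
      case False
      then have "a > 0" by (simp add: a_def)
      moreover have "0 \<le> n - a"
        by (simp add: n_a[symmetric])
      ultimately have "n > 0" by linarith
      have "(a * n) * b\<^sup>2 \<le> (a * n) * (c * (n - a))"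
        using disc by (simp add: power2_eq_square algebra_simps)
      then show ?thesis
        using \<open>a > 0\<close> \<open>n > 0\<close> by (simp add: mult_le_cancel_left_pos)
    qed
    then have "b\<^sup>2 \<le> (norm (defect M h) * norm (defect (adj N) y))\<^sup>2"
      by (simp add: power_mult_distrib n_a c_def)
    then show ?thesis
      by (simp add: b_def abs_le_square_iff[symmetric] abs_mult)
  qed
  show ?thesis
    using form_factorization[OF form] adj_defect[OF contraction_adj[OF N]] by auto
qed

text \<open>The Julia identity for \<open>B\<close> with \<open>g = M h\<close> eliminates the first
  row: with \<open>z = defect B f - adj B (M h)\<close>, contractivity bounds the norm of
  \<open>N z + Y h\<close> by those of \<open>z\<close> and \<open>defect M h\<close>. The kernel
  assumptions free \<open>z\<close> to range over the whole space, and the rest is a factorization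
  problem for a row.\<close>

lemma block_contraction_iff:
  fixes B :: "'a::chilbert_space \<Rightarrow>\<^sub>C\<^sub>L 'a" and N :: "'a \<Rightarrow>\<^sub>C\<^sub>L 'b::chilbert_space"
    and M :: "'b \<Rightarrow>\<^sub>C\<^sub>L 'a" and X :: "'b \<Rightarrow>\<^sub>C\<^sub>L 'b"
  assumes B: "contraction B" and N: "contraction N" and M: "contraction M"
    and N_ker: "kernel (defect B) \<subseteq> kernel N"
    and M_ker: "kernel (defect (adj B)) \<subseteq> kernel (adj M)"
  shows "contraction (op_block B (defect (adj B) o\<^sub>C\<^sub>L M) (N o\<^sub>C\<^sub>L defect B) X) \<longleftrightarrow>
    (\<exists>K. contraction K \<and> X = defect (adj N) o\<^sub>C\<^sub>L K o\<^sub>C\<^sub>L defect M - N o\<^sub>C\<^sub>L adj B o\<^sub>C\<^sub>L M)"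
    (is "contraction ?T \<longleftrightarrow> ?R")
proof -
  \<comment> \<open>\<open>X\<close> measured from the center of the ball.\<close>
  define Y where "Y = X + N o\<^sub>C\<^sub>L adj B o\<^sub>C\<^sub>L M"
  have T_iff: "contraction ?T \<longleftrightarrow> (\<forall>f h. (norm (N (defect B f - adj B (M h)) + Y h))\<^sup>2 \<le>
      (norm (defect B f - adj B (M h)))\<^sup>2 + (norm (defect M h))\<^sup>2)"
  proof -
    have "norm (?T (f, h)) \<le> norm (f, h) \<longleftrightarrow>
        (norm (N (defect B f - adj B (M h)) + Y h))\<^sup>2 \<le>
        (norm (defect B f - adj B (M h)))\<^sup>2 + (norm (defect M h))\<^sup>2" for f h
    proof -
      have "N (defect B f) + X h = N (defect B f - adj B (M h)) + Y h"
        by (simp add: Y_def)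
      then have "norm (?T (f, h)) \<le> norm (f, h) \<longleftrightarrow>
          (norm (B f + defect (adj B) (M h)))\<^sup>2 + (norm (N (defect B f - adj B (M h)) + Y h))\<^sup>2
          \<le> (norm f)\<^sup>2 + (norm h)\<^sup>2"
        by (simp add: norm_Pair del: cblinfun_linear_simps)
      then show ?thesis
        using julia_identity[OF B, of f "M h"] norm_defect[OF M, of h] by linarith
    qed
    then show ?thesis
      unfolding contraction_iff split_paired_All by blast
  qed
  have "contraction ?T \<longleftrightarrow>
      (\<forall>z h. (norm (N z + Y h))\<^sup>2 \<le> (norm z)\<^sup>2 + (norm (defect M h))\<^sup>2)"
  proof
    assume "contraction ?T"
    show "\<forall>z h. (norm (N z + Y h))\<^sup>2 \<le> (norm z)\<^sup>2 + (norm (defect M h))\<^sup>2"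
    proof (intro allI)
      fix z h
      \<comment> \<open>\<open>T_iff\<close> handles \<open>w - b\<close> for \<open>w\<close> in
        the range of \<open>defect B\<close>, hence by continuity in its closure. The remaining
        \<open>v\<close> is killed by \<open>defect B\<close>; then \<open>N v = 0\<close>, and
        \<open>B v\<close> lies in the kernel of \<open>adj M\<close>, so \<open>v\<close> is
        orthogonal to \<open>b\<close>. Adding \<open>v\<close> only enlarges the right-hand
        side.\<close>
      define b where "b = adj B (M h)"
      obtain w v where wv: "z + b = w + v" "w \<in> closure (range (defect B))"
        "\<And>y. inner (defect B y) v = 0"
        using closure_range_decompose[of "defect B" "z + b"] by auto
      have "inner (defect B v) (defect B v) = 0"
        using wv(3)[of "defect B v"] by (simp add: inner_defect[OF B])
      then have v: "defect B v = 0" by simp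
      with N_ker have "N v = 0" by (auto simp: kernel_def)
      have "defect (adj B) (B v) = 0"
        using defect_intertwine[OF B, of v] v by simp
      with M_ker have "adj M (B v) = 0" by (auto simp: kernel_def)
      then have "inner b v = 0"
        unfolding b_def by (simp add: inner_adj' inner_adj)
      moreover have "inner w v = 0"
        using orthogonal_closure_range[of "defect B" v w] wv(2,3) by blast
      ultimately have "inner (w - b) v = 0"
        by (simp add: inner_diff_left)
      moreover have z: "z = (w - b) + v"
        using wv(1) by (simp add: algebra_simps)
      ultimately have "(norm z)\<^sup>2 = (norm (w - b))\<^sup>2 + (norm v)\<^sup>2"
        by (simp add: power2_norm_eq_inner inner_add_left inner_add_right inner_commute)
      moreover have "(norm (N (w - b) + Y h))\<^sup>2 \<le> (norm (w - b))\<^sup>2 + (norm (defect M h))\<^sup>2"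
      proof -
        let ?S = "{w. (norm (N (w - b) + Y h))\<^sup>2 \<le> (norm (w - b))\<^sup>2 + (norm (defect M h))\<^sup>2}"
        have "continuous_on UNIV (\<lambda>w. N (w - b))"
          by (intro bounded_linear.continuous_on[OF bounded_linear_cblinfun_apply] continuous_intros)
        then have "closed ?S"
          by (intro closed_Collect_le continuous_intros)
        moreover have "range (defect B) \<subseteq> ?S"
          using \<open>contraction ?T\<close> unfolding T_iff b_def by blast
        ultimately show ?thesis
          using closure_minimal wv(2) by blast
      qed
      moreover have "N z = N (w - b)"
        unfolding z using \<open>N v = 0\<close> by simp
      ultimately show "(norm (N z + Y h))\<^sup>2 \<le> (norm z)\<^sup>2 + (norm (defect M h))\<^sup>2"
        by (smt (verit) zero_le_power2)
    qed
  qed (use T_iff in blast)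
  also have "\<dots> \<longleftrightarrow> (\<exists>K. contraction K \<and> Y = defect (adj N) o\<^sub>C\<^sub>L K o\<^sub>C\<^sub>L defect M)"
  proof
    assume "\<exists>K. contraction K \<and> Y = defect (adj N) o\<^sub>C\<^sub>L K o\<^sub>C\<^sub>L defect M"
    then obtain K where K: "contraction K" "Y = defect (adj N) o\<^sub>C\<^sub>L K o\<^sub>C\<^sub>L defect M" by blast
    show "\<forall>z h. (norm (N z + Y h))\<^sup>2 \<le> (norm z)\<^sup>2 + (norm (defect M h))\<^sup>2"
    proof (intro allI)
      fix z h
      have "(norm (K (defect M h)))\<^sup>2 \<le> (norm (defect M h))\<^sup>2"
        using K(1) by (intro power_mono) (auto simp: contraction_iff)
      moreover have "Y h = defect (adj N) (K (defect M h))"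
        using K(2) by simp
      ultimately show "(norm (N z + Y h))\<^sup>2 \<le> (norm z)\<^sup>2 + (norm (defect M h))\<^sup>2"
        using row_defect_bound[OF N, of z "K (defect M h)"] by (metis add_left_mono order_trans)
    qed
  qed (use row_factorization[OF N M] in blast)
  also have "\<dots> \<longleftrightarrow> ?R"
    unfolding Y_def by (simp add: eq_diff_eq)
  finally show ?thesis .
qed

section \<open>Factorization of the imaginary part\<close>

text \<open>Polarization writes the mixed term as a difference of two diagonal terms, and the
  parallelogram law sums their bounds. Scaling \<open>f\<close> by \<open>t\<close> turns the sum of
  squares into a product via the discriminant.\<close>

lemma symmetric_form_bound:
  fixes Q :: "'a::chilbert_space \<Rightarrow>\<^sub>C\<^sub>L 'a" and M :: "'a \<Rightarrow>\<^sub>C\<^sub>L 'b::chilbert_space"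
  assumes sym: "\<And>x y. inner (Q x) y = inner x (Q y)"
    and bound: "\<And>f. \<bar>inner (Q f) f\<bar> \<le> (norm (M f))\<^sup>2"
  shows "\<bar>inner (Q f) g\<bar> \<le> norm (M f) * norm (M g)"
proof -
  have "0 \<le> (norm (M f))\<^sup>2 * t\<^sup>2 + 2 * (- inner (Q f) g) * t + (norm (M g))\<^sup>2" for t
  proof -
    have Q_gf: "inner (Q g) f = inner (Q f) g"
      using sym[of g f] by (simp add: inner_commute)
    have "inner (Q (t *\<^sub>R f + g)) (t *\<^sub>R f + g) - inner (Q (t *\<^sub>R f - g)) (t *\<^sub>R f - g) =
        4 * t * inner (Q f) g"
      using Q_gf by (simp add: inner_add_left inner_add_right inner_diff_left inner_diff_right
          right_diff_distrib distrib_left)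
    moreover have "(norm (M (t *\<^sub>R f + g)))\<^sup>2 + (norm (M (t *\<^sub>R f - g)))\<^sup>2 =
        2 * (t\<^sup>2 * (norm (M f))\<^sup>2) + 2 * (norm (M g))\<^sup>2"
      unfolding power2_norm_eq_inner
      by (simp add: inner_add_left inner_add_right inner_diff_left
          inner_diff_right power2_eq_square right_diff_distrib distrib_left)
    ultimately have "4 * t * inner (Q f) g \<le> 2 * (t\<^sup>2 * (norm (M f))\<^sup>2) + 2 * (norm (M g))\<^sup>2"
      using abs_le_D1[OF bound[of "t *\<^sub>R f + g"]] abs_le_D2[OF bound[of "t *\<^sub>R f - g"]] by linarith
    then show ?thesis by (simp add: algebra_simps)
  qed
  then have "(- inner (Q f) g)\<^sup>2 \<le> (norm (M f))\<^sup>2 * (norm (M g))\<^sup>2"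
    by (rule quadratic_nonneg_discriminant)
  then have "(inner (Q f) g)\<^sup>2 \<le> (norm (M f) * norm (M g))\<^sup>2"
    by (simp add: power_mult_distrib)
  then show ?thesis
    by (simp add: abs_le_square_iff[symmetric] abs_mult)
qed

lemma selfadjoint_contraction_bounds:
  assumes "selfadjoint C" and "contraction C"
  shows "- id_cblinfun \<preceq> C" and "C \<preceq> id_cblinfun" and "\<bar>inner (C x) x\<bar> \<le> (norm x)\<^sup>2"
proof -
  show *: "\<bar>inner (C x) x\<bar> \<le> (norm x)\<^sup>2" for x
  proof -
    have "\<bar>inner (C x) x\<bar> \<le> norm (C x) * norm x"
      by (rule Cauchy_Schwarz_ineq2)
    also have "\<dots> \<le> norm x * norm x"
      using assms(2) by (intro mult_right_mono) (auto simp: contraction_iff)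
    finally show ?thesis by (simp add: power2_eq_square)
  qed
  have "0 \<le> inner x x - inner (C x) x" "0 \<le> inner (C x) x + inner x x" for x
    using *[of x] unfolding power2_norm_eq_inner by linarith+
  then show "- id_cblinfun \<preceq> C" "C \<preceq> id_cblinfun"
    using assms(1) unfolding op_le_def positive_op_iff selfadjoint_iff
    by (auto simp: inner_diff_left inner_diff_right inner_add_left inner_add_right)
qed

lemma contraction_compose: "contraction A \<Longrightarrow> contraction B \<Longrightarrow> contraction (A o\<^sub>C\<^sub>L B)"
  unfolding contraction_iff by (auto intro: order_trans)

lemma defect_contraction: "contraction X \<Longrightarrow> contraction (defect X)"
  unfolding contraction_iff[of "defect X"]
  using norm_defect[of X] by (simp add: power2_le_imp_le)

lemma selfadjoint_factorization:
  fixes A Q :: "'a::chilbert_space \<Rightarrow>\<^sub>C\<^sub>L 'a" and V :: "'a \<Rightarrow>\<^sub>C\<^sub>L 'b::chilbert_space"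
  assumes A: "contraction A" and V: "contraction V"
    and V_ker: "kernel (defect A) \<subseteq> kernel V" and t: "0 \<le> t"
    and sym: "\<And>x y. inner (Q x) y = inner x (Q y)"
    and bound: "\<And>f. \<bar>inner (Q f) f\<bar> \<le> t * (norm (defect V (defect A f)))\<^sup>2"
  shows "\<exists>C'. selfadjoint C' \<and> contraction C' \<and>
    kernel (defect A) \<subseteq> kernel (defect V o\<^sub>C\<^sub>L C' o\<^sub>C\<^sub>L defect V) \<and>
    Q = t *\<^sub>R (defect A o\<^sub>C\<^sub>L (defect V o\<^sub>C\<^sub>L C' o\<^sub>C\<^sub>L defect V) o\<^sub>C\<^sub>L defect A)"
proof -
  define M where "M = sqrt t *\<^sub>R (defect V o\<^sub>C\<^sub>L defect A)"
  have "\<bar>inner (Q f) f\<bar> \<le> (norm (M f))\<^sup>2" for f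
    using bound[of f] t by (simp add: M_def power_mult_distrib)
  from form_factorization[OF symmetric_form_bound[OF sym this]]
  obtain K where K: "contraction K" "Q = adj M o\<^sub>C\<^sub>L K o\<^sub>C\<^sub>L M"
    "\<And>x. (\<And>y. inner (M y) x = 0) \<Longrightarrow> K x = 0"
    "\<And>x. (\<And>y. inner (M y) x = 0) \<Longrightarrow> adj K x = 0" by blast
  \<comment> \<open>\<open>Q\<close> is symmetric, so its form does not change when \<open>K\<close>
    is replaced by its selfadjoint part.\<close>
  define C' where "C' = (1/2) *\<^sub>R (K + adj K)"
  have form: "inner (Q x) y = inner (C' (M x)) (M y)" for x y
  proof -
    have Q: "inner (Q x) y = inner (K (M x)) (M y)" for x y
      unfolding K(2) by (simp add: inner_adj')
    have "inner (Q x) y = inner (Q y) x"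
      using sym by (metis inner_commute)
    also have "\<dots> = inner (adj K (M x)) (M y)"
      unfolding Q by (metis inner_adj inner_commute)
    finally show ?thesis
      using Q[of x y] by (simp add: C'_def inner_add_left)
  qed
  show ?thesis
  proof (intro exI[of _ C'] conjI)
    show "selfadjoint C'"
      by (simp add: selfadjoint_def C'_def add.commute)
    show "contraction C'"
      unfolding contraction_iff
    proof
      fix x
      have "norm (K x + adj K x) \<le> norm x + norm x"
        using norm_triangle_ineq[of "K x" "adj K x"] K(1) contraction_adj[OF K(1)]
        unfolding contraction_iff by (smt (verit))
      moreover have "norm (C' x) = norm (K x + adj K x) / 2"
        unfolding C'_def cblinfun_apply_scaleR cblinfun_apply_plus norm_scaleR by simp
      ultimately show "norm (C' x) \<le> norm x" by linarith
    qed
    show "kernel (defect A) \<subseteq> kernel (defect V o\<^sub>C\<^sub>L C' o\<^sub>C\<^sub>L defect V)"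
    proof
      fix x assume x: "x \<in> kernel (defect A)"
      \<comment> \<open>On the kernel of \<open>defect A\<close> the defect of \<open>V\<close> acts
        as the identity, so \<open>x\<close> is orthogonal to the range of \<open>M\<close>, where
        both \<open>K\<close> and \<open>adj K\<close> vanish.\<close>
      with V_ker have "V x = 0" by (auto simp: kernel_def)
      then have Vx: "defect V x = x"
        by (rule defect_fixed_point[OF V])
      have "inner (M y) x = 0" for y
        using x by (simp add: M_def inner_defect[OF V] Vx inner_defect[OF A] kernel_def)
      then have "C' x = 0"
        by (simp add: C'_def K(3,4))
      then show "x \<in> kernel (defect V o\<^sub>C\<^sub>L C' o\<^sub>C\<^sub>L defect V)"
        by (simp add: kernel_def Vx)
    qed
    show "Q = t *\<^sub>R (defect A o\<^sub>C\<^sub>L (defect V o\<^sub>C\<^sub>L C' o\<^sub>C\<^sub>L defect V) o\<^sub>C\<^sub>L defect A)"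
    proof (rule cblinfun_inner_eqI)
      fix x y
      have "inner (Q x) y = t * inner (C' (defect V (defect A x))) (defect V (defect A y))"
        unfolding form using t by (simp add: M_def)
      then show "inner (Q x) y =
          inner ((t *\<^sub>R (defect A o\<^sub>C\<^sub>L (defect V o\<^sub>C\<^sub>L C' o\<^sub>C\<^sub>L defect V) o\<^sub>C\<^sub>L defect A)) x) y"
        by (simp add: inner_defect[OF V] inner_defect[OF A])
    qed
  qed
qed

section \<open>The imaginary part and the sector condition\<close>

lemma scaleC_diff_right: "c *\<^sub>C (x - y) = c *\<^sub>C x - c *\<^sub>C (y::'a::chilbert_space)"
  using scaleC_add_right[of c x "- y"] by (simp add: chilbert_scaleC_minus_right)

lemma two_im_part_apply: "(2 *\<^sub>R im_part X) x = (- \<i>) *\<^sub>C (X x - adj X x)"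
proof -
  have "(2 *\<^sub>R im_part X) x = (complex_of_real 2 * (1 / (2 * \<i>))) *\<^sub>C (X x - adj X x)"
    unfolding im_part_def by (simp only: cblinfun_apply_scaleR cblinfun_apply_scaleC_op
        cblinfun_apply_minus scaleR_scaleC scaleC_scaleC)
  also have "complex_of_real 2 * (1 / (2 * \<i>)) = - \<i>"
    by (simp add: complex_eq_iff)
  finally show ?thesis .
qed

lemma im_part_adj: "im_part (adj X) = - im_part X"
proof (rule cblinfun_eqI)
  fix x
  have "c *\<^sub>C (adj X x - X x) = - (c *\<^sub>C (X x - adj X x))" for c
    by (metis chilbert_scaleC_minus_right minus_diff_eq)
  then show "im_part (adj X) x = (- im_part X) x"
    by (simp add: im_part_def)
qed

lemma inner_two_im_part_commute:
  "inner ((2 *\<^sub>R im_part (adj A)) x) y = inner x ((2 *\<^sub>R im_part (adj A)) y)"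
proof -
  have "inner ((2 *\<^sub>R im_part (adj A)) x) y = inner (adj A x - A x) (\<i> *\<^sub>C y)"
    unfolding two_im_part_apply by (simp add: inner_scaleC)
  also have "\<dots> = inner x (\<i> *\<^sub>C (A y - adj A y))"
    by (simp add: inner_diff_left inner_adj' inner_adj scaleC_diff_right inner_diff_right)
  also have "\<i> *\<^sub>C (A y - adj A y) = (2 *\<^sub>R im_part (adj A)) y"
    unfolding two_im_part_apply by (simp add: scaleC_minus_left chilbert_scaleC_minus_right[symmetric])
  finally show ?thesis .
qed

lemma inner_two_im_part_self: "inner ((2 *\<^sub>R im_part (adj A)) f) f = - 2 * inner (A f) (\<i> *\<^sub>C f)"
proof -
  have "inner ((2 *\<^sub>R im_part (adj A)) f) f = inner (adj A f) (\<i> *\<^sub>C f) - inner (A f) (\<i> *\<^sub>C f)"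
    unfolding two_im_part_apply by (simp add: inner_scaleC inner_diff_left)
  also have "inner (adj A f) (\<i> *\<^sub>C f) = inner f (\<i> *\<^sub>C A f)"
    by (simp add: inner_adj')
  also have "\<dots> = inner (\<i> *\<^sub>C A f) f"
    by (rule inner_commute)
  also have "\<dots> = - inner (A f) (\<i> *\<^sub>C f)"
    by (simp add: inner_scaleC scaleC_minus_left)
  finally show ?thesis by simp
qed

lemma op_column_norm: "(norm (op_column A B x))\<^sup>2 = (norm (A x))\<^sup>2 + (norm (B x))\<^sup>2"
  by (simp add: norm_Pair)

lemma op_column_contraction: "contraction (op_column A B) \<Longrightarrow> contraction A"
  unfolding contraction_iff
  by (metis norm_fst_le op_column_apply order_trans fst_conv)

text \<open>The squared norm of \<open>defect ?T f\<close> is what remains of that of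
  \<open>f\<close> after removing those of \<open>A f\<close> and \<open>V (defect A f)\<close>,
  namely that of \<open>defect V (defect A f)\<close>. At \<open>\<phi> = 0\<close> the tangent
  vanishes, in agreement with the separate clause of the condition.\<close>

lemma sector_condition_bound:
  fixes A :: "'a::chilbert_space \<Rightarrow>\<^sub>C\<^sub>L 'a" and V :: "'a \<Rightarrow>\<^sub>C\<^sub>L 'b::chilbert_space"
  assumes T: "contraction (op_column A (V o\<^sub>C\<^sub>L defect A))" and V: "contraction V"
    and \<phi>: "0 \<le> \<phi>" "\<phi> < pi / 2" and sector: "sector_condition \<phi> (op_column A (V o\<^sub>C\<^sub>L defect A))"
  shows "\<bar>inner ((2 *\<^sub>R im_part (adj A)) f) f\<bar> \<le> tan \<phi> * (norm (defect V (defect A f)))\<^sup>2"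
proof -
  let ?T = "op_column A (V o\<^sub>C\<^sub>L defect A)"
  have A: "contraction A"
    using T by (rule op_column_contraction)
  have im: "Im (cinner (?T f) (f, 0)) = inner (A f) (\<i> *\<^sub>C f)"
    by (simp add: cinner_prod_def cinner_eq_inner)
  have defect_T: "(norm (defect ?T f))\<^sup>2 = (norm (defect V (defect A f)))\<^sup>2"
    by (simp only: norm_defect[OF T] norm_defect[OF V] norm_defect[OF A] op_column_norm
        cblinfun_apply_compose diff_diff_eq)
  show ?thesis
  proof (cases "\<phi> = 0")
    case True
    then show ?thesis
      using sector im unfolding inner_two_im_part_self sector_condition_def by simp
  next
    case False
    then have tan: "tan \<phi> > 0"
      using \<phi> by (intro tan_gt_zero) auto
    have "2 * cot \<phi> * \<bar>inner (A f) (\<i> *\<^sub>C f)\<bar> \<le> (norm (defect V (defect A f)))\<^sup>2"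
      using sector False unfolding sector_condition_def im[symmetric] defect_T[symmetric] by simp
    then have "tan \<phi> * (2 * cot \<phi> * \<bar>inner (A f) (\<i> *\<^sub>C f)\<bar>) \<le>
        tan \<phi> * (norm (defect V (defect A f)))\<^sup>2"
      using tan by (intro mult_left_mono) auto
    moreover have "tan \<phi> * cot \<phi> = 1"
      using tan by (auto simp: tan_def cot_def)
    then have "tan \<phi> * (2 * cot \<phi> * \<bar>inner (A f) (\<i> *\<^sub>C f)\<bar>) = 2 * \<bar>inner (A f) (\<i> *\<^sub>C f)\<bar>"
      by (metis mult.assoc mult.commute mult_1)
    ultimately show ?thesis
      unfolding inner_two_im_part_self by (simp add: abs_mult)
  qed
qed

section \<open>Partial isometries of the decompositions\<close>

lemma orthogonal_range_positive:
  assumes "positive_op D" and "\<And>y. inner (D y) q = 0"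
  shows "D q = 0"
proof -
  have "inner (D q) (D q) = 0"
    using assms(2)[of "D q"] positive_op_inner[OF assms(1)] by metis
  then show ?thesis by simp
qed

lemma orthogonal_complement_kernel:
  assumes D: "positive_op D"
  shows "orthogonal_complement (kernel D) = closure (range D)"
proof (intro equalityI subsetI)
  fix x assume x: "x \<in> orthogonal_complement (kernel D)"
  obtain p q where pq: "x = p + q" "p \<in> closure (range D)" "\<And>y. inner (D y) q = 0"
    using closure_range_decompose[of D x] by auto
  have "D q = 0"
    using D pq(3) by (rule orthogonal_range_positive)
  then have "cinner x q = 0"
    using x by (simp add: orthogonal_complement_def kernel_def)
  then have "inner x q = 0"
    by (simp add: Re_cinner[symmetric])
  moreover have "inner p q = 0"
    using orthogonal_closure_range[of D q p] pq by blast
  ultimately have "inner q q = 0"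
    using pq(1) by (simp add: inner_add_left)
  with pq show "x \<in> closure (range D)" by simp
next
  fix x assume x: "x \<in> closure (range D)"
  have "inner x y = 0" if "D y = 0" for y
  proof (rule orthogonal_closure_range[OF _ x])
    show "inner (D z) y = 0" for z
      using positive_op_inner[OF D, of z y] that by simp
  qed
  then show "x \<in> orthogonal_complement (kernel D)"
    by (simp add: orthogonal_complement_def kernel_def cinner_eq_inner complex_eq_iff)
qed

lemma eq_on_closure_range:
  fixes L :: "'b::real_vector \<Rightarrow> 'a::chilbert_space" and W W' :: "'a \<Rightarrow>\<^sub>C\<^sub>L 'c::chilbert_space"
  assumes L: "linear L" and range: "\<And>x. W (L x) = W' (L x)"
    and orth: "\<And>x. (\<And>y. inner (L y) x = 0) \<Longrightarrow> W x = W' x"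
  shows "W = W'"
proof (rule cblinfun_eqI)
  fix x
  obtain p q where pq: "x = p + q" "p \<in> closure (range L)" "\<And>y. inner (L y) q = 0"
    using closure_range_decompose[OF L, of x] by auto
  have "closed {p. W p = W' p}"
    by (intro closed_Collect_eq bounded_linear.continuous_on[OF bounded_linear_cblinfun_apply]
        continuous_intros)
  then have "closure (range L) \<subseteq> {p. W p = W' p}"
    using range by (intro closure_minimal) auto
  then show "W x = W' x"
    using pq orth[of q] by auto
qed

lemma op_inverse_eqI:
  assumes "A o\<^sub>C\<^sub>L B = id_cblinfun" and "B o\<^sub>C\<^sub>L A = id_cblinfun"
  shows "op_inverse A = B"
  unfolding op_inverse_def
proof (rule the_equality)
  fix B' assume B': "A o\<^sub>C\<^sub>L B' = id_cblinfun \<and> B' o\<^sub>C\<^sub>L A = id_cblinfun"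
  show "B' = B"
  proof (rule cblinfun_eqI)
    fix x
    have "B' (A (B x)) = B x"
      using B' by (metis cblinfun_apply_compose cblinfun_apply_id)
    moreover have "A (B x) = x"
      using assms(1) by (metis cblinfun_apply_compose cblinfun_apply_id)
    ultimately show "B' x = B x" by simp
  qed
qed (use assms in simp)

text \<open>Serves \<open>D_A\<close> with \<open>C\<^sub>1(\<phi>)\<close> and
  \<open>D_{A*}\<close> with \<open>C\<^sub>2(\<phi>)\<close>, for either sign. The strict norm
  bound makes the root invertible; the kernel condition makes it the identity on the kernel of
  \<open>D\<close>.\<close>

locale weighted_root =
  fixes D C :: "'a::chilbert_space \<Rightarrow>\<^sub>C\<^sub>L 'a" and s :: real
  assumes D: "positive_op D" and C_selfadjoint: "selfadjoint C" and C_norm: "norm C < 1"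
    and C_ker: "kernel D \<subseteq> kernel C" and s: "\<bar>s\<bar> = 1"
begin

abbreviation R where "R \<equiv> op_root s C"

lemma root_base_lower: "(1 - norm C) * (norm x)\<^sup>2 \<le> inner ((id_cblinfun + s *\<^sub>R C) x) x"
proof -
  have "\<bar>s * inner (C x) x\<bar> \<le> norm (C x) * norm x"
    using Cauchy_Schwarz_ineq2[of "C x" x] by (simp add: abs_mult s)
  also have "\<dots> \<le> (norm C * norm x) * norm x"
    by (intro mult_right_mono norm_cblinfun) auto
  finally show ?thesis
    by (simp add: inner_add_left power2_norm_eq_inner[symmetric] power2_eq_square algebra_simps)
qed

lemma root_base_positive: "positive_op (id_cblinfun + s *\<^sub>R C)"
proof -
  have "0 \<le> (1 - norm C) * (norm x)\<^sup>2" for x :: 'a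
    using C_norm by simp
  then have "0 \<le> inner ((id_cblinfun + s *\<^sub>R C) x) x" for x
    using root_base_lower order_trans by blast
  then show ?thesis
    using C_selfadjoint unfolding positive_op_iff selfadjoint_iff
    by (auto simp: inner_add_left inner_add_right)
qed

lemma R_positive: "positive_op R"
  unfolding op_root_def by (intro op_sqrt root_base_positive)

lemma R_R: "R (R x) = x + s *\<^sub>R C x"
  unfolding op_root_def by (subst op_sqrt_apply) (simp_all add: root_base_positive)

lemma norm_R: "(norm (R x))\<^sup>2 = (norm x)\<^sup>2 + s * inner (C x) x"
  by (simp add: power2_norm_eq_inner positive_op_inner[OF R_positive] R_R inner_add_right
      inner_commute)

lemma R_kernel: "D x = 0 \<Longrightarrow> R x = x"
  using C_ker by (intro positive_op_fixed_point R_positive) (auto simp: R_R kernel_def)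

text \<open>\<open>R\<close> is bounded below by \<open>k\<close>, so Douglas' factorization of a
  multiple of the identity through \<open>R\<close> yields a left inverse. Its adjoint is a right
  inverse because \<open>R\<close> is selfadjoint, and the two coincide.\<close>

lemma R_inverse: "op_inverse R (R x) = x" "R (op_inverse R x) = x"
proof -
  define k where "k = sqrt (1 - norm C)"
  have k: "k > 0"
    using C_norm by (simp add: k_def)
  have "norm ((k *\<^sub>R id_cblinfun) x) \<le> norm (R x)" for x
  proof -
    have "(norm ((k *\<^sub>R id_cblinfun) x))\<^sup>2 = (1 - norm C) * (norm x)\<^sup>2"
      using C_norm by (simp add: k_def power_mult_distrib)
    also have "\<dots> \<le> inner ((id_cblinfun + s *\<^sub>R C) x) x"
      by (rule root_base_lower)
    also have "\<dots> = (norm (R x))\<^sup>2"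
      unfolding norm_R by (simp add: inner_add_left power2_norm_eq_inner)
    finally have "(norm ((k *\<^sub>R id_cblinfun) x))\<^sup>2 \<le> (norm (R x))\<^sup>2" .
    then show ?thesis
      by (rule power2_le_imp_le) simp
  qed
  from douglas_factorization[OF this] obtain K where K: "k *\<^sub>R id_cblinfun = K o\<^sub>C\<^sub>L R" by blast
  define J where "J = (1 / k) *\<^sub>R K"
  have left: "J (R x) = x" for x
  proof -
    have "K (R x) = k *\<^sub>R x"
      using K by (metis cblinfun_apply_compose cblinfun_apply_id cblinfun_apply_scaleR)
    then show ?thesis using k by (simp add: J_def)
  qed
  have adj_right: "R (adj J x) = x" for x
  proof -
    have "R o\<^sub>C\<^sub>L adj J = id_cblinfun"
      by (rule cblinfun_inner_eqI) (simp add: positive_op_inner[OF R_positive] inner_adj' left)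
    then show ?thesis
      by (metis cblinfun_apply_compose cblinfun_apply_id)
  qed
  have right: "R (J x) = x" for x
    using adj_right[of x] left[of "adj J x"] by simp
  have "op_inverse R = J"
    by (intro op_inverse_eqI cblinfun_eqI) (simp_all add: left right)
  then show "op_inverse R (R x) = x" "R (op_inverse R x) = x"
    by (simp_all add: left right)
qed

lemma op_inverse_R_inner: "inner (op_inverse R x) y = inner x (op_inverse R y)"
  by (metis R_inverse(2) R_positive positive_op_inner)

lemma adj_op_inverse_R [simp]: "adj (op_inverse R) = op_inverse R"
  by (rule adj_eqI) (rule op_inverse_R_inner)

lemma op_inverse_R_kernel: "D x = 0 \<Longrightarrow> op_inverse R x = x"
  by (metis R_inverse(1) R_kernel)

lemma kernel_D_R: "D (R x) = 0 \<Longrightarrow> D x = 0"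
  by (metis R_inverse(1) R_kernel)

text \<open>Common shape of \<open>V1_decomposition\<close> (\<open>W = adj V1\<close>,
  \<open>G\<close> the defect of \<open>B11\<close>) and \<open>U1_decomposition\<close>
  (\<open>W = U1\<close>, \<open>G\<close> the defect of its adjoint), with
  \<open>\<sigma> = sin \<phi>\<close>.\<close>

definition root_decomposition :: "'a \<Rightarrow>\<^sub>C\<^sub>L 'a \<Rightarrow> real \<Rightarrow> 'a \<Rightarrow>\<^sub>C\<^sub>L 'a \<Rightarrow> bool"
  where "root_decomposition G \<sigma> W \<longleftrightarrow> partial_isometry W \<and> initial_space W = closure (range D) \<and>
    G = \<sigma> *\<^sub>R (W o\<^sub>C\<^sub>L R o\<^sub>C\<^sub>L D)"

text \<open>The definition prescribes only the orthogonal complement of the kernel of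
  \<open>W\<close>. Splitting \<open>x\<close> along the range of \<open>adj W\<close> leaves a part
  \<open>q\<close> in that kernel and a part \<open>p\<close> in the initial space; \<open>p\<close>
  is orthogonal to both \<open>x\<close> and \<open>q\<close>, hence zero.\<close>

lemma root_decomposition_kernel:
  assumes W: "root_decomposition G \<sigma> W" and x: "D x = 0"
  shows "W x = 0"
proof -
  obtain p q where pq: "x = p + q" "p \<in> closure (range (adj W))" "\<And>y. inner (adj W y) q = 0"
    using closure_range_decompose[of "adj W" x] by auto
  have "inner (W q) (W q) = 0"
    using pq(3)[of "W q"] by (simp add: inner_adj')
  then have q: "W q = 0" by simp
  have "inner p y = 0" if "W y = 0" for y
    using pq(2) that by (intro orthogonal_closure_range[of "adj W" y p]) (simp_all add: inner_adj')
  then have "p \<in> initial_space W"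
    by (simp add: initial_space_def orthogonal_complement_def kernel_def cinner_eq_inner
        complex_eq_iff)
  then have "p \<in> orthogonal_complement (kernel D)"
    using W by (simp add: root_decomposition_def orthogonal_complement_kernel[OF D])
  then have "cinner p x = 0"
    using x by (simp add: orthogonal_complement_def kernel_def)
  then have "inner p x = 0"
    by (simp add: Re_cinner[symmetric])
  moreover have "inner p q = 0"
    using orthogonal_closure_range[of "adj W" q p] pq by blast
  ultimately have "inner p p = 0"
    using pq(1) by (simp add: inner_add_right)
  with pq q show ?thesis by simp
qed

lemma weighted_range_orthogonal:
  assumes "\<sigma> \<noteq> 0" and "\<And>y. inner ((\<sigma> *\<^sub>R (R o\<^sub>C\<^sub>L D)) y) x = 0"
  shows "D x = 0"
proof -
  have "inner (D y) (R x) = 0" for y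
    using assms(2)[of y] assms(1) by (simp add: positive_op_inner[OF R_positive])
  then have "D (R x) = 0"
    using orthogonal_range_positive[OF D] by blast
  then show ?thesis by (rule kernel_D_R)
qed

text \<open>The Douglas factor of \<open>G\<close> through \<open>\<sigma> R D\<close> is isometric
  on the closed range, since the two norms agree. The decomposition determines \<open>W\<close> on
  that range, and \<open>W\<close> must vanish on the complement; this gives uniqueness.\<close>

lemma ex1_root_decomposition:
  fixes G :: "'a \<Rightarrow>\<^sub>C\<^sub>L 'a"
  assumes \<sigma>: "\<sigma> > 0" and G: "\<And>f. (norm (G f))\<^sup>2 = \<sigma>\<^sup>2 * (norm (R (D f)))\<^sup>2"
  shows "\<exists>!W. root_decomposition G \<sigma> W"
proof -
  define M where "M = \<sigma> *\<^sub>R (R o\<^sub>C\<^sub>L D)"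
  have M_orth: "D x = 0" if "\<And>y. inner (M y) x = 0" for x
    using weighted_range_orthogonal[of \<sigma> x] \<sigma> that unfolding M_def by blast
  have norm_eq: "norm (G f) = norm (M f)" for f
  proof -
    have "(norm (G f))\<^sup>2 = (norm (M f))\<^sup>2"
      by (simp add: M_def power_mult_distrib G)
    then show ?thesis by simp
  qed
  then obtain W where W: "contraction W" "G = W o\<^sub>C\<^sub>L M" "\<And>x. (\<And>y. inner (M y) x = 0) \<Longrightarrow> W x = 0"
    using douglas_factorization[of G M] by (metis order_refl)
  have isometric: "norm (W x) = norm x" if "x \<in> closure (range M)" for x
  proof -
    have "closed {x. norm (W x) = norm x}"
      by (intro closed_Collect_eq bounded_linear.continuous_on[OF bounded_linear_cblinfun_apply]
          continuous_intros)
    moreover have "norm (W (M f)) = norm (M f)" for f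
      using norm_eq[of f] W(2) by (metis cblinfun_apply_compose)
    ultimately have "closure (range M) \<subseteq> {x. norm (W x) = norm x}"
      by (intro closure_minimal) auto
    then show ?thesis using that by blast
  qed
  \<comment> \<open>Together with \<open>M_orth\<close>: \<open>M\<close> and \<open>D\<close> have
    the same vectors orthogonal to their ranges, because \<open>R\<close> fixes the kernel of
    \<open>D\<close>.\<close>
  have orth_M: "inner (M y) x = 0" if "D x = 0" for x y
    using that by (simp add: M_def positive_op_inner[OF R_positive] R_kernel
        positive_op_inner[OF D])
  have kernel_W: "kernel W = kernel D"
  proof (intro equalityI subsetI)
    fix x assume "x \<in> kernel W"
    obtain p q where pq: "x = p + q" "p \<in> closure (range M)" "\<And>y. inner (M y) q = 0"
      using closure_range_decompose[of M x] by auto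
    have "W p = 0"
      using \<open>x \<in> kernel W\<close> pq(1) W(3)[OF pq(3)] by (simp add: kernel_def)
    then have "p = 0"
      using isometric[OF pq(2)] by simp
    then show "x \<in> kernel D"
      using M_orth[OF pq(3)] pq(1) by (simp add: kernel_def)
  next
    fix x assume "x \<in> kernel D"
    then show "x \<in> kernel W"
      using W(3)[of x] orth_M by (simp add: kernel_def)
  qed
  have initial: "initial_space W = closure (range D)"
    by (simp add: initial_space_def kernel_W orthogonal_complement_kernel[OF D])
  have "partial_isometry W"
    unfolding partial_isometry_def
  proof
    fix x assume x: "x \<in> initial_space W"
    obtain p q where pq: "x = p + q" "p \<in> closure (range M)" "\<And>y. inner (M y) q = 0"
      using closure_range_decompose[of M x] by auto
    have "D q = 0"
      by (rule M_orth[OF pq(3)])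
    then have "cinner x q = 0"
      using x unfolding initial_space_def kernel_W by (simp add: orthogonal_complement_def kernel_def)
    then have "inner x q = 0"
      by (simp add: Re_cinner[symmetric])
    moreover have "inner p q = 0"
      using orthogonal_closure_range[of M q p] pq by blast
    ultimately have "inner q q = 0"
      using pq(1) by (simp add: inner_add_left)
    then show "norm (W x) = norm x"
      using isometric[OF pq(2)] pq(1) by simp
  qed
  moreover have "G = \<sigma> *\<^sub>R (W o\<^sub>C\<^sub>L R o\<^sub>C\<^sub>L D)"
    unfolding W(2) M_def by (rule cblinfun_eqI) simp
  ultimately have exists: "root_decomposition G \<sigma> W"
    using initial by (simp add: root_decomposition_def)
  show ?thesis
  proof (rule ex1I[of _ W], rule exists)
    fix W' assume W': "root_decomposition G \<sigma> W'"
    show "W' = W"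
    proof (rule eq_on_closure_range[of M])
      show "W' (M x) = W (M x)" for x
      proof -
        have "W' (M x) = G x"
          using W' by (simp add: root_decomposition_def M_def)
        then show ?thesis using W(2) by simp
      qed
      show "W' x = W x" if "\<And>y. inner (M y) x = 0" for x
        using W(3)[OF that] root_decomposition_kernel[OF W' M_orth[OF that]] by simp
    qed simp
  qed
qed

lemma root_decomposition_contraction:
  assumes W: "root_decomposition G \<sigma> W"
  shows "contraction W"
  unfolding contraction_iff
proof
  fix x
  obtain p q where pq: "x = p + q" "p \<in> closure (range D)" "\<And>y. inner (D y) q = 0"
    using closure_range_decompose[of D x] by auto
  have "W q = 0"
    using root_decomposition_kernel[OF W] orthogonal_range_positive[OF D pq(3)] by blast
  then have "norm (W x) = norm p"
    using W pq by (simp add: root_decomposition_def partial_isometry_def)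
  moreover have "inner p q = 0"
    using orthogonal_closure_range[of D q p] pq by blast
  then have "(norm x)\<^sup>2 = (norm p)\<^sup>2 + (norm q)\<^sup>2"
    by (simp add: pq(1) power2_norm_eq_inner inner_add_left inner_add_right inner_commute)
  then have "norm p \<le> norm x"
    by (simp add: power2_le_imp_le)
  ultimately show "norm (W x) \<le> norm x" by simp
qed

text \<open>Both \<open>W x\<close> and \<open>x\<close> have the same norm and \<open>adj W\<close>
  is contractive, so expanding the squared distance of \<open>adj W (W x)\<close> from
  \<open>x\<close> leaves nothing positive.\<close>

lemma root_decomposition_adj:
  assumes W: "root_decomposition G \<sigma> W" and x: "x \<in> closure (range D)"
  shows "adj W (W x) = x"
proof -
  have "norm (W x) = norm x"
    using W x by (simp add: root_decomposition_def partial_isometry_def)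
  moreover have "norm (adj W (W x)) \<le> norm (W x)"
    using contraction_adj[OF root_decomposition_contraction[OF W]] by (simp add: contraction_iff)
  ultimately have "(norm (adj W (W x)))\<^sup>2 \<le> (norm x)\<^sup>2" "(norm (W x))\<^sup>2 = (norm x)\<^sup>2"
    by (simp_all add: power_mono)
  moreover have "inner (adj W (W x)) x = (norm (W x))\<^sup>2"
    by (simp add: inner_adj' power2_norm_eq_inner)
  moreover have "(norm (adj W (W x) - x))\<^sup>2 =
      (norm (adj W (W x)))\<^sup>2 - 2 * inner (adj W (W x)) x + (norm x)\<^sup>2"
    by (simp add: power2_norm_eq_inner inner_diff_left inner_diff_right
        inner_commute[of x "adj W (W x)"])
  ultimately have "(norm (adj W (W x) - x))\<^sup>2 \<le> 0" by linarith
  then show ?thesis by simp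
qed

text \<open>The adjoint of the decomposition, as \<open>G\<close>, \<open>R\<close> and
  \<open>D\<close> are selfadjoint. It puts \<open>adj W\<close> next to the \<open>W\<close> of the
  factors below.\<close>

lemma root_decomposition_flip:
  assumes W: "root_decomposition G \<sigma> W" and G: "positive_op G"
  shows "G x = \<sigma> *\<^sub>R D (R (adj W x))"
proof -
  have "adj G = \<sigma> *\<^sub>R (adj D o\<^sub>C\<^sub>L (adj R o\<^sub>C\<^sub>L adj W))"
    using W by (simp add: root_decomposition_def)
  then have "G = \<sigma> *\<^sub>R (D o\<^sub>C\<^sub>L (R o\<^sub>C\<^sub>L adj W))"
    by (simp only: positive_op_adj G D R_positive)
  then show ?thesis by simp
qed

lemma op_inverse_R_closure_range:
  assumes Y_ker: "kernel D \<subseteq> kernel (adj Y)"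
  shows "op_inverse R (Y y) \<in> closure (range D)"
proof -
  have "inner (op_inverse R (Y y)) x = 0" if "D x = 0" for x
  proof -
    have "inner (op_inverse R (Y y)) x = inner y (adj Y x)"
      by (simp add: inner_adj op_inverse_R_kernel[OF that])
    also have "adj Y x = 0"
      using Y_ker that by (auto simp: kernel_def)
    finally show ?thesis by simp
  qed
  then show ?thesis
    unfolding orthogonal_complement_kernel[OF D, symmetric]
    by (simp add: orthogonal_complement_def kernel_def cinner_eq_inner complex_eq_iff)
qed

context
  fixes G W :: "'a \<Rightarrow>\<^sub>C\<^sub>L 'a" and Y :: "'b::chilbert_space \<Rightarrow>\<^sub>C\<^sub>L 'a" and \<sigma> :: real
  assumes W: "root_decomposition G \<sigma> W" and Y_ker: "kernel D \<subseteq> kernel (adj Y)"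
begin

text \<open>\<open>Y\<close> will be \<open>adj V\<close> or \<open>U\<close>. The adjoint of the
  composite applies \<open>adj W\<close>, the inverse root and \<open>adj Y\<close> in turn, and the
  assumption absorbs the inverse root.\<close>

lemma root_decomposition_factor_contraction:
  assumes "\<And>g. norm (adj Y g) \<le> norm (R g)"
  shows "contraction (W o\<^sub>C\<^sub>L op_inverse R o\<^sub>C\<^sub>L Y)"
proof -
  let ?N = "W o\<^sub>C\<^sub>L op_inverse R o\<^sub>C\<^sub>L Y"
  have "norm (adj ?N x) \<le> norm x" for x
  proof -
    have "norm (adj ?N x) = norm (adj Y (op_inverse R (adj W x)))"
      by simp
    also have "\<dots> \<le> norm (adj W x)"
      using assms[of "op_inverse R (adj W x)"] by (simp add: R_inverse)
    also have "\<dots> \<le> norm x"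
      using contraction_adj[OF root_decomposition_contraction[OF W]] by (simp add: contraction_iff)
    finally show ?thesis .
  qed
  then have "contraction (adj ?N)"
    unfolding contraction_iff by blast
  then show ?thesis
    using contraction_adj by fastforce
qed

text \<open>After the flip, \<open>adj W\<close> cancels \<open>W\<close> on the closed range of
  \<open>D\<close>, where the inverse root sends the values of \<open>Y\<close>; then
  \<open>R\<close> cancels its inverse.\<close>

lemma root_decomposition_factor_eq:
  assumes G: "positive_op G"
  shows "G o\<^sub>C\<^sub>L (W o\<^sub>C\<^sub>L op_inverse R o\<^sub>C\<^sub>L Y) = \<sigma> *\<^sub>R (D o\<^sub>C\<^sub>L Y)"
proof -
  show ?thesis
    by (rule cblinfun_eqI)
      (simp add: root_decomposition_flip[OF W G] root_decomposition_adj[OF W op_inverse_R_closure_range[OF Y_ker]] R_inverse)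
qed

lemma root_decomposition_factor_kernel:
  assumes G: "positive_op G" and \<sigma>: "\<sigma> \<noteq> 0"
  shows "kernel G \<subseteq> kernel (adj (W o\<^sub>C\<^sub>L op_inverse R o\<^sub>C\<^sub>L Y))"
proof
  fix x assume "x \<in> kernel G"
  then have "D (adj W x) = 0"
    using root_decomposition_flip[OF W G, of x] \<sigma> kernel_D_R by (simp add: kernel_def)
  then have "W (adj W x) = 0"
    by (rule root_decomposition_kernel[OF W])
  then have "inner (adj W x) (adj W x) = 0"
    by (simp add: inner_adj')
  then show "x \<in> kernel (adj (W o\<^sub>C\<^sub>L op_inverse R o\<^sub>C\<^sub>L Y))"
    by (simp add: kernel_def)
qed

end

end

section \<open>The operator hole\<close>

lemma adj_B11: "adj (B11 s \<phi> A) = B11 (- s) \<phi> (adj A)"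
  by (simp add: B11_def cos_of_real)

text \<open>The mixed term of the squared norm of \<open>B11 s \<phi> A f\<close> is the imaginary
  part of \<open>A\<close>. Its factor \<open>tan \<phi>\<close> meets
  \<open>sin \<phi> * cos \<phi>\<close>, which produces the common factor
  \<open>sin\<^sup>2 \<phi>\<close>.\<close>

lemma B11_norm:
  fixes A C :: "'a::chilbert_space \<Rightarrow>\<^sub>C\<^sub>L 'a"
  assumes A: "contraction A" and s: "\<bar>s\<bar> = 1" and cos: "cos \<phi> \<noteq> 0"
    and Q: "2 *\<^sub>R im_part (adj A) = tan \<phi> *\<^sub>R (defect A o\<^sub>C\<^sub>L C o\<^sub>C\<^sub>L defect A)"
  shows "(norm f)\<^sup>2 - (norm (B11 s \<phi> A f))\<^sup>2 =
    (sin \<phi>)\<^sup>2 * ((norm (defect A f))\<^sup>2 + s * inner (C (defect A f)) (defect A f))"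
proof -
  define v where "v = \<i> *\<^sub>C f"
  have "(s * \<i> * cos \<phi>) *\<^sub>C f = (s * cos \<phi>) *\<^sub>R v"
    unfolding v_def scaleR_scaleC scaleC_scaleC by (simp add: mult_ac cos_of_real)
  then have "B11 s \<phi> A f = sin \<phi> *\<^sub>R A f + (s * cos \<phi>) *\<^sub>R v"
    by (simp add: B11_def cos_of_real)
  then have norm_B: "(norm (B11 s \<phi> A f))\<^sup>2 = (sin \<phi>)\<^sup>2 * (norm (A f))\<^sup>2 +
      2 * s * (sin \<phi> * cos \<phi> * inner (A f) v) + (s * cos \<phi>)\<^sup>2 * (norm v)\<^sup>2"
    unfolding power2_norm_eq_inner
    by (simp add: inner_add_left inner_add_right inner_commute[of v "A f"] power2_eq_square
        distrib_left)
  have norm_v: "norm v = norm f"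
    by (simp add: v_def chilbert_norm_scaleC)
  have coeff: "(s * cos \<phi>)\<^sup>2 = 1 - (sin \<phi>)\<^sup>2"
    using s by (simp add: power_mult_distrib cos_squared_eq power2_eq_1_iff abs_if split: if_splits)
  have mixed: "sin \<phi> * cos \<phi> * inner (A f) v =
      - (sin \<phi>)\<^sup>2 * inner (C (defect A f)) (defect A f) / 2"
  proof -
    have "inner ((2 *\<^sub>R im_part (adj A)) f) f = tan \<phi> * inner (C (defect A f)) (defect A f)"
      unfolding Q by (simp add: inner_defect[OF A])
    then have "inner (A f) v = - tan \<phi> * inner (C (defect A f)) (defect A f) / 2"
      unfolding inner_two_im_part_self v_def by simp
    then show ?thesis
      using cos by (simp add: tan_def power2_eq_square)
  qed
  show ?thesis
    unfolding norm_defect[OF A] norm_B coeff mixed norm_v by (simp add: algebra_simps)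
qed

lemma B11_defect:
  assumes A: "contraction A" and cos: "cos \<phi> \<noteq> 0" and root: "weighted_root (defect A) C s"
    and Q: "2 *\<^sub>R im_part (adj A) = tan \<phi> *\<^sub>R (defect A o\<^sub>C\<^sub>L C o\<^sub>C\<^sub>L defect A)"
  shows "contraction (B11 s \<phi> A)"
    and "(norm (defect (B11 s \<phi> A) f))\<^sup>2 = (sin \<phi>)\<^sup>2 * (norm (op_root s C (defect A f)))\<^sup>2"
proof -
  interpret weighted_root "defect A" C s by (rule root)
  have eq: "(norm f)\<^sup>2 - (norm (B11 s \<phi> A f))\<^sup>2 = (sin \<phi>)\<^sup>2 * (norm (op_root s C (defect A f)))\<^sup>2" for f
    unfolding norm_R by (rule B11_norm[OF A s cos Q])
  show B: "contraction (B11 s \<phi> A)"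
    unfolding contraction_iff
  proof
    fix f
    have "0 \<le> (sin \<phi>)\<^sup>2 * (norm (op_root s C (defect A f)))\<^sup>2" by simp
    then have "(norm (B11 s \<phi> A f))\<^sup>2 \<le> (norm f)\<^sup>2"
      using eq[of f] by linarith
    then show "norm (B11 s \<phi> A f) \<le> norm f"
      by (rule power2_le_imp_le) simp
  qed
  show "(norm (defect (B11 s \<phi> A) f))\<^sup>2 = (sin \<phi>)\<^sup>2 * (norm (op_root s C (defect A f)))\<^sup>2"
    unfolding norm_defect[OF B] by (rule eq)
qed

lemma op_root_minus: "op_root (- s) (- C) = op_root s C"
  by (simp add: op_root_def)

text \<open>Passing to adjoints reverses both the sign \<open>s\<close> and the imaginary part, so
  the previous result applies with \<open>- s\<close> and \<open>- C\<close>, for which the root is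
  unchanged.\<close>

lemma B11_adj_defect:
  assumes A: "contraction A" and cos: "cos \<phi> \<noteq> 0" and root: "weighted_root (defect (adj A)) C s"
    and Q: "2 *\<^sub>R im_part (adj A) = tan \<phi> *\<^sub>R (defect (adj A) o\<^sub>C\<^sub>L C o\<^sub>C\<^sub>L defect (adj A))"
  shows "(norm (defect (adj (B11 s \<phi> A)) f))\<^sup>2 = (sin \<phi>)\<^sup>2 * (norm (op_root s C (defect (adj A) f)))\<^sup>2"
proof -
  have "weighted_root (defect (adj A)) (- C) (- s)"
    using root unfolding weighted_root_def selfadjoint_iff kernel_def by simp
  moreover have "2 *\<^sub>R im_part (adj (adj A)) =
      tan \<phi> *\<^sub>R (defect (adj A) o\<^sub>C\<^sub>L (- C) o\<^sub>C\<^sub>L defect (adj A))"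
  proof (rule cblinfun_eqI)
    fix x
    have "(2 *\<^sub>R im_part (adj A)) x = tan \<phi> *\<^sub>R defect (adj A) (C (defect (adj A) x))"
      unfolding Q by simp
    then show "(2 *\<^sub>R im_part (adj (adj A))) x =
        (tan \<phi> *\<^sub>R (defect (adj A) o\<^sub>C\<^sub>L (- C) o\<^sub>C\<^sub>L defect (adj A))) x"
      unfolding im_part_adj[of "adj A"] by simp
  qed
  ultimately show ?thesis
    unfolding adj_B11 op_root_minus[symmetric, of s]
    using B11_defect(2)[OF contraction_adj[OF A] cos] by blast
qed

lemma V1_decomposition_iff:
  assumes "weighted_root (defect A) C s"
  shows "V1_decomposition s \<phi> A C V1 \<longleftrightarrow>
    weighted_root.root_decomposition (defect A) C s (defect (B11 s \<phi> A)) (sin \<phi>) (adj V1)"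
  unfolding V1_decomposition_def weighted_root.root_decomposition_def[OF assms] ..

lemma U1_decomposition_iff:
  assumes "weighted_root (defect (adj A)) C s"
  shows "U1_decomposition s \<phi> A C U1 \<longleftrightarrow>
    weighted_root.root_decomposition (defect (adj A)) C s (defect (adj (B11 s \<phi> A))) (sin \<phi>) U1"
  unfolding U1_decomposition_def weighted_root.root_decomposition_def[OF assms] ..

lemma ex1_V1_decomposition:
  fixes A :: "'a::chilbert_space \<Rightarrow>\<^sub>C\<^sub>L 'a"
  assumes A: "contraction A" and cos: "cos \<phi> \<noteq> 0" and sin: "0 < sin \<phi>"
    and root: "weighted_root (defect A) C s"
    and Q: "2 *\<^sub>R im_part (adj A) = tan \<phi> *\<^sub>R (defect A o\<^sub>C\<^sub>L C o\<^sub>C\<^sub>L defect A)"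
  shows "\<exists>!V1. V1_decomposition s \<phi> A C V1"
proof -
  have "\<exists>!W. weighted_root.root_decomposition (defect A) C s (defect (B11 s \<phi> A)) (sin \<phi>) W"
    by (rule weighted_root.ex1_root_decomposition[OF root sin]) (rule B11_defect(2)[OF A cos root Q])
  then show ?thesis
    unfolding V1_decomposition_iff[OF root] by (metis adj_adj)
qed

lemma ex1_U1_decomposition:
  fixes A :: "'a::chilbert_space \<Rightarrow>\<^sub>C\<^sub>L 'a"
  assumes A: "contraction A" and cos: "cos \<phi> \<noteq> 0" and sin: "0 < sin \<phi>"
    and root: "weighted_root (defect (adj A)) C s"
    and Q: "2 *\<^sub>R im_part (adj A) = tan \<phi> *\<^sub>R (defect (adj A) o\<^sub>C\<^sub>L C o\<^sub>C\<^sub>L defect (adj A))"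
  shows "\<exists>!U1. U1_decomposition s \<phi> A C U1"
  unfolding U1_decomposition_iff[OF root]
  by (rule weighted_root.ex1_root_decomposition[OF root sin]) (rule B11_adj_defect[OF A cos root Q])

text \<open>The second claim depends on the sandwiched form of \<open>C\<close>: the squared norm of
  \<open>g\<close> splits into those of \<open>V g\<close> and \<open>defect V g\<close>, and the
  perturbation \<open>k * inner (C g) g\<close> is at most the latter in absolute value.\<close>

lemma weighted_root_factor:
  fixes A C' :: "'a::chilbert_space \<Rightarrow>\<^sub>C\<^sub>L 'a" and V :: "'a \<Rightarrow>\<^sub>C\<^sub>L 'b::chilbert_space"
  assumes A: "contraction A" and V: "contraction V" and C': "selfadjoint C'" "contraction C'"
    and C: "C = defect V o\<^sub>C\<^sub>L C' o\<^sub>C\<^sub>L defect V" and C_ker: "kernel (defect A) \<subseteq> kernel C"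
    and k: "0 \<le> k" "k < 1" and s: "\<bar>s\<bar> = 1"
  shows "weighted_root (defect A) (k *\<^sub>R C) s"
    and "norm (V g) \<le> norm (op_root s (k *\<^sub>R C) g)"
proof -
  have "norm C \<le> 1"
    using contraction_compose[OF contraction_compose[OF defect_contraction[OF V] C'(2)]
        defect_contraction[OF V]] by (simp add: C contraction_def)
  then have "norm (k *\<^sub>R C) < 1"
    using k mult_left_mono[of "norm C" 1 k] by simp
  moreover have "selfadjoint (k *\<^sub>R C)"
    using C'(1) by (simp add: selfadjoint_iff C inner_defect[OF V])
  moreover have "kernel (defect A) \<subseteq> kernel (k *\<^sub>R C)"
    using C_ker by (auto simp: kernel_def)
  ultimately show root: "weighted_root (defect A) (k *\<^sub>R C) s"
    using s defect_positive[OF A] by unfold_locales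
  have "\<bar>s * inner ((k *\<^sub>R C) g) g\<bar> = k * \<bar>inner (C' (defect V g)) (defect V g)\<bar>"
    using k s by (simp add: C abs_mult inner_defect[OF V])
  also have "\<dots> \<le> 1 * \<bar>inner (C' (defect V g)) (defect V g)\<bar>"
    using k by (intro mult_right_mono) auto
  also have "\<dots> \<le> (norm (defect V g))\<^sup>2"
    using selfadjoint_contraction_bounds(3)[OF C'] by simp
  also have "\<dots> = (norm g)\<^sup>2 - (norm (V g))\<^sup>2"
    by (rule norm_defect[OF V])
  finally have "(norm (V g))\<^sup>2 \<le> (norm (op_root s (k *\<^sub>R C) g))\<^sup>2"
    unfolding weighted_root.norm_R[OF root] by linarith
  then show "norm (V g) \<le> norm (op_root s (k *\<^sub>R C) g)"
    by (rule power2_le_imp_le) simp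
qed

text \<open>Adding a multiple of the identity changes only the diagonal blocks. The shift of the
  last one moves the center \<open>- Vs B\<^sup>* Us\<close> to \<open>ball_center\<close>.\<close>

lemma block_in_ball_iff:
  fixes A :: "'a::chilbert_space \<Rightarrow>\<^sub>C\<^sub>L 'a" and T22 :: "'b::chilbert_space \<Rightarrow>\<^sub>C\<^sub>L 'b"
    and s \<phi> :: real
  assumes B: "contraction (B11 s \<phi> A)" and Vs: "contraction Vs" and Us: "contraction Us"
    and Vs_ker: "kernel (defect (B11 s \<phi> A)) \<subseteq> kernel Vs"
    and Us_ker: "kernel (defect (adj (B11 s \<phi> A))) \<subseteq> kernel (adj Us)"
    and T12: "defect (adj (B11 s \<phi> A)) o\<^sub>C\<^sub>L Us = sin \<phi> *\<^sub>R T12"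
    and T21: "Vs o\<^sub>C\<^sub>L defect (B11 s \<phi> A) = sin \<phi> *\<^sub>R T21"
  shows "norm (sin \<phi> *\<^sub>R op_block A T12 T21 T22 + (complex_of_real s * \<i> * complex_of_real (cos \<phi>)) *\<^sub>C id_cblinfun) \<le> 1 \<longleftrightarrow>
    sin \<phi> *\<^sub>R T22 \<in> sgn_ball s \<phi> A Vs Us"
proof -
  let ?B = "B11 s \<phi> A" and ?X = "sin \<phi> *\<^sub>R T22 + (complex_of_real s * \<i> * complex_of_real (cos \<phi>)) *\<^sub>C id_cblinfun"
  have "sin \<phi> *\<^sub>R op_block A T12 T21 T22 + (complex_of_real s * \<i> * complex_of_real (cos \<phi>)) *\<^sub>C id_cblinfun =
      op_block ?B (sin \<phi> *\<^sub>R T12) (sin \<phi> *\<^sub>R T21) ?X"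
    by (rule cblinfun_eqI) (simp add: B11_def scaleC_prod_def prod_eq_iff scaleR_add_right cos_of_real)
  then have "norm (sin \<phi> *\<^sub>R op_block A T12 T21 T22 + (complex_of_real s * \<i> * complex_of_real (cos \<phi>)) *\<^sub>C id_cblinfun) \<le> 1 \<longleftrightarrow>
      contraction (op_block ?B (defect (adj ?B) o\<^sub>C\<^sub>L Us) (Vs o\<^sub>C\<^sub>L defect ?B) ?X)"
    by (simp add: T12 T21 contraction_def)
  also have "\<dots> \<longleftrightarrow> (\<exists>K. contraction K \<and>
      ?X = defect (adj Vs) o\<^sub>C\<^sub>L K o\<^sub>C\<^sub>L defect Us - Vs o\<^sub>C\<^sub>L adj ?B o\<^sub>C\<^sub>L Us)"
    by (rule block_contraction_iff[OF B Vs Us Vs_ker Us_ker])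
  also have "\<dots> \<longleftrightarrow> (\<exists>K. contraction K \<and>
      sin \<phi> *\<^sub>R T22 = ball_center s \<phi> A Vs Us + defect (adj Vs) o\<^sub>C\<^sub>L K o\<^sub>C\<^sub>L defect Us)"
  proof -
    have minus: "(- c) *\<^sub>C id_cblinfun = - (c *\<^sub>C (id_cblinfun :: 'c::chilbert_space \<Rightarrow>\<^sub>C\<^sub>L 'c))" for c
      by (rule cblinfun_eqI) (simp add: scaleC_minus_left)
    have "adj ?B = sin \<phi> *\<^sub>R adj A - (complex_of_real s * \<i> * complex_of_real (cos \<phi>)) *\<^sub>C id_cblinfun"
      by (simp add: B11_def minus cos_of_real)
    then have "ball_center s \<phi> A Vs Us =
        - ((complex_of_real s * \<i> * complex_of_real (cos \<phi>)) *\<^sub>C id_cblinfun) - Vs o\<^sub>C\<^sub>L adj ?B o\<^sub>C\<^sub>L Us"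
      by (simp add: ball_center_def minus cos_of_real)
    moreover have "a + c = e - f \<longleftrightarrow> a = - c - f + e" for a c e f :: "'b \<Rightarrow>\<^sub>C\<^sub>L 'b"
      by (auto simp: algebra_simps)
    ultimately show ?thesis by simp
  qed
  also have "\<dots> \<longleftrightarrow> sin \<phi> *\<^sub>R T22 \<in> sgn_ball s \<phi> A Vs Us"
    unfolding sgn_ball_def operator_ball_def contraction_def by auto
  finally show ?thesis .
qed

lemma ball_characterization:
  fixes A C1 C2 V1 U1 :: "'a::chilbert_space \<Rightarrow>\<^sub>C\<^sub>L 'a" and V :: "'a \<Rightarrow>\<^sub>C\<^sub>L 'b::chilbert_space"
    and U :: "'b \<Rightarrow>\<^sub>C\<^sub>L 'a" and T22 :: "'b \<Rightarrow>\<^sub>C\<^sub>L 'b" and s \<phi> :: real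
  assumes A: "contraction A" and cos: "cos \<phi> \<noteq> 0" and sin: "0 < sin \<phi>"
    and V_ker: "kernel (defect A) \<subseteq> kernel V" and U_ker: "kernel (defect (adj A)) \<subseteq> kernel (adj U)"
    and root1: "weighted_root (defect A) C1 s" and root2: "weighted_root (defect (adj A)) C2 s"
    and Q1: "2 *\<^sub>R im_part (adj A) = tan \<phi> *\<^sub>R (defect A o\<^sub>C\<^sub>L C1 o\<^sub>C\<^sub>L defect A)"
    and V_bound: "\<And>g. norm (V g) \<le> norm (op_root s C1 g)"
    and U_bound: "\<And>g. norm (adj U g) \<le> norm (op_root s C2 g)"
    and V1: "V1_decomposition s \<phi> A C1 V1" and U1: "U1_decomposition s \<phi> A C2 U1"
  shows "contraction (V_sgn s C1 V1 V)" and "contraction (U_sgn s C2 U1 U)"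
    and "norm (sin \<phi> *\<^sub>R op_block A (defect (adj A) o\<^sub>C\<^sub>L U) (V o\<^sub>C\<^sub>L defect A) T22 +
        (complex_of_real s * \<i> * complex_of_real (cos \<phi>)) *\<^sub>C id_cblinfun) \<le> 1 \<longleftrightarrow>
      sin \<phi> *\<^sub>R T22 \<in> sgn_ball s \<phi> A (V_sgn s C1 V1 V) (U_sgn s C2 U1 U)"
proof -
  let ?B = "B11 s \<phi> A" and ?N = "adj V1 o\<^sub>C\<^sub>L op_inverse (op_root s C1) o\<^sub>C\<^sub>L adj V"
  let ?Vs = "V_sgn s C1 V1 V" and ?Us = "U_sgn s C2 U1 U"
  note W1 = V1[unfolded V1_decomposition_iff[OF root1]]
  note W2 = U1[unfolded U1_decomposition_iff[OF root2]]
  have V_ker': "kernel (defect A) \<subseteq> kernel (adj (adj V))" and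
    V_bound': "norm (adj (adj V) g) \<le> norm (op_root s C1 g)" for g
    using V_ker V_bound by simp_all
  have B: "contraction ?B"
    by (rule B11_defect(1)[OF A cos root1 Q1])
  have adj_Vs: "adj ?Vs = ?N"
    by (simp add: V_sgn_def del: adj_compose)
  have "contraction ?N"
    by (rule weighted_root.root_decomposition_factor_contraction[OF root1 W1 V_ker' V_bound'])
  then show Vs: "contraction ?Vs"
    unfolding V_sgn_def by (rule contraction_adj)
  show Us: "contraction ?Us"
    unfolding U_sgn_def
    by (rule weighted_root.root_decomposition_factor_contraction[OF root2 W2 U_ker U_bound])
  have Vs_ker: "kernel (defect ?B) \<subseteq> kernel ?Vs"
    unfolding V_sgn_def using sin
    by (intro weighted_root.root_decomposition_factor_kernel[OF root1 W1 V_ker' defect_positive[OF B]])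
      simp
  have Us_ker: "kernel (defect (adj ?B)) \<subseteq> kernel (adj ?Us)"
    unfolding U_sgn_def using sin
    by (intro weighted_root.root_decomposition_factor_kernel[OF root2 W2 U_ker
          defect_positive[OF contraction_adj[OF B]]]) simp
  have T12: "defect (adj ?B) o\<^sub>C\<^sub>L ?Us = sin \<phi> *\<^sub>R (defect (adj A) o\<^sub>C\<^sub>L U)"
    unfolding U_sgn_def
    by (rule weighted_root.root_decomposition_factor_eq[OF root2 W2 U_ker
          defect_positive[OF contraction_adj[OF B]]])
  have "defect ?B o\<^sub>C\<^sub>L ?N = sin \<phi> *\<^sub>R (defect A o\<^sub>C\<^sub>L adj V)"
    by (rule weighted_root.root_decomposition_factor_eq[OF root1 W1 V_ker' defect_positive[OF B]])
  \<comment> \<open>\<open>V_sgn\<close> is defined through its adjoint, so the factor identity is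
    proved for \<open>adj V\<close> and transposed.\<close>
  then have "adj (defect ?B o\<^sub>C\<^sub>L adj ?Vs) = adj (sin \<phi> *\<^sub>R (defect A o\<^sub>C\<^sub>L adj V))"
    unfolding adj_Vs by (rule arg_cong)
  then have T21: "?Vs o\<^sub>C\<^sub>L defect ?B = sin \<phi> *\<^sub>R (V o\<^sub>C\<^sub>L defect A)"
    by (simp add: adj_defect A B)
  show "norm (sin \<phi> *\<^sub>R op_block A (defect (adj A) o\<^sub>C\<^sub>L U) (V o\<^sub>C\<^sub>L defect A) T22 +
        (complex_of_real s * \<i> * complex_of_real (cos \<phi>)) *\<^sub>C id_cblinfun) \<le> 1 \<longleftrightarrow>
      sin \<phi> *\<^sub>R T22 \<in> sgn_ball s \<phi> A ?Vs ?Us"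
    by (rule block_in_ball_iff[OF B Vs Us Vs_ker Us_ker T12 T21])
qed

section \<open>Extensions of the dual pair as block operators\<close>

lemma op_block_eq_iff:
  "op_block A B C D = op_block A' B' C' D' \<longleftrightarrow> A = A' \<and> B = B' \<and> C = C' \<and> D = D'"
proof
  assume eq: "op_block A B C D = op_block A' B' C' D'"
  have "A x = A' x \<and> C x = C' x" for x
    using arg_cong[OF eq, of "\<lambda>T. cblinfun_apply T (x, 0)"] by simp
  moreover have "B y = B' y \<and> D y = D' y" for y
    using arg_cong[OF eq, of "\<lambda>T. cblinfun_apply T (0, y)"] by simp
  ultimately show "A = A' \<and> B = B' \<and> C = C' \<and> D = D'"
    by (auto intro!: cblinfun_eqI)
qed auto

lemma op_column_eq_iff: "op_column A B = op_column A' B' \<longleftrightarrow> A = A' \<and> B = B'"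
proof
  assume eq: "op_column A B = op_column A' B'"
  have "A x = A' x \<and> B x = B' x" for x
    using arg_cong[OF eq, of "\<lambda>T. cblinfun_apply T x"] by simp
  then show "A = A' \<and> B = B'"
    by (auto intro!: cblinfun_eqI)
qed auto

lemma dual_pair_extension_iff:
  fixes A :: "'a::chilbert_space \<Rightarrow>\<^sub>C\<^sub>L 'a" and V :: "'a \<Rightarrow>\<^sub>C\<^sub>L 'b::chilbert_space" and U :: "'b \<Rightarrow>\<^sub>C\<^sub>L 'a"
  assumes A: "contraction A"
  shows "dual_pair_extension (op_column A (V o\<^sub>C\<^sub>L defect A))
      (op_column (adj A) (adj U o\<^sub>C\<^sub>L defect (adj A))) T \<longleftrightarrow>
    (\<exists>T22. T = op_block A (defect (adj A) o\<^sub>C\<^sub>L U) (V o\<^sub>C\<^sub>L defect A) T22)"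
proof -
  have "adj U o\<^sub>C\<^sub>L defect (adj A) = adj T12 \<longleftrightarrow> T12 = defect (adj A) o\<^sub>C\<^sub>L U" for T12
    by (metis adj_adj adj_compose adj_defect contraction_adj[OF A])
  then show ?thesis
    unfolding dual_pair_extension_def op_column_eq_iff by metis
qed

theorem proposition3p17:
  fixes T1 T2 :: "'h1::chilbert_space \<Rightarrow>\<^sub>C\<^sub>L ('h1 \<times> 'h2::chilbert_space)"
    and T11 :: "'h1 \<Rightarrow>\<^sub>C\<^sub>L 'h1"
    and V :: "'h1 \<Rightarrow>\<^sub>C\<^sub>L 'h2"
    and U :: "'h2 \<Rightarrow>\<^sub>C\<^sub>L 'h1"
    and \<phi>0 :: real
  assumes dual: "dual_pair T1 T2"
    and T1_eq: "T1 = op_column T11 (V o\<^sub>C\<^sub>L defect T11)"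
    and T2_eq: "T2 = op_column (adj T11) (adj U o\<^sub>C\<^sub>L defect (adj T11))"
    and V_contr: "contraction V" and V_ker: "kernel (defect T11) \<subseteq> kernel V"
    and U_contr: "contraction U" and U_ker: "kernel (defect (adj T11)) \<subseteq> kernel (adj U)"
    and \<phi>0: "0 \<le> \<phi>0" "\<phi>0 < pi / 2"
    and sector: "sector_condition \<phi>0 T1" "sector_condition \<phi>0 T2"
  shows
    "\<exists>C1 C2 :: 'h1 \<Rightarrow>\<^sub>C\<^sub>L 'h1.
      selfadjoint C1 \<and> contraction C1 \<and> kernel (defect T11) \<subseteq> kernel C1 \<and>
      selfadjoint C2 \<and> contraction C2 \<and> kernel (defect (adj T11)) \<subseteq> kernel C2 \<and>
      (\<exists>C'. - id_cblinfun \<preceq> C' \<and> C' \<preceq> id_cblinfun \<and>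
        C1 = defect V o\<^sub>C\<^sub>L C' o\<^sub>C\<^sub>L defect V) \<and>
      (\<exists>C''. - id_cblinfun \<preceq> C'' \<and> C'' \<preceq> id_cblinfun \<and>
        C2 = defect (adj U) o\<^sub>C\<^sub>L C'' o\<^sub>C\<^sub>L defect (adj U)) \<and>
      (\<forall>\<phi>. \<phi>0 \<le> \<phi> \<and> \<phi> < pi / 2 \<and> 0 < \<phi> \<longrightarrow>
        (let C1\<phi> = (tan \<phi>0 / tan \<phi>) *\<^sub>R C1; C2\<phi> = (tan \<phi>0 / tan \<phi>) *\<^sub>R C2 in
          selfadjoint C1\<phi> \<and> contraction C1\<phi> \<and> selfadjoint C2\<phi> \<and> contraction C2\<phi> \<and>
          2 *\<^sub>R im_part (adj T11) = tan \<phi> *\<^sub>R (defect T11 o\<^sub>C\<^sub>L C1\<phi> o\<^sub>C\<^sub>L defect T11) \<and>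
          2 *\<^sub>R im_part (adj T11) =
            tan \<phi> *\<^sub>R (defect (adj T11) o\<^sub>C\<^sub>L C2\<phi> o\<^sub>C\<^sub>L defect (adj T11)))) \<and>
      (\<forall>\<phi>. \<phi>0 < \<phi> \<and> \<phi> < pi / 2 \<longrightarrow>
        (let C1\<phi> = (tan \<phi>0 / tan \<phi>) *\<^sub>R C1; C2\<phi> = (tan \<phi>0 / tan \<phi>) *\<^sub>R C2 in
          (\<forall>s\<in>{1, -1}. \<exists>!V1. V1_decomposition s \<phi> T11 C1\<phi> V1) \<and>
          (\<forall>s\<in>{1, -1}. \<exists>!U1. U1_decomposition s \<phi> T11 C2\<phi> U1) \<and>
          (\<forall>V1p V1m U1p U1m.
            V1_decomposition 1 \<phi> T11 C1\<phi> V1p \<and> V1_decomposition (-1) \<phi> T11 C1\<phi> V1m \<and>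
            U1_decomposition 1 \<phi> T11 C2\<phi> U1p \<and> U1_decomposition (-1) \<phi> T11 C2\<phi> U1m \<longrightarrow>
            (let Vp = V_sgn 1 C1\<phi> V1p V; Vm = V_sgn (-1) C1\<phi> V1m V;
                 Up = U_sgn 1 C2\<phi> U1p U; Um = U_sgn (-1) C2\<phi> U1m U;
                 L = sgn_ball 1 \<phi> T11 Vp Up \<inter> sgn_ball (-1) \<phi> T11 Vm Um in
              contraction Vp \<and> contraction Vm \<and> contraction Up \<and> contraction Um \<and>
              (\<forall>T T12 T21 T22.
                dual_pair_extension T1 T2 T \<and> T = op_block T11 T12 T21 T22 \<longrightarrow>
                (T \<in> Ext T1 T2 \<phi> \<longleftrightarrow> sin \<phi> *\<^sub>R T22 \<in> L)) \<and>
              (Ext T1 T2 \<phi> \<noteq> {} \<longleftrightarrow> L \<noteq> {})))))"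
proof -
  have T1: "contraction (op_column T11 (V o\<^sub>C\<^sub>L defect T11))"
    and T2: "contraction (op_column (adj T11) (adj U o\<^sub>C\<^sub>L defect (adj T11)))"
    using dual by (simp_all add: dual_pair_def T1_eq T2_eq)
  have A: "contraction T11" and A': "contraction (adj T11)"
    using op_column_contraction[OF T1] by (simp_all add: contraction_adj)
  note U_contr' = contraction_adj[OF U_contr]
  have tan0: "0 \<le> tan \<phi>0"
    using \<phi>0 tan_gt_zero[of \<phi>0] by (cases "\<phi>0 = 0") auto
  \<comment> \<open>One form, factored twice: through \<open>defect T11\<close> by the condition on
    \<open>T1\<close> and through \<open>defect (adj T11)\<close> by that on
    \<open>T2\<close>.\<close>
  define Q where "Q = 2 *\<^sub>R im_part (adj T11)"
  have Q_sym: "inner (Q x) y = inner x (Q y)" for x y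
    unfolding Q_def by (rule inner_two_im_part_commute)
  have "\<bar>inner (Q f) f\<bar> \<le> tan \<phi>0 * (norm (defect V (defect T11 f)))\<^sup>2" for f
    unfolding Q_def using sector(1) unfolding T1_eq by (rule sector_condition_bound[OF T1 V_contr \<phi>0])
  from selfadjoint_factorization[OF A V_contr V_ker tan0 Q_sym this]
  obtain C' where C': "selfadjoint C'" "contraction C'"
    and C1_ker: "kernel (defect T11) \<subseteq> kernel (defect V o\<^sub>C\<^sub>L C' o\<^sub>C\<^sub>L defect V)"
    and C1_Q: "Q = tan \<phi>0 *\<^sub>R (defect T11 o\<^sub>C\<^sub>L (defect V o\<^sub>C\<^sub>L C' o\<^sub>C\<^sub>L defect V) o\<^sub>C\<^sub>L defect T11)"
    by blast
  \<comment> \<open>The corner of \<open>T2\<close> is \<open>adj T11\<close>, so its condition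
    concerns \<open>- Q\<close>; the absolute value hides the sign.\<close>
  have Q_adj: "2 *\<^sub>R im_part (adj (adj T11)) = - Q"
    unfolding im_part_adj[of "adj T11"] Q_def by simp
  have "\<bar>inner (Q f) f\<bar> \<le> tan \<phi>0 * (norm (defect (adj U) (defect (adj T11) f)))\<^sup>2" for f
  proof -
    have "\<bar>inner ((2 *\<^sub>R im_part (adj (adj T11))) f) f\<bar> \<le>
        tan \<phi>0 * (norm (defect (adj U) (defect (adj T11) f)))\<^sup>2"
      using sector(2) unfolding T2_eq by (rule sector_condition_bound[OF T2 U_contr' \<phi>0])
    then show ?thesis unfolding Q_adj by simp
  qed
  from selfadjoint_factorization[OF A' U_contr' U_ker tan0 Q_sym this]
  obtain C'' where C'': "selfadjoint C''" "contraction C''"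
    and C2_ker: "kernel (defect (adj T11)) \<subseteq> kernel (defect (adj U) o\<^sub>C\<^sub>L C'' o\<^sub>C\<^sub>L defect (adj U))"
    and C2_Q: "Q = tan \<phi>0 *\<^sub>R (defect (adj T11) o\<^sub>C\<^sub>L
      (defect (adj U) o\<^sub>C\<^sub>L C'' o\<^sub>C\<^sub>L defect (adj U)) o\<^sub>C\<^sub>L defect (adj T11))"
    by blast
  define C1 where "C1 = defect V o\<^sub>C\<^sub>L C' o\<^sub>C\<^sub>L defect V"
  define C2 where "C2 = defect (adj U) o\<^sub>C\<^sub>L C'' o\<^sub>C\<^sub>L defect (adj U)"
  note C1_ker = C1_ker[folded C1_def] and C2_ker = C2_ker[folded C2_def]
  have C1: "selfadjoint C1" "contraction C1"
    using C' V_contr by (auto simp: C1_def selfadjoint_iff inner_defect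
        intro!: contraction_compose defect_contraction)
  have C2: "selfadjoint C2" "contraction C2"
    using C'' U_contr' by (auto simp: C2_def selfadjoint_iff inner_defect
        intro!: contraction_compose defect_contraction)
  have ratio: "0 \<le> tan \<phi>0 / tan \<phi>" "tan \<phi>0 / tan \<phi> \<le> 1" "0 < tan \<phi>" "\<phi>0 < \<phi> \<Longrightarrow> tan \<phi>0 / tan \<phi> < 1"
    if "\<phi>0 \<le> \<phi>" "\<phi> < pi / 2" "0 < \<phi>" for \<phi>
  proof -
    show tan: "0 < tan \<phi>"
      using that by (intro tan_gt_zero) auto
    then show "0 \<le> tan \<phi>0 / tan \<phi>"
      using tan0 by simp
    show "tan \<phi>0 / tan \<phi> \<le> 1"
      using tan that \<phi>0 tan_mono_le[of \<phi>0 \<phi>] by simp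
    show "tan \<phi>0 / tan \<phi> < 1" if "\<phi>0 < \<phi>"
      using tan that \<phi>0 \<open>\<phi> < pi / 2\<close> tan_monotone[of \<phi>0 \<phi>] by simp
  qed
  have Q1: "2 *\<^sub>R im_part (adj T11) =
      tan \<phi> *\<^sub>R (defect T11 o\<^sub>C\<^sub>L (tan \<phi>0 / tan \<phi>) *\<^sub>R C1 o\<^sub>C\<^sub>L defect T11)" if "0 < tan \<phi>" for \<phi>
    unfolding Q_def[symmetric] C1_Q C1_def[symmetric] using that by (intro cblinfun_eqI) simp
  have Q2: "2 *\<^sub>R im_part (adj T11) =
      tan \<phi> *\<^sub>R (defect (adj T11) o\<^sub>C\<^sub>L (tan \<phi>0 / tan \<phi>) *\<^sub>R C2 o\<^sub>C\<^sub>L defect (adj T11))" if "0 < tan \<phi>" for \<phi>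
    unfolding Q_def[symmetric] C2_Q C2_def[symmetric] using that by (intro cblinfun_eqI) simp
  have scaled: "selfadjoint (k *\<^sub>R C) \<and> contraction (k *\<^sub>R C)"
    if "selfadjoint C" "contraction C" "0 \<le> k" "k \<le> 1" for k :: real and C :: "'h1 \<Rightarrow>\<^sub>C\<^sub>L 'h1"
    using that by (simp add: selfadjoint_def contraction_def mult_le_one)
  have part_i: "let C1\<phi> = (tan \<phi>0 / tan \<phi>) *\<^sub>R C1; C2\<phi> = (tan \<phi>0 / tan \<phi>) *\<^sub>R C2 in
      selfadjoint C1\<phi> \<and> contraction C1\<phi> \<and> selfadjoint C2\<phi> \<and> contraction C2\<phi> \<and>
      2 *\<^sub>R im_part (adj T11) = tan \<phi> *\<^sub>R (defect T11 o\<^sub>C\<^sub>L C1\<phi> o\<^sub>C\<^sub>L defect T11) \<and>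
      2 *\<^sub>R im_part (adj T11) = tan \<phi> *\<^sub>R (defect (adj T11) o\<^sub>C\<^sub>L C2\<phi> o\<^sub>C\<^sub>L defect (adj T11))"
    if "\<phi>0 \<le> \<phi>" "\<phi> < pi / 2" "0 < \<phi>" for \<phi>
    unfolding Let_def
    using scaled[OF C1 ratio(1,2)[OF that]] scaled[OF C2 ratio(1,2)[OF that]]
      Q1[OF ratio(3)[OF that]] Q2[OF ratio(3)[OF that]] by blast
  have part_ii: "let C1\<phi> = (tan \<phi>0 / tan \<phi>) *\<^sub>R C1; C2\<phi> = (tan \<phi>0 / tan \<phi>) *\<^sub>R C2 in
      (\<forall>s\<in>{1, -1}. \<exists>!V1. V1_decomposition s \<phi> T11 C1\<phi> V1) \<and>
      (\<forall>s\<in>{1, -1}. \<exists>!U1. U1_decomposition s \<phi> T11 C2\<phi> U1) \<and>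
      (\<forall>V1p V1m U1p U1m.
        V1_decomposition 1 \<phi> T11 C1\<phi> V1p \<and> V1_decomposition (-1) \<phi> T11 C1\<phi> V1m \<and>
        U1_decomposition 1 \<phi> T11 C2\<phi> U1p \<and> U1_decomposition (-1) \<phi> T11 C2\<phi> U1m \<longrightarrow>
        (let Vp = V_sgn 1 C1\<phi> V1p V; Vm = V_sgn (-1) C1\<phi> V1m V;
             Up = U_sgn 1 C2\<phi> U1p U; Um = U_sgn (-1) C2\<phi> U1m U;
             L = sgn_ball 1 \<phi> T11 Vp Up \<inter> sgn_ball (-1) \<phi> T11 Vm Um in
          contraction Vp \<and> contraction Vm \<and> contraction Up \<and> contraction Um \<and>
          (\<forall>T T12 T21 T22.
            dual_pair_extension T1 T2 T \<and> T = op_block T11 T12 T21 T22 \<longrightarrow>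
            (T \<in> Ext T1 T2 \<phi> \<longleftrightarrow> sin \<phi> *\<^sub>R T22 \<in> L)) \<and>
          (Ext T1 T2 \<phi> \<noteq> {} \<longleftrightarrow> L \<noteq> {})))"
    if \<phi>: "\<phi>0 < \<phi>" "\<phi> < pi / 2" for \<phi>
  proof -
    define k where "k = tan \<phi>0 / tan \<phi>"
    have \<phi>_pos: "0 < \<phi>" using \<phi> \<phi>0 by simp
    have k: "0 \<le> k" "k < 1" and tan: "0 < tan \<phi>"
      using ratio[of \<phi>] \<phi> \<phi>_pos by (simp_all add: k_def)
    have sin: "0 < sin \<phi>" and cos: "cos \<phi> \<noteq> 0"
      using \<phi> \<phi>_pos sin_gt_zero[of \<phi>] cos_gt_zero[of \<phi>] by auto
    note Q1 = Q1[OF tan, folded k_def] and Q2 = Q2[OF tan, folded k_def]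
    note root1 = weighted_root_factor(1)[OF A V_contr C' C1_def C1_ker k]
    note root2 = weighted_root_factor(1)[OF A' U_contr' C'' C2_def C2_ker k]
    note bound1 = weighted_root_factor(2)[OF A V_contr C' C1_def C1_ker k]
    note bound2 = weighted_root_factor(2)[OF A' U_contr' C'' C2_def C2_ker k]
    have unit: "\<bar>s\<bar> = 1" if "s \<in> {1, -1}" for s :: real
      using that by auto
    have V1_ex: "\<exists>!V1. V1_decomposition s \<phi> T11 (k *\<^sub>R C1) V1" if "\<bar>s\<bar> = 1" for s
      by (rule ex1_V1_decomposition[OF A cos sin root1[OF that] Q1])
    have U1_ex: "\<exists>!U1. U1_decomposition s \<phi> T11 (k *\<^sub>R C2) U1" if "\<bar>s\<bar> = 1" for s
      by (rule ex1_U1_decomposition[OF A cos sin root2[OF that] Q2])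
    let ?T = "op_block T11 (defect (adj T11) o\<^sub>C\<^sub>L U) (V o\<^sub>C\<^sub>L defect T11)"
    have extension: "dual_pair_extension T1 T2 T \<longleftrightarrow> (\<exists>T22. T = ?T T22)" for T
      unfolding T1_eq T2_eq by (rule dual_pair_extension_iff[OF A])
    have hole: "contraction Vp \<and> contraction Vm \<and> contraction Up \<and> contraction Um \<and>
        (\<forall>T22. ?T T22 \<in> Ext T1 T2 \<phi> \<longleftrightarrow> sin \<phi> *\<^sub>R T22 \<in> L)"
      if dec: "V1_decomposition 1 \<phi> T11 (k *\<^sub>R C1) V1p" "V1_decomposition (-1) \<phi> T11 (k *\<^sub>R C1) V1m"
        "U1_decomposition 1 \<phi> T11 (k *\<^sub>R C2) U1p" "U1_decomposition (-1) \<phi> T11 (k *\<^sub>R C2) U1m"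
      and defs: "Vp = V_sgn 1 (k *\<^sub>R C1) V1p V" "Vm = V_sgn (-1) (k *\<^sub>R C1) V1m V"
        "Up = U_sgn 1 (k *\<^sub>R C2) U1p U" "Um = U_sgn (-1) (k *\<^sub>R C2) U1m U"
        "L = sgn_ball 1 \<phi> T11 Vp Up \<inter> sgn_ball (-1) \<phi> T11 Vm Um"
      for V1p V1m U1p U1m Vp Vm Up Um L
    proof -
      have p: "\<bar>1 :: real\<bar> = 1" and m: "\<bar>- 1 :: real\<bar> = 1" by simp_all
      note plus = ball_characterization[OF A cos sin V_ker U_ker root1[OF p] root2[OF p] Q1
          bound1[OF p] bound2[OF p] dec(1,3), folded defs]
      note minus = ball_characterization[OF A cos sin V_ker U_ker root1[OF m] root2[OF m] Q1
          bound1[OF m] bound2[OF m] dec(2,4), folded defs]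
      \<comment> \<open>In \<open>Ext\<close> the lower sign is a subtraction, in
        \<open>minus\<close> an addition with \<open>s = -1\<close>.\<close>
      have "(- c) *\<^sub>C (id_cblinfun :: ('h1 \<times> 'h2) \<Rightarrow>\<^sub>C\<^sub>L ('h1 \<times> 'h2)) = - (c *\<^sub>C id_cblinfun)" for c
        by (rule cblinfun_eqI) (simp add: scaleC_minus_left)
      then have "?T T22 \<in> Ext T1 T2 \<phi> \<longleftrightarrow> sin \<phi> *\<^sub>R T22 \<in> L" for T22
        unfolding defs(5) Ext_def using plus(3)[of T22] minus(3)[of T22] extension[of "?T T22"]
        by (auto simp: cos_of_real)
      then show ?thesis
        using plus(1,2) minus(1,2) by blast
    qed
    have nonempty: "Ext T1 T2 \<phi> \<noteq> {} \<longleftrightarrow> L \<noteq> {}"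
      if L: "\<forall>T22. ?T T22 \<in> Ext T1 T2 \<phi> \<longleftrightarrow> sin \<phi> *\<^sub>R T22 \<in> L" for L
    proof
      assume "Ext T1 T2 \<phi> \<noteq> {}"
      then obtain T where T: "T \<in> Ext T1 T2 \<phi>" by blast
      then have "dual_pair_extension T1 T2 T" by (simp add: Ext_def)
      then obtain T22 where "T = ?T T22" using extension by blast
      then show "L \<noteq> {}" using L T by blast
    next
      assume "L \<noteq> {}"
      then obtain Y where "Y \<in> L" by blast
      \<comment> \<open>As \<open>sin \<phi> > 0\<close>, every element of the hole comes from some
        \<open>T22\<close>.\<close>
      moreover have "Y = sin \<phi> *\<^sub>R ((1 / sin \<phi>) *\<^sub>R Y)"
        using sin by simp
      ultimately show "Ext T1 T2 \<phi> \<noteq> {}" using L by (metis empty_iff)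
    qed
    \<comment> \<open>The block entries are unique, so an arbitrary presentation of an extension has
      the prescribed off-diagonal entries.\<close>
    have blocks: "T = ?T T22" if "dual_pair_extension T1 T2 T" "T = op_block T11 T12 T21 T22"
      for T T12 T21 T22
      using that extension op_block_eq_iff by metis
    show ?thesis
      unfolding Let_def k_def[symmetric]
    proof (intro conjI ballI allI impI)
      show "\<exists>!V1. V1_decomposition s \<phi> T11 (k *\<^sub>R C1) V1" if "s \<in> {1, -1}" for s
        using V1_ex unit that by blast
      show "\<exists>!U1. U1_decomposition s \<phi> T11 (k *\<^sub>R C2) U1" if "s \<in> {1, -1}" for s
        using U1_ex unit that by blast
    qed (use hole[OF _ _ _ _ refl refl refl refl refl] nonempty blocks in \<open>metis+\<close>)
  qed
  show ?thesis
  proof (rule exI[of _ C1], rule exI[of _ C2], intro conjI allI impI)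
    show "\<exists>C'. - id_cblinfun \<preceq> C' \<and> C' \<preceq> id_cblinfun \<and> C1 = defect V o\<^sub>C\<^sub>L C' o\<^sub>C\<^sub>L defect V"
      using selfadjoint_contraction_bounds(1,2)[OF C'] C1_def by blast
    show "\<exists>C''. - id_cblinfun \<preceq> C'' \<and> C'' \<preceq> id_cblinfun \<and>
        C2 = defect (adj U) o\<^sub>C\<^sub>L C'' o\<^sub>C\<^sub>L defect (adj U)"
      using selfadjoint_contraction_bounds(1,2)[OF C''] C2_def by blast
  qed (use C1 C2 C1_ker C2_ker part_i part_ii in blast)+
qed

end
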